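(* Consider the known-scale model described in the context. Suppose that $k_n\sim n^a$ for some $a\in(0,1)$, and that for some $0\le\delta<1-a$ and some $v>1$: (A1) for each $n$ there is $\theta_{0n}=(\theta_{10n},\dots,\theta_{K(n)0n})$ with $\|f_{\theta_{0n}}-f_0\|_{2}=o(n^{-\delta})$; (A3) $\sum_{i=1}^{K(n)}\theta_{i0n}^2=O(n^{v})$. Let the prior be $p(\omega_n)=\prod_{i=1}^{K(n)}(2\pi\zeta^2n^u)^{-1/2}e^{-\theta_{in}^2/(2\zeta^2n^u)}$ with fixed $\zeta>0$ and $u>v$, and let $\pi^*$ be the variational posterior over the Gaussian mean-field family. Then for every $\varepsilon>0$, $\pi^*(\mathcal V_\varepsilon^c)=o_{P_0^n}(n^{-\delta})$.
   Context: Data: i.i.d. pairs $(y_i,\mathbf x_i)$, $i=1,\dots,n$, with $\mathbf x_i\sim\mathrm{Uniform}[0,1]^p$ ($p$ fixed) and $y_i=f_0(\mathbf x_i)+\xi_i$, $\xi_i\sim N(0,\sigma_0^2)$ independent of $\mathbf x_i$, where $f_0$ is square integrable on $[0,1]^p$ and $\sigma_0>0$ is known. $P_0^n$ is the true law of the data and $Z_n=o_{P_0^n}(r_n)$ means $Z_n/r_n\to0$ in $P_0^n$-probability. $\|\cdot\|_2$ is the $L_2([0,1]^p)$ norm. $\psi(u)=1/(1+e^{-u})$, $f_{\theta_n}(\mathbf x)=\beta_0+\sum_{j=1}^{k_n}\beta_j\psi(\gamma_{j0}+\sum_{h=1}^p\gamma_{jh}x_h)$, where $\theta_n=(\theta_{1n},\dots,\theta_{K(n)n})$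 lists all parameters and $K(n)$ is their number. $l_0(y,\mathbf x)=(2\pi\sigma_0^2)^{-1/2}\exp(-(y-f_0(\mathbf x))^2/(2\sigma_0^2))$, $l_{\omega_n}(y,\mathbf x)=(2\pi\sigma_0^2)^{-1/2}\exp(-(y-f_{\theta_n}(\mathbf x))^2/(2\sigma_0^2))$ with $\omega_n=\theta_n$; $L(\omega_n)=\prod_{i=1}^nl_{\omega_n}(y_i,\mathbf x_i)$. Posterior $\pi(\omega_n|\mathbf y_n,\mathbf X_n)\propto L(\omega_n)p(\omega_n)$. $d_{KL}(q,p)=\int q\log(q/p)$. Variational family $\mathcal Q_n$: product densities $\prod_{i=1}^{K(n)}N(\theta_{in};\tilde m_{in},\tilde s_{in}^2)$; variational posterior $\pi^*=\arg\min_{q\in\mathcal Q_n}d_{KL}(q,\pi(\cdot|\mathbf y_n,\mathbf X_n))$. $d_H(l_0,l_{\omega_n})=\int\int(\sqrt{l_{\omega_n}}-\sqrt{l_0})^2dy\,d\mathbf x$ and $\mathcal V_\varepsilon=\{\omega_n:d_H(l_0,l_{\omega_n})<\varepsilon\}$. *)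

theory Defs
  imports "HOL-Probability.Probability" "HOL-Library.Landau_Symbols"
begin

definition psi :: "real \<Rightarrow> real" where
  "psi u = 1 / (1 + exp (- u))"

definition nparams :: "nat \<Rightarrow> nat \<Rightarrow> nat" where
  "nparams p k = 1 + k + k * (p + 1)"

(* Parameter layout (theta :: nat => real, indices 0..<nparams p k):
     theta 0                         = beta_0
     theta j          (1 <= j <= k)  = beta_j
     theta (k + 1 + (j-1)*(p+1) + h) = gamma_{jh}   (1 <= j <= k, 0 <= h <= p)
   Inputs x :: nat => real with coordinates x 1, ..., x p. *)
definition gam_idx :: "nat \<Rightarrow> nat \<Rightarrow> nat \<Rightarrow> nat \<Rightarrow> nat" where
  "gam_idx p k j h = k + 1 + (j - 1) * (p + 1) + h"

definition nn :: "nat \<Rightarrow> nat \<Rightarrow> (nat \<Rightarrow> real) \<Rightarrow> (nat \<Rightarrow> real) \<Rightarrow> real" where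
  "nn p k \<theta> x = \<theta> 0 + (\<Sum>j\<in>{1..k}. \<theta> j *
      psi (\<theta> (gam_idx p k j 0) + (\<Sum>h\<in>{1..p}. \<theta> (gam_idx p k j h) * x h)))"

definition Xmeas :: "nat \<Rightarrow> (nat \<Rightarrow> real) measure" where
  "Xmeas p = PiM {1..p} (\<lambda>_. uniform_measure lborel {0..1::real})"

definition gauss :: "real \<Rightarrow> real \<Rightarrow> real measure" where
  "gauss m s = density lborel (normal_density m s)"

definition lik1 :: "real \<Rightarrow> ((nat \<Rightarrow> real) \<Rightarrow> real) \<Rightarrow> real \<Rightarrow> (nat \<Rightarrow> real) \<Rightarrow> real" where
  "lik1 \<sigma> f y x = normal_density (f x) \<sigma> y"

definition obs_law :: "nat \<Rightarrow> real \<Rightarrow> ((nat \<Rightarrow> real) \<Rightarrow> real) \<Rightarrow> (real \<times> (nat \<Rightarrow> real)) measure" where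
  "obs_law p \<sigma> f0 = density (lborel \<Otimes>\<^sub>M Xmeas p) (\<lambda>(y, x). lik1 \<sigma> f0 y x)"

definition data_law :: "nat \<Rightarrow> real \<Rightarrow> ((nat \<Rightarrow> real) \<Rightarrow> real) \<Rightarrow> nat
      \<Rightarrow> (nat \<Rightarrow> real \<times> (nat \<Rightarrow> real)) measure" where
  "data_law p \<sigma> f0 n = PiM {..<n} (\<lambda>_. obs_law p \<sigma> f0)"

definition likelihood :: "nat \<Rightarrow> nat \<Rightarrow> real \<Rightarrow> nat \<Rightarrow> (nat \<Rightarrow> real \<times> (nat \<Rightarrow> real))
      \<Rightarrow> (nat \<Rightarrow> real) \<Rightarrow> real" where
  "likelihood p k \<sigma> n D \<theta> = (\<Prod>i<n. lik1 \<sigma> (nn p k \<theta>) (fst (D i)) (snd (D i)))"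

definition prior :: "nat \<Rightarrow> real \<Rightarrow> real \<Rightarrow> nat \<Rightarrow> (nat \<Rightarrow> real) measure" where
  "prior K \<zeta> u n = PiM {..<K} (\<lambda>_. gauss 0 (sqrt (\<zeta>\<^sup>2 * real n powr u)))"

definition posterior :: "nat \<Rightarrow> nat \<Rightarrow> real \<Rightarrow> real \<Rightarrow> real \<Rightarrow> nat
      \<Rightarrow> (nat \<Rightarrow> real \<times> (nat \<Rightarrow> real)) \<Rightarrow> (nat \<Rightarrow> real) measure" where
  "posterior p k \<sigma> \<zeta> u n D =
     density (prior (nparams p k) \<zeta> u n)
       (\<lambda>\<theta>. ennreal (likelihood p k \<sigma> n D \<theta> /
              (\<integral>t. likelihood p k \<sigma> n D t \<partial>prior (nparams p k) \<zeta> u n)))"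

definition mf_family :: "nat \<Rightarrow> (nat \<Rightarrow> real) measure set" where
  "mf_family K = {PiM {..<K} (\<lambda>i. gauss (m i) (s i)) | m s. \<forall>i<K. s i > 0}"

(* d_KL(q, p) = int q log(q/p) ; the library's KL_divergence b M N is D(N || M) *)
definition dKL :: "'a measure \<Rightarrow> 'a measure \<Rightarrow> real" where
  "dKL q P = KL_divergence (exp 1) P q"

definition dH :: "nat \<Rightarrow> real \<Rightarrow> ((nat \<Rightarrow> real) \<Rightarrow> real) \<Rightarrow> ((nat \<Rightarrow> real) \<Rightarrow> real) \<Rightarrow> ennreal" where
  "dH p \<sigma> f0 f = (\<integral>\<^sup>+ z. ennreal ((sqrt (lik1 \<sigma> f (fst z) (snd z)) - sqrt (lik1 \<sigma> f0 (fst z) (snd z)))\<^sup>2)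
                     \<partial>(lborel \<Otimes>\<^sub>M Xmeas p))"

definition Vc :: "nat \<Rightarrow> nat \<Rightarrow> real \<Rightarrow> ((nat \<Rightarrow> real) \<Rightarrow> real) \<Rightarrow> real \<Rightarrow> (nat \<Rightarrow> real) set" where
  "Vc p k \<sigma> f0 \<epsilon> = {\<theta> \<in> PiE {..<nparams p k} (\<lambda>_. UNIV). \<not> (dH p \<sigma> f0 (nn p k \<theta>) < ennreal \<epsilon>)}"

definition L2dist :: "nat \<Rightarrow> ((nat \<Rightarrow> real) \<Rightarrow> real) \<Rightarrow> ((nat \<Rightarrow> real) \<Rightarrow> real) \<Rightarrow> real" where
  "L2dist p f g = sqrt (\<integral>x. (f x - g x)\<^sup>2 \<partial>Xmeas p)"

definition outer_prob :: "'a measure \<Rightarrow> 'a set \<Rightarrow> real" where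
  "outer_prob M S = Inf (measure M ` {A \<in> sets M. S \<subseteq> A})"

definition small_o_prob :: "(nat \<Rightarrow> 'a measure) \<Rightarrow> (nat \<Rightarrow> 'a \<Rightarrow> real) \<Rightarrow> (nat \<Rightarrow> real) \<Rightarrow> bool" where
  "small_o_prob P Z r \<longleftrightarrow>
     (\<forall>\<eta>>0. (\<lambda>n. outer_prob (P n) {\<omega> \<in> space (P n). \<eta> * r n < \<bar>Z n \<omega>\<bar>}) \<longlonglongrightarrow> 0)"

end

theory Submission
  imports Defs "HOL-Real_Asymp.Real_Asymp"
begin

text \<open>
  Let \<open>R(\<theta>)\<close> be the likelihood ratio of \<open>f\<^sub>\<theta>\<close> to \<open>f\<^sub>0\<close>, \<open>P\<close> the prior and \<open>A(q) = KL(q, P) - \<integral> log R dq\<close>.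
  Up to the log evidence, which does not depend on \<open>q\<close>, \<open>A(q)\<close> is the divergence from \<open>q\<close> to the posterior, so the
  variational posterior \<open>q*\<close> satisfies \<open>A(q*) \<le> A(q)\<close> for the Gaussian product \<open>q\<close> centred at the
  approximating network with tiny variances. The Donsker--Varadhan inequality for the test function
  \<open>c n 1\<^sub>V\<close>, with \<open>V\<close> the complement of the Hellinger ball, gives
  \<open>c n q*(V) \<le> A(q) + log \<integral> exp (c n 1\<^sub>V) R dP\<close>.
  No lower bound on the evidence is needed. The term \<open>A(q)\<close> is \<open>o(n\<^bsup>1-\<delta>\<^esup>)\<close> in probability because the mean of
  the positive part of \<open>log (1 / R)\<close> is at most \<open>n \<parallel>f\<^sub>\<theta> - f\<^sub>0\<parallel>\<^sup>2 / (2 \<sigma>\<^sup>2) + 1\<close>. The integral on the right is at most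
  \<open>n + 2\<close> with probability tending to one: \<open>\<integral> R dP\<close> has mean one, the prior mass outside a large cube is
  negligible, and inside the cube \<open>R\<close> is uniformly exponentially small on \<open>V\<close>, by a Chernoff bound for
  \<open>sqrt R\<close> at the points of a polynomially fine grid, of which there are \<open>exp (o(n))\<close>.
\<close>

subsection \<open>Products of Gaussian measures\<close>

text \<open>The obstacle is that \<open>f0\<close> is only square integrable and the parameters are
  unbounded, so no uniform bound on the difference between a network and \<open>f0\<close> is
  available. Two devices replace it. In the grid argument residuals are measured from the network at
  the grid point, not from \<open>f0\<close>: under the density of that network the residual is
  plain Gaussian noise, whose exponential moments depend on the noise level alone. In the log ratio
  only means over the data are taken, and these are squared L2 distances. With K parameters, both
  the relative entropy of the tiny Gaussian product and the logarithm of the number of grid points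
  are of order K log n, that is n^a log n. The condition a < 1 - \<delta> keeps the entropy below
  n^(1-\<delta>), and a < 1 keeps the grid below the exponential gain. Since u > v, the squared norm
  of the centre costs only a constant against the prior variance. Events about the variational
  posterior need not be measurable, so one measurable bad event is built that serves all Gaussian
  products at once.\<close>

definition gprod :: "nat \<Rightarrow> (nat \<Rightarrow> real) \<Rightarrow> (nat \<Rightarrow> real) \<Rightarrow> (nat \<Rightarrow> real) measure" where
  "gprod K m s = PiM {..<K} (\<lambda>i. gauss (m i) (s i))"

definition gdens :: "nat \<Rightarrow> (nat \<Rightarrow> real) \<Rightarrow> (nat \<Rightarrow> real) \<Rightarrow> (nat \<Rightarrow> real) \<Rightarrow> real" where
  "gdens K m s \<theta> = (\<Prod>i<K. normal_density (m i) (s i) (\<theta> i))"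

lemma sets_gauss [simp, measurable_cong]: "sets (gauss m s) = sets borel"
  by (simp add: gauss_def)

lemma space_gauss [simp]: "space (gauss m s) = UNIV"
  by (simp add: gauss_def)

lemma prob_space_gauss: "s > 0 \<Longrightarrow> prob_space (gauss m s)"
  unfolding gauss_def by (rule prob_space_normal_density)

lemma sets_gprod [simp, measurable_cong]: "sets (gprod K m s) = sets (PiM {..<K} (\<lambda>_. borel))"
  unfolding gprod_def by (intro sets_PiM_cong) auto

lemma prob_space_gprod: "\<forall>i<K. s i > 0 \<Longrightarrow> prob_space (gprod K m s)"
  unfolding gprod_def by (intro prob_space_PiM prob_space_gauss) auto

lemma gdens_pos: "\<forall>i<K. s i > 0 \<Longrightarrow> gdens K m s \<theta> > 0"
  unfolding gdens_def by (intro prod_pos) (auto intro: normal_density_pos)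

lemma measurable_gdens [measurable]: "gdens K m s \<in> borel_measurable (PiM {..<K} (\<lambda>_. borel))"
  unfolding gdens_def by measurable

lemma sets_PiM_lborel: "sets (PiM I (\<lambda>_. lborel :: real measure)) = sets (PiM I (\<lambda>_. borel))"
  by (intro sets_PiM_cong) auto

lemma gprod_eq_density:
  assumes s: "\<forall>i<K. s i > 0"
  shows "gprod K m s = density (PiM {..<K} (\<lambda>_. lborel)) (\<lambda>\<theta>. ennreal (gdens K m s \<theta>))"
proof -
  \<comment> \<open>The standard Gaussian at indices from \<open>K\<close> on is padding: the
    product locale asks for a probability measure at every index, and \<open>s\<close> is known to
    be positive only below \<open>K\<close>.\<close>
  define N where "N i = (if i < K then gauss (m i) (s i) else gauss 0 1)" for i
  interpret N: product_prob_space N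
    by (rule product_prob_spaceI) (simp add: N_def prob_space_gauss s)
  interpret L: product_sigma_finite "\<lambda>_::nat. lborel :: real measure"
    by unfold_locales
  have "density (PiM {..<K} (\<lambda>_. lborel)) (\<lambda>\<theta>. ennreal (gdens K m s \<theta>)) = PiM {..<K} N"
  proof (rule N.PiM_eqI)
    show "sets (density (PiM {..<K} (\<lambda>_. lborel)) (\<lambda>\<theta>. ennreal (gdens K m s \<theta>))) = sets (PiM {..<K} N)"
      unfolding sets_density sets_PiM_lborel
      by (intro sets_PiM_cong) (auto simp: N_def)
    fix A assume A: "\<And>i. i \<in> {..<K} \<Longrightarrow> A i \<in> sets (N i)"
    then have A': "\<And>i. i < K \<Longrightarrow> A i \<in> sets borel" by (auto simp: N_def)
    have meas: "(\<lambda>\<theta>. ennreal (gdens K m s \<theta>)) \<in> borel_measurable (PiM {..<K} (\<lambda>_. lborel))"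
      by (subst measurable_cong_sets[OF sets_PiM_lborel refl]) measurable
    have "PiE {..<K} A \<in> sets (PiM {..<K} (\<lambda>_. lborel))"
      by (intro sets_PiM_I_finite) (auto simp: A')
    then have "emeasure (density (PiM {..<K} (\<lambda>_. lborel)) (\<lambda>\<theta>. ennreal (gdens K m s \<theta>))) (PiE {..<K} A)
      = (\<integral>\<^sup>+\<theta>. ennreal (gdens K m s \<theta>) * indicator (PiE {..<K} A) \<theta> \<partial>PiM {..<K} (\<lambda>_. lborel))"
      by (intro emeasure_density meas)
    also have "\<dots> = (\<integral>\<^sup>+\<theta>. (\<Prod>i<K. ennreal (normal_density (m i) (s i) (\<theta> i)) * indicator (A i) (\<theta> i))
         \<partial>PiM {..<K} (\<lambda>_. lborel))"
    proof (intro nn_integral_cong)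
      fix \<theta> assume "\<theta> \<in> space (PiM {..<K} (\<lambda>_. lborel :: real measure))"
      then have "indicator (PiE {..<K} A) \<theta> = (\<Prod>i<K. indicator (A i) (\<theta> i) :: ennreal)"
        by (auto simp: indicator_def space_PiM PiE_def extensional_def Pi_iff prod_zero_iff)
      then show "ennreal (gdens K m s \<theta>) * indicator (PiE {..<K} A) \<theta>
         = (\<Prod>i<K. ennreal (normal_density (m i) (s i) (\<theta> i)) * indicator (A i) (\<theta> i))"
        by (simp add: gdens_def prod.distrib prod_ennreal)
    qed
    also have "\<dots> = (\<Prod>i<K. \<integral>\<^sup>+x. ennreal (normal_density (m i) (s i) x) * indicator (A i) x \<partial>lborel)"
      using A' by (subst L.product_nn_integral_prod[where f="\<lambda>i x. ennreal (normal_density (m i) (s i) x) * indicator (A i) x"]) auto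
    also have "\<dots> = (\<Prod>i\<in>{..<K}. emeasure (N i) (A i))"
      using A' by (intro prod.cong refl) (auto simp: N_def gauss_def emeasure_density)
    finally show "emeasure (density (PiM {..<K} (\<lambda>_. lborel)) (\<lambda>\<theta>. ennreal (gdens K m s \<theta>))) (PiE {..<K} A)
      = (\<Prod>i\<in>{..<K}. emeasure (N i) (A i))" .
  qed simp
  also have "PiM {..<K} N = gprod K m s"
    unfolding gprod_def by (intro PiM_cong) (auto simp: N_def)
  finally show ?thesis by simp
qed

lemma distr_gprod_component:
  assumes "\<forall>i<K. s i > 0" "i < K"
  shows "distr (gprod K m s) (gauss (m i) (s i)) (\<lambda>\<theta>. \<theta> i) = gauss (m i) (s i)"
  unfolding gprod_def using assms
  by (intro distr_PiM_component[of "{..<K}" "\<lambda>i. gauss (m i) (s i)"] prob_space_gauss) auto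

lemma measurable_gprod_component: "i < K \<Longrightarrow> (\<lambda>\<theta>. \<theta> i) \<in> measurable (gprod K m s) (gauss (m i) (s i))"
  by measurable

lemma nn_integral_gprod_component:
  assumes "\<forall>i<K. s i > 0" "i < K" and f: "f \<in> borel_measurable borel"
  shows "(\<integral>\<^sup>+\<theta>. f (\<theta> i) \<partial>gprod K m s) = (\<integral>\<^sup>+x. f x \<partial>gauss (m i) (s i))"
proof -
  have "(\<integral>\<^sup>+x. f x \<partial>gauss (m i) (s i)) = (\<integral>\<^sup>+x. f x \<partial>distr (gprod K m s) (gauss (m i) (s i)) (\<lambda>\<theta>. \<theta> i))"
    using distr_gprod_component[OF assms(1,2)] by simp
  also have "\<dots> = (\<integral>\<^sup>+\<theta>. f (\<theta> i) \<partial>gprod K m s)"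
    using measurable_gprod_component[OF assms(2)] f by (intro nn_integral_distr) auto
  finally show ?thesis ..
qed

lemma has_bochner_integral_gprod_component:
  assumes "\<forall>i<K. s i > 0" "i < K" and f: "f \<in> borel_measurable borel"
    and "has_bochner_integral (gauss (m i) (s i)) f (c::real)"
  shows "has_bochner_integral (gprod K m s) (\<lambda>\<theta>. f (\<theta> i)) c"
proof -
  have "has_bochner_integral (distr (gprod K m s) (gauss (m i) (s i)) (\<lambda>\<theta>. \<theta> i)) f c"
    using distr_gprod_component[OF assms(1,2)] assms(4) by simp
  then show ?thesis
    using measurable_gprod_component[OF assms(2)] f
    by (auto simp: has_bochner_integral_iff integrable_distr_eq integral_distr)
qed

section \<open>Moments and log densities of Gaussian products\<close>

lemma gauss_centered_second_moment:
  assumes "s > 0"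
  shows "has_bochner_integral (gauss m s) (\<lambda>x. (x - m)\<^sup>2) (s\<^sup>2)"
  unfolding gauss_def using normal_moment_even[OF assms, of m 1]
  by (intro has_bochner_integral_density) (auto simp: fact_numeral divide_simps)

lemma gauss_second_moment:
  assumes "s > 0"
  shows "has_bochner_integral (gauss m s) (\<lambda>x. x\<^sup>2) (s\<^sup>2 + m\<^sup>2)"
proof -
  interpret prob_space "gauss m s" using assms by (rule prob_space_gauss)
  have 1: "has_bochner_integral (gauss m s) (\<lambda>x. x) m"
    unfolding gauss_def using normal_moment_nz_1[OF assms, of m]
    by (intro has_bochner_integral_density) auto
  have c: "has_bochner_integral (gauss m s) (\<lambda>x. m\<^sup>2) (m\<^sup>2)"
    using prob_space by (simp add: has_bochner_integral_iff)
  have "has_bochner_integral (gauss m s) (\<lambda>x. (x - m)\<^sup>2 + 2 * m * x - m\<^sup>2) (s\<^sup>2 + 2 * m * m - m\<^sup>2)"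
    by (intro has_bochner_integral_add has_bochner_integral_diff gauss_centered_second_moment assms
         has_bochner_integral_mult_right 1 c)
  then show ?thesis
    by (simp add: power2_eq_square algebra_simps)
qed

lemma gprod_centered_second_moment:
  assumes "\<forall>i<K. s i > 0" "i < K"
  shows "has_bochner_integral (gprod K m s) (\<lambda>\<theta>. (\<theta> i - m i)\<^sup>2) ((s i)\<^sup>2)"
  using assms by (intro has_bochner_integral_gprod_component[where f="\<lambda>x. (x - m i)\<^sup>2" and i=i]
      gauss_centered_second_moment) auto

lemma gprod_second_moment:
  assumes "\<forall>i<K. s i > 0" "i < K"
  shows "has_bochner_integral (gprod K m s) (\<lambda>\<theta>. (\<theta> i)\<^sup>2) ((s i)\<^sup>2 + (m i)\<^sup>2)"
  using assms by (intro has_bochner_integral_gprod_component[where f="\<lambda>x. x\<^sup>2" and i=i]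
      gauss_second_moment) auto

lemma ln_normal_density:
  assumes "s > 0"
  shows "ln (normal_density m s x) = - (x - m)\<^sup>2 / (2 * s\<^sup>2) - ln (sqrt (2 * pi) * s)"
  using assms by (simp add: normal_density_def ln_mult ln_div real_sqrt_mult)

lemma ln_gdens:
  assumes "\<forall>i<K. s i > 0"
  shows "ln (gdens K m s \<theta>) = (\<Sum>i<K. - (\<theta> i - m i)\<^sup>2 / (2 * (s i)\<^sup>2) - ln (sqrt (2 * pi) * s i))"
proof -
  have "ln (gdens K m s \<theta>) = (\<Sum>i<K. ln (normal_density (m i) (s i) (\<theta> i)))"
    unfolding gdens_def using assms
    by (intro ln_prod) (auto simp: normal_density_pos less_imp_neq[OF normal_density_pos, symmetric])
  also have "\<dots> = (\<Sum>i<K. - (\<theta> i - m i)\<^sup>2 / (2 * (s i)\<^sup>2) - ln (sqrt (2 * pi) * s i))"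
    using assms by (intro sum.cong) (auto simp: ln_normal_density)
  finally show ?thesis .
qed

lemma integrable_gprod_second_moment:
  assumes "\<forall>i<K. s i > 0" "i < K"
  shows "integrable (gprod K m s) (\<lambda>\<theta>. (\<theta> i)\<^sup>2)"
  using gprod_second_moment[OF assms] by (simp add: has_bochner_integral_iff)

lemma integrable_gprod_component:
  assumes "\<forall>i<K. s i > 0" "i < K"
  shows "integrable (gprod K m s) (\<lambda>\<theta>. \<theta> i)"
proof -
  have "s i > 0" using assms by simp
  then have "has_bochner_integral (gauss (m i) (s i)) (\<lambda>x. x) (m i)"
    unfolding gauss_def using normal_moment_nz_1[of "s i" "m i"]
    by (intro has_bochner_integral_density) auto
  then have "has_bochner_integral (gprod K m s) (\<lambda>\<theta>. \<theta> i) (m i)"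
    by (rule has_bochner_integral_gprod_component[where f="\<lambda>x. x", OF assms measurable_ident_sets[OF refl]])
  then show ?thesis by (simp add: has_bochner_integral_iff)
qed

text \<open>A Gaussian log density is a quadratic polynomial in each coordinate, so two moments
  suffice whatever the two parameter sets are. Relative entropies within the family are therefore
  genuine integrals that may be split; a Bochner integral that does not exist would silently be
  0.\<close>

lemma integrable_ln_gdens:
  assumes "\<forall>i<K. s i > 0" "\<forall>i<K. s' i > 0"
  shows "integrable (gprod K m s) (\<lambda>\<theta>. ln (gdens K m' s' \<theta>))"
proof -
  interpret prob_space "gprod K m s" using assms(1) by (rule prob_space_gprod)
  have *: "(\<lambda>\<theta>. ln (gdens K m' s' \<theta>)) = (\<lambda>\<theta>. (\<Sum>i<K. ((- 1 / (2 * (s' i)\<^sup>2)) * (\<theta> i)\<^sup>2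
     + (m' i / (s' i)\<^sup>2) * \<theta> i) - ((m' i)\<^sup>2 / (2 * (s' i)\<^sup>2) + ln (sqrt (2 * pi) * s' i))))"
    unfolding ln_gdens[OF assms(2)]
  proof (rule ext, rule sum.cong[OF refl])
    fix \<theta> :: "nat \<Rightarrow> real" and i assume "i \<in> {..<K}"
    then have "s' i > 0" using assms(2) by simp
    then show "- (\<theta> i - m' i)\<^sup>2 / (2 * (s' i)\<^sup>2) - ln (sqrt (2 * pi) * s' i) = ((- 1 / (2 * (s' i)\<^sup>2)) * (\<theta> i)\<^sup>2
     + (m' i / (s' i)\<^sup>2) * \<theta> i) - ((m' i)\<^sup>2 / (2 * (s' i)\<^sup>2) + ln (sqrt (2 * pi) * s' i))"
      by (simp add: field_simps power2_diff)
  qed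
  have sq: "integrable (gprod K m s) (\<lambda>\<theta>. (- 1 / (2 * (s' i)\<^sup>2)) * (\<theta> i)\<^sup>2)"
    and lin: "integrable (gprod K m s) (\<lambda>\<theta>. (m' i / (s' i)\<^sup>2) * \<theta> i)" if "i < K" for i
    by (rule integrable_mult_right, rule integrable_gprod_second_moment[OF assms(1) that])
       (rule integrable_mult_right, rule integrable_gprod_component[OF assms(1) that])
  show ?thesis unfolding *
    by (rule Bochner_Integration.integrable_sum, rule Bochner_Integration.integrable_diff,
        rule Bochner_Integration.integrable_add, rule sq, simp, rule lin, simp, rule integrable_const)
qed

subsection \<open>The variational inequality\<close>

text \<open>The bound \<open>B\<close> supplies integrability; without it the Bochner integral that
  normalises the posterior could be the default value 0.\<close>

lemma evidence_pos:
  fixes L :: "(nat \<Rightarrow> real) \<Rightarrow> real"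
  assumes s: "\<forall>i<K. s i > 0" and L [measurable]: "L \<in> borel_measurable (PiM {..<K} (\<lambda>_. borel))"
    and pos: "\<And>\<theta>. 0 < L \<theta>" and bnd: "\<And>\<theta>. L \<theta> \<le> B"
  shows "0 < (\<integral>\<theta>. L \<theta> \<partial>gprod K m s)"
proof -
  interpret prob_space "gprod K m s" using s by (rule prob_space_gprod)
  have int: "integrable (gprod K m s) L"
    by (rule integrable_const_bound[where B=B]) (auto simp: bnd less_imp_le[OF pos])
  have "(\<integral>\<theta>. 0 \<partial>gprod K m s) < (\<integral>\<theta>. L \<theta> \<partial>gprod K m s)"
    using int pos by (intro integral_less_AE_space) (auto simp: emeasure_space_1)
  then show ?thesis by simp
qed

text \<open>Both measures have densities with respect to Lebesgue measure, so the Radon-Nikodym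
  derivative is a quotient of densities. The evidence \<open>Z\<close> survives only as
  \<open>ln Z\<close>, the same for all \<open>m\<close> and \<open>s\<close>.\<close>

lemma dKL_gprod:
  fixes L :: "(nat \<Rightarrow> real) \<Rightarrow> real"
  assumes s: "\<forall>i<K. s i > 0" and s0: "\<forall>i<K. s0 i > 0"
    and L [measurable]: "L \<in> borel_measurable (PiM {..<K} (\<lambda>_. borel))"
    and pos: "\<And>\<theta>. 0 < L \<theta>" and Z: "Z > 0"
    and int: "integrable (gprod K m s) (\<lambda>\<theta>. ln (L \<theta>))"
  shows "dKL (gprod K m s) (density (gprod K m0 s0) (\<lambda>\<theta>. ennreal (L \<theta> / Z)))
    = (\<integral>\<theta>. ln (gdens K m s \<theta>) - ln (gdens K m0 s0 \<theta>) - ln (L \<theta>) \<partial>gprod K m s) + ln Z"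
proof -
  let ?lam = "PiM {..<K} (\<lambda>_. lborel :: real measure)"
  let ?q = "gdens K m s" and ?p = "gdens K m0 s0"
  interpret q: prob_space "gprod K m s" using s by (rule prob_space_gprod)
  interpret prod: product_sigma_finite "\<lambda>_::nat. lborel :: real measure"
    by unfold_locales
  interpret lam: sigma_finite_measure ?lam
    by (rule prod.sigma_finite) simp
  have ms: "\<And>f :: _ \<Rightarrow> real. f \<in> borel_measurable (PiM {..<K} (\<lambda>_. borel)) \<Longrightarrow> f \<in> borel_measurable ?lam"
    using measurable_cong_sets[OF sets_PiM_lborel refl] by blast
  have mL: "L \<in> borel_measurable ?lam" and mq: "?q \<in> borel_measurable ?lam" and mp: "?p \<in> borel_measurable ?lam"
    by (auto intro!: ms)
  note [measurable] = mL mq mp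
  have qpos: "\<And>\<theta>. 0 < ?q \<theta>" and ppos: "\<And>\<theta>. 0 < ?p \<theta>"
    using gdens_pos s s0 by auto
  have post: "density (gprod K m0 s0) (\<lambda>\<theta>. ennreal (L \<theta> / Z)) = density ?lam (\<lambda>\<theta>. ennreal (?p \<theta> * (L \<theta> / Z)))"
    unfolding gprod_eq_density[OF s0]
    by (subst density_density_eq)
       (auto intro!: density_cong simp: ennreal_mult'[symmetric] less_imp_le[OF ppos] simp del: times_divide_eq_right)
  have "dKL (gprod K m s) (density (gprod K m0 s0) (\<lambda>\<theta>. ennreal (L \<theta> / Z)))
      = KL_divergence (exp 1) (density ?lam (\<lambda>\<theta>. ennreal (?p \<theta> * (L \<theta> / Z)))) (density ?lam (\<lambda>\<theta>. ennreal (?q \<theta>)))"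
    unfolding dKL_def post by (simp add: gprod_eq_density[OF s])
  also have "\<dots> = (\<integral>\<theta>. ?q \<theta> * log (exp 1) (?q \<theta> / (?p \<theta> * (L \<theta> / Z))) \<partial>?lam)"
    using qpos ppos pos Z
    by (intro lam.KL_density_density) (auto simp: less_imp_le less_imp_neq[symmetric] intro!: AE_I2 mult_nonneg_nonneg divide_nonneg_pos)
  also have "\<dots> = (\<integral>\<theta>. log (exp 1) (?q \<theta> / (?p \<theta> * (L \<theta> / Z))) \<partial>density ?lam (\<lambda>\<theta>. ennreal (?q \<theta>)))"
    using qpos by (subst integral_real_density) (auto simp: less_imp_le)
  also have "\<dots> = (\<integral>\<theta>. (ln (?q \<theta>) - ln (?p \<theta>) - ln (L \<theta>)) + ln Z \<partial>gprod K m s)"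
    unfolding gprod_eq_density[OF s, symmetric]
    using qpos ppos pos Z
    by (intro Bochner_Integration.integral_cong refl) (simp add: log_def ln_div ln_mult less_imp_neq[symmetric])
  also have "\<dots> = (\<integral>\<theta>. ln (?q \<theta>) - ln (?p \<theta>) - ln (L \<theta>) \<partial>gprod K m s) + ln Z"
    by (subst Bochner_Integration.integral_add)
       (auto intro!: Bochner_Integration.integrable_diff integrable_ln_gdens s s0 int simp: q.prob_space[simplified])
  finally show ?thesis .
qed

text \<open>The Donsker--Varadhan inequality for the test function \<^term>\<open>\<lambda>\<theta>. t * indicator V \<theta>\<close>.\<close>

lemma gprod_mass_le:
  fixes R :: "(nat \<Rightarrow> real) \<Rightarrow> real"
  assumes s: "\<forall>i<K. s i > 0" and s0: "\<forall>i<K. s0 i > 0"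
    and R [measurable]: "R \<in> borel_measurable (PiM {..<K} (\<lambda>_. borel))"
    and pos: "\<And>\<theta>. 0 < R \<theta>"
    and int: "integrable (gprod K m s) (\<lambda>\<theta>. ln (R \<theta>))"
    and V [measurable]: "V \<in> sets (PiM {..<K} (\<lambda>_. borel))"
    and M: "M > 0"
    and mass: "(\<integral>\<^sup>+\<theta>. ennreal (exp (t * indicator V \<theta>) * R \<theta>) \<partial>gprod K m0 s0) \<le> ennreal M"
  shows "t * measure (gprod K m s) V
    \<le> (\<integral>\<theta>. ln (gdens K m s \<theta>) - ln (gdens K m0 s0 \<theta>) - ln (R \<theta>) \<partial>gprod K m s) + ln M"
proof -
  let ?lam = "PiM {..<K} (\<lambda>_. lborel :: real measure)"
  let ?q = "gdens K m s" and ?p = "gdens K m0 s0"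
  let ?Q = "gprod K m s"
  interpret q: prob_space ?Q using s by (rule prob_space_gprod)
  have ms: "\<And>f :: _ \<Rightarrow> real. f \<in> borel_measurable (PiM {..<K} (\<lambda>_. borel)) \<Longrightarrow> f \<in> borel_measurable ?lam"
    using measurable_cong_sets[OF sets_PiM_lborel refl] by blast
  have qpos: "\<And>\<theta>. 0 < ?q \<theta>" and ppos: "\<And>\<theta>. 0 < ?p \<theta>"
    using gdens_pos s s0 by auto
  \<comment> \<open>\<open>f\<close> is the density with respect to \<open>?Q\<close> of the prior
    reweighted by \<open>exp (t * indicator V \<theta>) * R \<theta>\<close> and divided by
    \<open>M\<close>. The hypothesis \<open>mass\<close> says that it integrates to at most
    1.\<close>
  define f where "f \<theta> = exp (t * indicator V \<theta>) * R \<theta> * ?p \<theta> / (?q \<theta> * M)" for \<theta>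
  have fm [measurable]: "f \<in> borel_measurable (PiM {..<K} (\<lambda>_. borel))"
    unfolding f_def by measurable
  have fpos: "f \<theta> > 0" for \<theta>
    unfolding f_def using pos ppos qpos M by (intro divide_pos_pos mult_pos_pos) auto
  have em: "(\<lambda>\<theta>. exp (t * indicator V \<theta>) * R \<theta>) \<in> borel_measurable (PiM {..<K} (\<lambda>_. borel))"
    by measurable
  note [measurable] = ms[OF fm] ms[OF em] ms[OF measurable_gdens]
  have "(\<integral>\<^sup>+\<theta>. ennreal (f \<theta>) \<partial>?Q) = (\<integral>\<^sup>+\<theta>. ennreal (?q \<theta>) * ennreal (f \<theta>) \<partial>?lam)"
    unfolding gprod_eq_density[OF s] by (intro nn_integral_density) auto
  also have "\<dots> = (\<integral>\<^sup>+\<theta>. ennreal (1 / M) * (ennreal (?p \<theta>) * ennreal (exp (t * indicator V \<theta>) * R \<theta>)) \<partial>?lam)"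
    using qpos ppos pos M less_imp_neq[OF qpos, symmetric]
    by (intro nn_integral_cong) (simp add: f_def ennreal_mult'[symmetric] less_imp_le field_simps)
  also have "\<dots> = ennreal (1 / M) * (\<integral>\<^sup>+\<theta>. ennreal (?p \<theta>) * ennreal (exp (t * indicator V \<theta>) * R \<theta>) \<partial>?lam)"
    by (intro nn_integral_cmult) auto
  also have "\<dots> = ennreal (1 / M) * (\<integral>\<^sup>+\<theta>. ennreal (exp (t * indicator V \<theta>) * R \<theta>) \<partial>gprod K m0 s0)"
    unfolding gprod_eq_density[OF s0] by (subst nn_integral_density) auto
  also have "\<dots> \<le> ennreal (1 / M) * ennreal M"
    by (intro mult_left_mono mass) simp
  also have "\<dots> = 1"
    using M by (simp add: ennreal_mult'[symmetric])
  finally have nn: "(\<integral>\<^sup>+\<theta>. ennreal (f \<theta>) \<partial>?Q) \<le> 1" .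
  have fint: "integrable ?Q f"
    by (rule integrableI_nonneg) (auto simp: less_imp_le[OF fpos] intro: le_less_trans[OF nn])
  have f1: "(\<integral>\<theta>. f \<theta> \<partial>?Q) \<le> 1"
    using nn fint fpos by (subst (asm) nn_integral_eq_integral) (auto simp: less_imp_le)
  have dint: "integrable ?Q (\<lambda>\<theta>. ln (?q \<theta>) - ln (?p \<theta>) - ln (R \<theta>))"
    by (intro Bochner_Integration.integrable_diff integrable_ln_gdens s s0 int)
  have vint: "integrable ?Q (\<lambda>\<theta>. t * indicator V \<theta>)"
    by (intro integrable_mult_right) (auto simp: integrable_indicator_iff q.emeasure_eq_measure)
  have "(\<integral>\<theta>. t * indicator V \<theta> \<partial>?Q) \<le> (\<integral>\<theta>. (ln (?q \<theta>) - ln (?p \<theta>) - ln (R \<theta>)) + ln M + (f \<theta> - 1) \<partial>?Q)"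
  proof (intro integral_mono vint Bochner_Integration.integrable_add dint Bochner_Integration.integrable_diff fint q.integrable_const)
    fix \<theta>
    have "ln (f \<theta>) = t * indicator V \<theta> + ln (R \<theta>) + ln (?p \<theta>) - ln (?q \<theta>) - ln M"
      unfolding f_def using pos[of \<theta>] ppos[of \<theta>] qpos[of \<theta>] M by (simp add: ln_div ln_mult)
    \<comment> \<open>The tangent inequality stands in for Jensen: integrated against
      \<open>?Q\<close>, the remainder \<open>f \<theta> - 1\<close> is nonpositive because
      \<open>f\<close> has mean at most 1.\<close>
    moreover have "ln (f \<theta>) \<le> f \<theta> - 1"
      using fpos by (rule ln_le_minus_one)
    ultimately show "t * indicator V \<theta> \<le> (ln (?q \<theta>) - ln (?p \<theta>) - ln (R \<theta>)) + ln M + (f \<theta> - 1)"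
      by linarith
  qed
  also have "\<dots> = (\<integral>\<theta>. ln (?q \<theta>) - ln (?p \<theta>) - ln (R \<theta>) \<partial>?Q) + ln M + ((\<integral>\<theta>. f \<theta> \<partial>?Q) - 1)"
    using q.prob_space by (simp add: dint fint)
  also have "(\<integral>\<theta>. t * indicator V \<theta> \<partial>?Q) = t * measure ?Q V"
    by (simp add: Int_absorb2 sets.sets_into_space)
  finally show ?thesis using f1 by simp
qed

text \<open>Minimality enters only as a comparison with the single competitor \<open>m1\<close>,
  \<open>s1\<close>. Passing from \<open>L\<close> to \<open>L / L0\<close> adds
  \<open>ln L0\<close> to both sides, and \<open>ln Z\<close> is common to both, so the comparison
  of divergences carries over to the likelihood ratio.\<close>

lemma variational_mass_le:
  fixes L :: "(nat \<Rightarrow> real) \<Rightarrow> real"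
  assumes s: "\<forall>i<K. s i > 0" and s0: "\<forall>i<K. s0 i > 0" and s1: "\<forall>i<K. s1 i > 0"
    and L [measurable]: "L \<in> borel_measurable (PiM {..<K} (\<lambda>_. borel))"
    and pos: "\<And>\<theta>. 0 < L \<theta>" and Z: "Z > 0" and L0: "L0 > 0"
    and int: "\<And>m s. \<forall>i<K. s i > 0 \<Longrightarrow> integrable (gprod K m s) (\<lambda>\<theta>. ln (L \<theta>))"
    and V: "V \<in> sets (PiM {..<K} (\<lambda>_. borel))"
    and M: "M > 0"
    and mass: "(\<integral>\<^sup>+\<theta>. ennreal (exp (t * indicator V \<theta>) * (L \<theta> / L0)) \<partial>gprod K m0 s0) \<le> ennreal M"
    and min: "dKL (gprod K m s) (density (gprod K m0 s0) (\<lambda>\<theta>. ennreal (L \<theta> / Z)))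
      \<le> dKL (gprod K m1 s1) (density (gprod K m0 s0) (\<lambda>\<theta>. ennreal (L \<theta> / Z)))"
  shows "t * measure (gprod K m s) V
    \<le> (\<integral>\<theta>. ln (gdens K m1 s1 \<theta>) - ln (gdens K m0 s0 \<theta>) \<partial>gprod K m1 s1)
      + (\<integral>\<theta>. ln (L0 / L \<theta>) \<partial>gprod K m1 s1) + ln M"
proof -
  have lnR: "ln (L \<theta> / L0) = ln (L \<theta>) - ln L0" for \<theta>
    using pos[of \<theta>] L0 by (simp add: ln_div)
  have split: "(\<integral>\<theta>. ln (gdens K m s \<theta>) - ln (gdens K m0 s0 \<theta>) - ln (L \<theta> / L0) \<partial>gprod K m s)
     = (\<integral>\<theta>. ln (gdens K m s \<theta>) - ln (gdens K m0 s0 \<theta>) - ln (L \<theta>) \<partial>gprod K m s) + ln L0"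
    if s: "\<forall>i<K. s i > 0" for m s
  proof -
    interpret prob_space "gprod K m s" using s by (rule prob_space_gprod)
    have "(\<integral>\<theta>. ln (gdens K m s \<theta>) - ln (gdens K m0 s0 \<theta>) - ln (L \<theta> / L0) \<partial>gprod K m s)
     = (\<integral>\<theta>. (ln (gdens K m s \<theta>) - ln (gdens K m0 s0 \<theta>) - ln (L \<theta>)) + ln L0 \<partial>gprod K m s)"
      by (simp add: lnR algebra_simps)
    then show ?thesis using prob_space
      by (simp add: Bochner_Integration.integrable_diff integrable_ln_gdens s s0 int)
  qed
  have "t * measure (gprod K m s) V
    \<le> (\<integral>\<theta>. ln (gdens K m s \<theta>) - ln (gdens K m0 s0 \<theta>) - ln (L \<theta> / L0) \<partial>gprod K m s) + ln M"
  proof (rule gprod_mass_le[OF s s0 _ _ _ V M mass])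
    interpret prob_space "gprod K m s" using s by (rule prob_space_gprod)
    show "integrable (gprod K m s) (\<lambda>\<theta>. ln (L \<theta> / L0))"
      unfolding lnR by (intro Bochner_Integration.integrable_diff int s integrable_const)
  qed (use pos L0 in \<open>auto intro: divide_pos_pos\<close>)
  also have "(\<integral>\<theta>. ln (gdens K m s \<theta>) - ln (gdens K m0 s0 \<theta>) - ln (L \<theta> / L0) \<partial>gprod K m s)
     \<le> (\<integral>\<theta>. ln (gdens K m1 s1 \<theta>) - ln (gdens K m0 s0 \<theta>) - ln (L \<theta> / L0) \<partial>gprod K m1 s1)"
    using min unfolding split[OF s] split[OF s1]
    by (simp add: dKL_gprod[OF s s0 L pos Z int[OF s]] dKL_gprod[OF s1 s0 L pos Z int[OF s1]])
  also have "(\<integral>\<theta>. ln (gdens K m1 s1 \<theta>) - ln (gdens K m0 s0 \<theta>) - ln (L \<theta> / L0) \<partial>gprod K m1 s1)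
    = (\<integral>\<theta>. ln (gdens K m1 s1 \<theta>) - ln (gdens K m0 s0 \<theta>) \<partial>gprod K m1 s1)
      + (\<integral>\<theta>. ln (L0 / L \<theta>) \<partial>gprod K m1 s1)"
  proof -
    interpret prob_space "gprod K m1 s1" using s1 by (rule prob_space_gprod)
    have inv: "ln (L0 / L \<theta>) = - ln (L \<theta> / L0)" for \<theta>
      using pos[of \<theta>] L0 by (simp add: ln_div)
    have "integrable (gprod K m1 s1) (\<lambda>\<theta>. ln (L \<theta> / L0))"
      unfolding lnR by (intro Bochner_Integration.integrable_diff int s1 integrable_const)
    then show ?thesis unfolding inv
      by (simp add: Bochner_Integration.integrable_diff integrable_ln_gdens s1 s0)
  qed
  finally show ?thesis by simp
qed

text \<open>The exact divergence has a further \<open>- 1 / 2\<close> per coordinate. It is the mean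
  of the quadratic term of \<open>ln (gdens K m1 s1 \<theta>)\<close>, which is nonpositive and is
  dropped before integrating.\<close>

lemma gprod_relative_entropy_le:
  assumes s1: "\<forall>i<K. s1 i > 0" and s: "s > 0"
  shows "(\<integral>\<theta>. ln (gdens K m1 s1 \<theta>) - ln (gdens K (\<lambda>_. 0) (\<lambda>_. s) \<theta>) \<partial>gprod K m1 s1)
    \<le> (\<Sum>i<K. ln (s / s1 i) + ((s1 i)\<^sup>2 + (m1 i)\<^sup>2) / (2 * s\<^sup>2))"
proof -
  interpret prob_space "gprod K m1 s1" using s1 by (rule prob_space_gprod)
  have s': "\<forall>i<K. (\<lambda>_. s) i > 0" using s by simp
  have "has_bochner_integral (gprod K m1 s1) (\<lambda>\<theta>. \<Sum>i<K. ln (s / s1 i) + (\<theta> i)\<^sup>2 / (2 * s\<^sup>2))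
    (\<Sum>i<K. ln (s / s1 i) + ((s1 i)\<^sup>2 + (m1 i)\<^sup>2) / (2 * s\<^sup>2))"
    using gprod_second_moment[OF s1] prob_space
    by (intro has_bochner_integral_sum has_bochner_integral_add has_bochner_integral_divide_zero)
       (auto simp: has_bochner_integral_iff)
  moreover have "ln (gdens K m1 s1 \<theta>) - ln (gdens K (\<lambda>_. 0) (\<lambda>_. s) \<theta>)
     \<le> (\<Sum>i<K. ln (s / s1 i) + (\<theta> i)\<^sup>2 / (2 * s\<^sup>2))" for \<theta>
    unfolding ln_gdens[OF s1] ln_gdens[OF s'] sum_subtractf[symmetric]
  proof (rule sum_mono)
    fix i assume "i \<in> {..<K}"
    then have "s1 i > 0" using s1 by simp
    moreover have "- (\<theta> i - m1 i)\<^sup>2 / (2 * (s1 i)\<^sup>2) \<le> 0" by simp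
    ultimately show "- (\<theta> i - m1 i)\<^sup>2 / (2 * (s1 i)\<^sup>2) - ln (sqrt (2 * pi) * s1 i)
       - (- (\<theta> i - 0)\<^sup>2 / (2 * s\<^sup>2) - ln (sqrt (2 * pi) * s)) \<le> ln (s / s1 i) + (\<theta> i)\<^sup>2 / (2 * s\<^sup>2)"
      using s by (simp add: ln_mult ln_div)
  qed
  moreover have "integrable (gprod K m1 s1) (\<lambda>\<theta>. ln (gdens K m1 s1 \<theta>) - ln (gdens K (\<lambda>_. 0) (\<lambda>_. s) \<theta>))"
    using s by (intro Bochner_Integration.integrable_diff integrable_ln_gdens s1) auto
  ultimately show ?thesis
    unfolding has_bochner_integral_iff by (metis (no_types, lifting) integral_mono)
qed

subsection \<open>The network\<close>

lemma psi_bounds: "0 < psi u" "psi u < 1"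
  by (auto simp: psi_def add_pos_pos divide_simps)

text \<open>With \<open>t = u - v\<close> the difference is
  \<open>exp (- v) * (1 - exp (- t))\<close> over a denominator that is at least
  \<open>exp (- v)\<close>, and \<open>1 - exp (- t) \<le> t\<close>.\<close>

lemma psi_diff_le:
  assumes "v \<le> u"
  shows "\<bar>psi u - psi v\<bar> \<le> u - v"
proof -
  have pos: "1 + exp (- x) > 0" for x :: real by (simp add: add_pos_pos)
  have "psi u - psi v = (exp (- v) - exp (- u)) / ((1 + exp (- u)) * (1 + exp (- v)))"
    unfolding psi_def using pos[of u] pos[of v] by (simp add: divide_simps)
  also have "exp (- v) - exp (- u) = exp (- v) * (1 - exp (- (u - v)))"
    by (simp add: algebra_simps exp_add[symmetric])
  finally have eq: "psi u - psi v = exp (- v) * (1 - exp (- (u - v))) / ((1 + exp (- u)) * (1 + exp (- v)))" .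
  have nn: "0 \<le> 1 - exp (- (u - v))" using assms by simp
  have le: "1 - exp (- (u - v)) \<le> u - v" using exp_ge_add_one_self[of "- (u - v)"] by linarith
  have "exp (- v) * (1 - exp (- (u - v))) \<le> ((1 + exp (- u)) * (1 + exp (- v))) * (u - v)"
    by (intro mult_mono le nn) (auto simp: algebra_simps add_nonneg_nonneg)
  then have "psi u - psi v \<le> u - v"
    unfolding eq using pos[of u] pos[of v] by (simp add: divide_le_eq mult.commute)
  moreover have "0 \<le> psi u - psi v"
    unfolding eq using nn pos[of u] pos[of v] by (intro divide_nonneg_pos mult_pos_pos mult_nonneg_nonneg) auto
  ultimately show ?thesis by simp
qed

lemma psi_lipschitz: "\<bar>psi u - psi v\<bar> \<le> \<bar>u - v\<bar>"
  using psi_diff_le[of v u] psi_diff_le[of u v] by (cases "v \<le> u") (auto simp: abs_minus_commute)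

lemma gam_idx_less:
  assumes "j \<in> {1..k}" "h \<le> p"
  shows "gam_idx p k j h < nparams p k"
proof -
  have "(j - 1) * (p + 1) + (p + 1) = j * (p + 1)"
    using assms by (cases j) auto
  also have "\<dots> \<le> k * (p + 1)" using assms by (intro mult_right_mono) auto
  finally show ?thesis using assms unfolding gam_idx_def nparams_def by linarith
qed

lemma beta_idx_less: "j \<le> k \<Longrightarrow> j < nparams p k"
  by (simp add: nparams_def)

lemma nn_bounded: "\<bar>nn p k \<theta> x\<bar> \<le> (\<Sum>j\<le>k. \<bar>\<theta> j\<bar>)"
proof -
  have "\<bar>nn p k \<theta> x\<bar> \<le> \<bar>\<theta> 0\<bar> + (\<Sum>j\<in>{1..k}. \<bar>\<theta> j * psi (\<theta> (gam_idx p k j 0) + (\<Sum>h\<in>{1..p}. \<theta> (gam_idx p k j h) * x h))\<bar>)"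
    unfolding nn_def by (rule order_trans[OF abs_triangle_ineq]) (intro add_left_mono sum_abs)
  also have "\<dots> \<le> \<bar>\<theta> 0\<bar> + (\<Sum>j\<in>{1..k}. \<bar>\<theta> j\<bar>)"
    using psi_bounds by (intro add_left_mono sum_mono) (auto simp: abs_mult less_imp_le intro!: mult_left_le)
  also have "\<dots> = (\<Sum>j\<le>k. \<bar>\<theta> j\<bar>)"
    by (simp add: sum.atLeast1_atMost_eq atMost_atLeast0 sum.atLeast_Suc_atMost)
  finally show ?thesis .
qed

text \<open>Cauchy-Schwarz and \<open>psi < 1\<close>. The bound is free of \<open>x\<close>, which
  makes networks square integrable in the inputs; it is quadratic in the output weights, which makes
  it integrable in the parameters under Gaussian products.\<close>

lemma nn_square_le: "(nn p k \<theta> x)\<^sup>2 \<le> real (k + 1) * (\<Sum>j\<le>k. (\<theta> j)\<^sup>2)"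
proof -
  have "(nn p k \<theta> x)\<^sup>2 \<le> (\<Sum>j\<le>k. \<bar>\<theta> j\<bar>)\<^sup>2"
    using nn_bounded by (rule abs_le_square_iff[THEN iffD1, OF order_trans]) simp
  also have "\<dots> \<le> real (card {..k}) * (\<Sum>j\<le>k. \<bar>\<theta> j\<bar>\<^sup>2)"
    using sum_squared_le_sum_of_squares[of "\<lambda>j. \<bar>\<theta> j\<bar>" "{..k}"] by (simp add: mult.commute)
  finally show ?thesis by simp
qed

text \<open>Only \<open>\<theta>'\<close> has to be bounded; \<open>\<theta>\<close> is any point
  near it. The lemma thus serves grid points in a cube as well as Gaussian draws around the
  approximating network, with the bounded vector always in the place of
  \<open>\<theta>'\<close>.\<close>

lemma nn_lipschitz:
  assumes r: "\<forall>i<nparams p k. \<bar>\<theta> i - \<theta>' i\<bar> \<le> r" and C: "\<forall>i<nparams p k. \<bar>\<theta>' i\<bar> \<le> C"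
    and x: "\<forall>h\<in>{1..p}. x h \<in> {0..1}"
  shows "\<bar>nn p k \<theta> x - nn p k \<theta>' x\<bar> \<le> real (nparams p k) * (1 + C) * r"
proof -
  have r0: "r \<ge> 0" and C0: "C \<ge> 0"
    using r C beta_idx_less[of 0 k p] by (meson abs_ge_zero order_trans zero_le)+
  define A where "A t j = t (gam_idx p k j 0) + (\<Sum>h\<in>{1..p}. t (gam_idx p k j h) * x h)" for t :: "nat \<Rightarrow> real" and j
  have arg: "\<bar>A \<theta> j - A \<theta>' j\<bar> \<le> (p + 1) * r" if j: "j \<in> {1..k}" for j
  proof -
    have "A \<theta> j - A \<theta>' j = (\<theta> (gam_idx p k j 0) - \<theta>' (gam_idx p k j 0))
       + (\<Sum>h\<in>{1..p}. (\<theta> (gam_idx p k j h) - \<theta>' (gam_idx p k j h)) * x h)"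
      by (simp add: A_def sum_subtractf left_diff_distrib)
    also have "\<bar>\<dots>\<bar> \<le> r + (\<Sum>h\<in>{1..p}. r)"
    proof (rule order_trans[OF abs_triangle_ineq], rule add_mono)
      show "\<bar>\<theta> (gam_idx p k j 0) - \<theta>' (gam_idx p k j 0)\<bar> \<le> r"
        using r gam_idx_less[OF j] by auto
      have "\<bar>(\<theta> (gam_idx p k j h) - \<theta>' (gam_idx p k j h)) * x h\<bar> \<le> r * 1" if "h \<in> {1..p}" for h
        unfolding abs_mult using r gam_idx_less[OF j, of h] x that r0 by (intro mult_mono) auto
      then show "\<bar>\<Sum>h\<in>{1..p}. (\<theta> (gam_idx p k j h) - \<theta>' (gam_idx p k j h)) * x h\<bar> \<le> (\<Sum>h\<in>{1..p}. r)"
        by (intro order_trans[OF sum_abs] sum_mono) auto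
    qed
    finally show ?thesis by (simp add: algebra_simps)
  qed
  have term_le: "\<bar>\<theta> j * psi (A \<theta> j) - \<theta>' j * psi (A \<theta>' j)\<bar> \<le> r + C * ((p + 1) * r)" if j: "j \<in> {1..k}" for j
  proof -
    have jl: "j < nparams p k" using j by (intro beta_idx_less) auto
    \<comment> \<open>The split is chosen so that the change of the hidden unit is multiplied by the
      bounded weight \<open>\<theta>' j\<close>; the other part uses only
      \<open>psi < 1\<close>.\<close>
    have "\<theta> j * psi (A \<theta> j) - \<theta>' j * psi (A \<theta>' j)
       = (\<theta> j - \<theta>' j) * psi (A \<theta> j) + \<theta>' j * (psi (A \<theta> j) - psi (A \<theta>' j))"
      by (simp add: algebra_simps)
    also have "\<bar>\<dots>\<bar> \<le> r * 1 + C * ((p + 1) * r)"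
    proof (rule order_trans[OF abs_triangle_ineq], rule add_mono)
      show "\<bar>(\<theta> j - \<theta>' j) * psi (A \<theta> j)\<bar> \<le> r * 1"
        unfolding abs_mult using r jl psi_bounds[of "A \<theta> j"] r0 by (intro mult_mono) auto
      show "\<bar>\<theta>' j * (psi (A \<theta> j) - psi (A \<theta>' j))\<bar> \<le> C * ((p + 1) * r)"
        unfolding abs_mult using C jl C0 order_trans[OF psi_lipschitz arg[OF j]] by (intro mult_mono) auto
    qed
    finally show ?thesis by simp
  qed
  have "nn p k \<theta> x - nn p k \<theta>' x = (\<theta> 0 - \<theta>' 0) + (\<Sum>j\<in>{1..k}. \<theta> j * psi (A \<theta> j) - \<theta>' j * psi (A \<theta>' j))"
    by (simp add: nn_def A_def sum_subtractf)
  also have "\<bar>\<dots>\<bar> \<le> r + (\<Sum>j\<in>{1..k}. r + C * ((p + 1) * r))"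
    using r beta_idx_less[of 0 k p] term_le
    by (intro order_trans[OF abs_triangle_ineq] add_mono order_trans[OF sum_abs] sum_mono) auto
  also have "\<dots> = (1 + real k) * r + real k * real (p + 1) * (C * r)"
    by (simp add: algebra_simps)
  also have "\<dots> \<le> (1 + real k + real k * real (p + 1)) * r + (1 + real k + real k * real (p + 1)) * (C * r)"
    using r0 C0 by (intro add_mono mult_right_mono) (auto simp: distrib_left)
  also have "\<dots> = real (nparams p k) * (1 + C) * r"
    by (simp add: nparams_def algebra_simps)
  finally show ?thesis .
qed

text \<open>Parameters and inputs may both depend on \<open>w\<close>. This covers fixed parameters,
  fixed data and the joint measurability that Tonelli requires.\<close>

lemma measurable_nn:
  assumes T: "\<And>i. i < nparams p k \<Longrightarrow> (\<lambda>w. T w i) \<in> borel_measurable M"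
    and X: "\<And>h. h \<in> {1..p} \<Longrightarrow> (\<lambda>w. X w h) \<in> borel_measurable M"
  shows "(\<lambda>w. nn p k (T w) (X w)) \<in> borel_measurable M"
proof -
  have [measurable]: "psi \<in> borel_measurable borel"
    unfolding psi_def by measurable
  have "(\<lambda>w. T w (gam_idx p k j 0) + (\<Sum>h\<in>{1..p}. T w (gam_idx p k j h) * X w h)) \<in> borel_measurable M"
    if "j \<in> {1..k}" for j
    using that by (intro borel_measurable_add borel_measurable_sum borel_measurable_times T X gam_idx_less) auto
  then have "(\<lambda>w. psi (T w (gam_idx p k j 0) + (\<Sum>h\<in>{1..p}. T w (gam_idx p k j h) * X w h))) \<in> borel_measurable M"
    if "j \<in> {1..k}" for j
    using that by (intro measurable_compose[OF _ \<open>psi \<in> borel_measurable borel\<close>])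
  then show ?thesis unfolding nn_def
    by (intro borel_measurable_add borel_measurable_sum borel_measurable_times T) (auto intro: beta_idx_less)
qed

subsection \<open>The input distribution\<close>

lemma prob_space_unif01: "prob_space (uniform_measure lborel {0..1::real})"
  by (rule prob_space_uniform_measure) auto

lemma sets_Xmeas [simp, measurable_cong]: "sets (Xmeas p) = sets (PiM {1..p} (\<lambda>_. borel))"
  unfolding Xmeas_def by (intro sets_PiM_cong) auto

lemma prob_space_Xmeas: "prob_space (Xmeas p)"
  unfolding Xmeas_def by (intro prob_space_PiM prob_space_unif01)

text \<open>The space of \<open>Xmeas p\<close> contains all real vectors, while
  \<open>nn_lipschitz\<close> speaks of inputs in the cube.\<close>

lemma AE_Xmeas_cube: "AE x in Xmeas p. \<forall>h\<in>{1..p}. x h \<in> {0..1}"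
proof -
  have *: "AE t in uniform_measure lborel {0..1::real}. t \<in> {0..1}"
    by (rule AE_uniform_measureI) auto
  have "AE x in Xmeas p. x h \<in> {0..1}" if "h \<in> {1..p}" for h
    unfolding Xmeas_def
    by (rule AE_PiM_component[where P="\<lambda>t. t \<in> {0..1}", OF prob_space_unif01 that *])
  then show ?thesis by (intro AE_finite_allI) auto
qed

lemma measurable_nn_Xmeas [measurable]: "nn p k \<theta> \<in> borel_measurable (Xmeas p)"
  by (rule measurable_nn) measurable

lemma integrable_nn_diff_square:
  assumes "f0 \<in> borel_measurable (Xmeas p)" "integrable (Xmeas p) (\<lambda>x. (f0 x)\<^sup>2)"
  shows "integrable (Xmeas p) (\<lambda>x. (nn p k \<theta> x - f0 x)\<^sup>2)"
proof -
  interpret prob_space "Xmeas p" by (rule prob_space_Xmeas)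
  note [measurable] = assms(1)
  have "integrable (Xmeas p) (\<lambda>x. 2 * (real (k + 1) * (\<Sum>j\<le>k. (\<theta> j)\<^sup>2)) + 2 * (f0 x)\<^sup>2)"
    by (intro Bochner_Integration.integrable_add integrable_mult_right assms(2) integrable_const)
  then show ?thesis
  proof (rule Bochner_Integration.integrable_bound)
    show "AE x in Xmeas p. norm ((nn p k \<theta> x - f0 x)\<^sup>2) \<le> norm (2 * (real (k + 1) * (\<Sum>j\<le>k. (\<theta> j)\<^sup>2)) + 2 * (f0 x)\<^sup>2)"
    proof (rule AE_I2)
      fix x
      have "(nn p k \<theta> x - f0 x)\<^sup>2 \<le> 2 * (nn p k \<theta> x)\<^sup>2 + 2 * (f0 x)\<^sup>2"
        using sum_squares_bound[of "nn p k \<theta> x" "- f0 x"] by (simp add: power2_diff)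
      also have "\<dots> \<le> 2 * (real (k + 1) * (\<Sum>j\<le>k. (\<theta> j)\<^sup>2)) + 2 * (f0 x)\<^sup>2"
        using nn_square_le by (intro add_right_mono mult_left_mono) auto
      finally show "norm ((nn p k \<theta> x - f0 x)\<^sup>2) \<le> norm (2 * (real (k + 1) * (\<Sum>j\<le>k. (\<theta> j)\<^sup>2)) + 2 * (f0 x)\<^sup>2)"
        by (simp add: abs_of_nonneg)
    qed
  qed measurable
qed

subsection \<open>The law of one observation\<close>

lemma lik1_pos: "\<sigma> > 0 \<Longrightarrow> 0 < lik1 \<sigma> f y x"
  by (simp add: lik1_def normal_density_pos)

lemma lik1_nonneg [simp]: "0 \<le> lik1 \<sigma> f y x"
  by (simp add: lik1_def)

lemma lik1_translate: "lik1 \<sigma> f (f x + t) x = normal_density 0 \<sigma> t"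
  by (simp add: lik1_def normal_density_def)

lemma measurable_lik1:
  assumes "(\<lambda>w. f w (X w)) \<in> borel_measurable M" "Y \<in> borel_measurable M"
  shows "(\<lambda>w. lik1 \<sigma> (f w) (Y w) (X w)) \<in> borel_measurable M"
  using assms unfolding lik1_def normal_density_def by measurable

lemma measurable_lik1_pair [measurable]:
  assumes [measurable]: "f \<in> borel_measurable (Xmeas p)"
  shows "(\<lambda>z. lik1 \<sigma> f (fst z) (snd z)) \<in> borel_measurable (lborel \<Otimes>\<^sub>M Xmeas p)"
  by (rule measurable_lik1) measurable

lemma sets_obs_law [simp, measurable_cong]: "sets (obs_law p \<sigma> f) = sets (borel \<Otimes>\<^sub>M Xmeas p)"
  unfolding obs_law_def sets_density by (intro sets_pair_measure_cong) auto

lemma space_obs_law: "space (obs_law p \<sigma> f) = UNIV \<times> space (Xmeas p)"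
  using sets_eq_imp_space_eq[OF sets_obs_law] by (simp add: space_pair_measure)

lemma obs_law_eq: "obs_law p \<sigma> f = density (lborel \<Otimes>\<^sub>M Xmeas p) (\<lambda>z. ennreal (lik1 \<sigma> f (fst z) (snd z)))"
  by (simp add: obs_law_def case_prod_beta')

lemma nn_integral_translate:
  fixes g :: "real \<Rightarrow> ennreal"
  assumes "g \<in> borel_measurable borel"
  shows "(\<integral>\<^sup>+y. g y \<partial>lborel) = (\<integral>\<^sup>+t. g (c + t) \<partial>lborel)"
  using nn_integral_real_affine[OF assms, of 1 c] by simp

text \<open>The substitution \<open>y = f x + t\<close> turns the density into centred noise. As
  \<open>f\<close> is arbitrary, integrals against the density of a network also become Gaussian
  integrals, with no trace of \<open>f0\<close>.\<close>

lemma nn_integral_lik1: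
  fixes g :: "real \<times> (nat \<Rightarrow> real) \<Rightarrow> ennreal"
  assumes f [measurable]: "f \<in> borel_measurable (Xmeas p)"
    and g [measurable]: "g \<in> borel_measurable (borel \<Otimes>\<^sub>M Xmeas p)"
  shows "(\<integral>\<^sup>+z. ennreal (lik1 \<sigma> f (fst z) (snd z)) * g z \<partial>(lborel \<Otimes>\<^sub>M Xmeas p))
    = (\<integral>\<^sup>+x. (\<integral>\<^sup>+t. g (f x + t, x) \<partial>gauss 0 \<sigma>) \<partial>Xmeas p)"
proof -
  interpret X: prob_space "Xmeas p" by (rule prob_space_Xmeas)
  interpret pair_sigma_finite "lborel :: real measure" "Xmeas p" by unfold_locales
  have "(\<integral>\<^sup>+z. ennreal (lik1 \<sigma> f (fst z) (snd z)) * g z \<partial>(lborel \<Otimes>\<^sub>M Xmeas p))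
     = (\<integral>\<^sup>+x. (\<integral>\<^sup>+y. ennreal (lik1 \<sigma> f y x) * g (y, x) \<partial>lborel) \<partial>Xmeas p)"
    by (subst nn_integral_snd[symmetric]) (auto simp: case_prod_beta')
  also have "\<dots> = (\<integral>\<^sup>+x. (\<integral>\<^sup>+t. g (f x + t, x) \<partial>gauss 0 \<sigma>) \<partial>Xmeas p)"
  proof (rule nn_integral_cong)
    fix x assume x [measurable]: "x \<in> space (Xmeas p)"
    have gm [measurable]: "(\<lambda>y. g (y, x)) \<in> borel_measurable borel"
      using g x by measurable
    have [measurable]: "(\<lambda>y. lik1 \<sigma> f y x) \<in> borel_measurable borel"
      unfolding lik1_def normal_density_def by measurable
    have "(\<integral>\<^sup>+y. ennreal (lik1 \<sigma> f y x) * g (y, x) \<partial>lborel)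
      = (\<integral>\<^sup>+t. ennreal (lik1 \<sigma> f (f x + t) x) * g (f x + t, x) \<partial>lborel)"
      by (rule nn_integral_translate) measurable
    also have "\<dots> = (\<integral>\<^sup>+t. g (f x + t, x) \<partial>gauss 0 \<sigma>)"
      unfolding gauss_def lik1_translate by (subst nn_integral_density) auto
    finally show "(\<integral>\<^sup>+y. ennreal (lik1 \<sigma> f y x) * g (y, x) \<partial>lborel) = (\<integral>\<^sup>+t. g (f x + t, x) \<partial>gauss 0 \<sigma>)" .
  qed
  finally show ?thesis .
qed

lemma nn_integral_lik1_eq_1:
  assumes f: "f \<in> borel_measurable (Xmeas p)" and \<sigma>: "\<sigma> > 0"
  shows "(\<integral>\<^sup>+z. ennreal (lik1 \<sigma> f (fst z) (snd z)) \<partial>(lborel \<Otimes>\<^sub>M Xmeas p)) = 1"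
  using nn_integral_lik1[OF f, of "\<lambda>_. 1" \<sigma>] prob_space.emeasure_space_1[OF prob_space_gauss[OF \<sigma>]]
    prob_space.emeasure_space_1[OF prob_space_Xmeas] by simp

lemma nn_integral_obs_law:
  fixes g :: "real \<times> (nat \<Rightarrow> real) \<Rightarrow> ennreal"
  assumes [measurable]: "f \<in> borel_measurable (Xmeas p)" "g \<in> borel_measurable (borel \<Otimes>\<^sub>M Xmeas p)"
  shows "(\<integral>\<^sup>+z. g z \<partial>obs_law p \<sigma> f)
     = (\<integral>\<^sup>+z. ennreal (lik1 \<sigma> f (fst z) (snd z)) * g z \<partial>(lborel \<Otimes>\<^sub>M Xmeas p))"
proof -
  have [measurable]: "g \<in> borel_measurable (lborel \<Otimes>\<^sub>M Xmeas p)"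
    using assms(2) by (subst measurable_cong_sets[OF sets_pair_measure_cong[OF sets_lborel refl] refl])
  show ?thesis unfolding obs_law_eq by (rule nn_integral_density) measurable
qed

lemma prob_space_obs_law:
  assumes f: "f \<in> borel_measurable (Xmeas p)" and \<sigma>: "\<sigma> > 0"
  shows "prob_space (obs_law p \<sigma> f)"
proof
  show "emeasure (obs_law p \<sigma> f) (space (obs_law p \<sigma> f)) = 1"
    using nn_integral_obs_law[OF f, of "\<lambda>_. 1" \<sigma>] nn_integral_lik1_eq_1[OF f \<sigma>] by simp
qed

text \<open>Writing the observation as signal plus independent noise lets Fubini on a product
  measure handle signed integrands.\<close>

lemma obs_law_eq_distr:
  assumes f [measurable]: "f \<in> borel_measurable (Xmeas p)" and \<sigma>: "\<sigma> > 0"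
  shows "obs_law p \<sigma> f = distr (gauss 0 \<sigma> \<Otimes>\<^sub>M Xmeas p) (borel \<Otimes>\<^sub>M Xmeas p) (\<lambda>z. (f (snd z) + fst z, snd z))"
proof (rule measure_eqI)
  interpret N: prob_space "gauss 0 \<sigma>" using \<sigma> by (rule prob_space_gauss)
  interpret X: prob_space "Xmeas p" by (rule prob_space_Xmeas)
  interpret pair_sigma_finite "gauss 0 \<sigma>" "Xmeas p" by unfold_locales
  show "sets (obs_law p \<sigma> f) = sets (distr (gauss 0 \<sigma> \<Otimes>\<^sub>M Xmeas p) (borel \<Otimes>\<^sub>M Xmeas p) (\<lambda>z. (f (snd z) + fst z, snd z)))"
    by simp
  fix A assume A: "A \<in> sets (obs_law p \<sigma> f)"
  then have A' [measurable]: "A \<in> sets (borel \<Otimes>\<^sub>M Xmeas p)" by simp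
  have "emeasure (obs_law p \<sigma> f) A = (\<integral>\<^sup>+z. indicator A z \<partial>obs_law p \<sigma> f)"
    using A by simp
  also have "\<dots> = (\<integral>\<^sup>+x. (\<integral>\<^sup>+t. indicator A (f x + t, x) \<partial>gauss 0 \<sigma>) \<partial>Xmeas p)"
    by (simp add: nn_integral_obs_law nn_integral_lik1)
  also have "\<dots> = (\<integral>\<^sup>+z. indicator A (f (snd z) + fst z, snd z) \<partial>(gauss 0 \<sigma> \<Otimes>\<^sub>M Xmeas p))"
    by (subst nn_integral_snd[symmetric]) (auto simp: case_prod_beta')
  also have "\<dots> = (\<integral>\<^sup>+z. indicator A z \<partial>distr (gauss 0 \<sigma> \<Otimes>\<^sub>M Xmeas p) (borel \<Otimes>\<^sub>M Xmeas p) (\<lambda>z. (f (snd z) + fst z, snd z)))"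
    by (subst nn_integral_distr) auto
  also have "\<dots> = emeasure (distr (gauss 0 \<sigma> \<Otimes>\<^sub>M Xmeas p) (borel \<Otimes>\<^sub>M Xmeas p) (\<lambda>z. (f (snd z) + fst z, snd z))) A"
    using A' by (intro nn_integral_indicator) simp
  finally show "emeasure (obs_law p \<sigma> f) A
    = emeasure (distr (gauss 0 \<sigma> \<Otimes>\<^sub>M Xmeas p) (borel \<Otimes>\<^sub>M Xmeas p) (\<lambda>z. (f (snd z) + fst z, snd z))) A"
    .
qed

lemma AE_obs_law_cube:
  assumes f: "f \<in> borel_measurable (Xmeas p)" and \<sigma>: "\<sigma> > 0"
  shows "AE z in obs_law p \<sigma> f. \<forall>h\<in>{1..p}. snd z h \<in> {0..1}"
proof -
  let ?B = "{x \<in> space (Xmeas p). \<not> (\<forall>h\<in>{1..p}. x h \<in> {0..1})}"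
  have B [measurable]: "?B \<in> sets (Xmeas p)" by measurable
  have "(\<integral>\<^sup>+z. indicator ?B (snd z) \<partial>obs_law p \<sigma> f)
    = (\<integral>\<^sup>+x. (\<integral>\<^sup>+t. indicator ?B x \<partial>gauss 0 \<sigma>) \<partial>Xmeas p)"
    by (simp add: nn_integral_obs_law[OF f] nn_integral_lik1[OF f])
  also have "\<dots> = (\<integral>\<^sup>+x. indicator ?B x \<partial>Xmeas p)"
    using prob_space.emeasure_space_1[OF prob_space_gauss[OF \<sigma>, of 0]] by simp
  also have "\<dots> = emeasure (Xmeas p) ?B"
    using B by (rule nn_integral_indicator)
  also have "\<dots> = 0"
    using AE_Xmeas_cube[of p] B by (subst (asm) AE_iff_measurable[OF B]) auto
  finally have "AE z in obs_law p \<sigma> f. indicator ?B (snd z) = (0::ennreal)"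
    by (subst (asm) nn_integral_0_iff_AE) auto
  then show ?thesis
    using AE_space by eventually_elim (auto simp: space_obs_law indicator_def split: if_splits)
qed

text \<open>Gaussian densities vanish nowhere, so the denominator cancels everywhere and the full
  mass of the other density is left.\<close>

lemma nn_integral_likelihood_ratio:
  assumes f0 [measurable]: "f0 \<in> borel_measurable (Xmeas p)" and f [measurable]: "f \<in> borel_measurable (Xmeas p)"
    and \<sigma>: "\<sigma> > 0"
  shows "(\<integral>\<^sup>+z. ennreal (lik1 \<sigma> f (fst z) (snd z) / lik1 \<sigma> f0 (fst z) (snd z)) \<partial>obs_law p \<sigma> f0) = 1"
proof -
  have [measurable]: "(\<lambda>z. lik1 \<sigma> f (fst z) (snd z)) \<in> borel_measurable (borel \<Otimes>\<^sub>M Xmeas p)"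
    "(\<lambda>z. lik1 \<sigma> f0 (fst z) (snd z)) \<in> borel_measurable (borel \<Otimes>\<^sub>M Xmeas p)"
    by (rule measurable_lik1; measurable)+
  have "(\<integral>\<^sup>+z. ennreal (lik1 \<sigma> f (fst z) (snd z) / lik1 \<sigma> f0 (fst z) (snd z)) \<partial>obs_law p \<sigma> f0)
    = (\<integral>\<^sup>+z. ennreal (lik1 \<sigma> f (fst z) (snd z)) \<partial>(lborel \<Otimes>\<^sub>M Xmeas p))"
    by (subst nn_integral_obs_law[OF f0])
       (auto intro!: nn_integral_cong simp: ennreal_mult'[symmetric] less_imp_neq[OF lik1_pos[OF \<sigma>], symmetric])
  also have "\<dots> = 1" by (rule nn_integral_lik1_eq_1[OF f \<sigma>])
  finally show ?thesis .
qed

section \<open>Kullback-Leibler divergence of one observation\<close>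

lemma ln_lik1_ratio:
  assumes "\<sigma> > 0"
  shows "ln (lik1 \<sigma> f0 y x / lik1 \<sigma> f y x) = ((f x - f0 x)\<^sup>2 - 2 * ((y - f0 x) * (f x - f0 x))) / (2 * \<sigma>\<^sup>2)"
proof -
  have "ln (lik1 \<sigma> f0 y x / lik1 \<sigma> f y x) = ln (lik1 \<sigma> f0 y x) - ln (lik1 \<sigma> f y x)"
    using lik1_pos[OF assms] by (simp add: ln_div less_imp_neq[symmetric])
  also have "\<dots> = ((y - f x)\<^sup>2 - (y - f0 x)\<^sup>2) / (2 * \<sigma>\<^sup>2)"
    using assms by (simp add: lik1_def ln_normal_density diff_divide_distrib)
  also have "(y - f x)\<^sup>2 - (y - f0 x)\<^sup>2 = (f x - f0 x)\<^sup>2 - 2 * ((y - f0 x) * (f x - f0 x))"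
    by (simp add: power2_eq_square algebra_simps)
  finally show ?thesis .
qed

text \<open>With noise \<open>t\<close> and \<open>d = f - f0\<close> the log ratio is
  \<open>(d\<^sup>2 - 2 * t * d) / (2 * \<sigma>\<^sup>2)\<close>. The cross term has mean zero
  because \<open>t\<close> is centred and independent of the input.\<close>

lemma obs_law_KL:
  assumes f0 [measurable]: "f0 \<in> borel_measurable (Xmeas p)" and f [measurable]: "f \<in> borel_measurable (Xmeas p)"
    and \<sigma>: "\<sigma> > 0" and sq: "integrable (Xmeas p) (\<lambda>x. (f x - f0 x)\<^sup>2)"
  shows "has_bochner_integral (obs_law p \<sigma> f0) (\<lambda>z. ln (lik1 \<sigma> f0 (fst z) (snd z) / lik1 \<sigma> f (fst z) (snd z)))
    ((\<integral>x. (f x - f0 x)\<^sup>2 \<partial>Xmeas p) / (2 * \<sigma>\<^sup>2))"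
proof -
  interpret N: prob_space "gauss 0 \<sigma>" using \<sigma> by (rule prob_space_gauss)
  interpret X: prob_space "Xmeas p" by (rule prob_space_Xmeas)
  interpret pair_sigma_finite "gauss 0 \<sigma>" "Xmeas p" by unfold_locales
  let ?N = "gauss 0 \<sigma> \<Otimes>\<^sub>M Xmeas p"
  define d where "d x = f x - f0 x" for x
  have d [measurable]: "d \<in> borel_measurable (Xmeas p)" unfolding d_def by measurable
  have dsq: "integrable (Xmeas p) (\<lambda>x. (d x)\<^sup>2)" using sq by (simp add: d_def)
  have I1: "integrable ?N (\<lambda>z. (fst z)\<^sup>2)"
    using gauss_centered_second_moment[OF \<sigma>, of 0] X.prob_space
    by (intro Fubini_integrable) (auto simp: has_bochner_integral_iff)
  have I2: "integrable ?N (\<lambda>z. (d (snd z))\<^sup>2)"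
    using dsq N.prob_space by (intro Fubini_integrable) auto
  have I3: "integrable ?N (\<lambda>z. fst z * d (snd z))"
  proof (rule Bochner_Integration.integrable_bound[OF Bochner_Integration.integrable_add[OF I1 I2]])
    show "AE z in ?N. norm (fst z * d (snd z)) \<le> norm ((fst z)\<^sup>2 + (d (snd z))\<^sup>2)"
    proof (rule AE_I2)
      fix z :: "real \<times> (nat \<Rightarrow> real)"
      have "2 * (\<bar>fst z\<bar> * \<bar>d (snd z)\<bar>) \<le> (fst z)\<^sup>2 + (d (snd z))\<^sup>2"
        using sum_squares_bound[of "\<bar>fst z\<bar>" "\<bar>d (snd z)\<bar>"] by simp
      moreover have "0 \<le> \<bar>fst z\<bar> * \<bar>d (snd z)\<bar>" by simp
      ultimately show "norm (fst z * d (snd z)) \<le> norm ((fst z)\<^sup>2 + (d (snd z))\<^sup>2)"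
        unfolding real_norm_def abs_mult by linarith
    qed
  qed measurable
  have m1: "(\<integral>t. t \<partial>gauss 0 \<sigma>) = 0"
    using integral_normal_moment_nz_1[OF \<sigma>, of 0] unfolding gauss_def
    by (subst integral_real_density) auto
  have E3: "(\<integral>z. fst z * d (snd z) \<partial>?N) = 0"
  proof -
    have "(\<integral>z. fst z * d (snd z) \<partial>?N) = (\<integral>x. (\<integral>t. t * d x \<partial>gauss 0 \<sigma>) \<partial>Xmeas p)"
      using integral_snd[of "\<lambda>t x. t * d x"] I3 by (simp add: case_prod_beta')
    then show ?thesis by (simp add: m1)
  qed
  have E2: "(\<integral>z. (d (snd z))\<^sup>2 \<partial>?N) = (\<integral>x. (d x)\<^sup>2 \<partial>Xmeas p)"
  proof -
    have "(\<integral>z. (d (snd z))\<^sup>2 \<partial>?N) = (\<integral>x. (\<integral>t. (d x)\<^sup>2 \<partial>gauss 0 \<sigma>) \<partial>Xmeas p)"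
      using integral_snd[of "\<lambda>t x. (d x)\<^sup>2"] I2 by (simp add: case_prod_beta')
    then show ?thesis using N.prob_space by simp
  qed
  have "has_bochner_integral ?N (\<lambda>z. ((d (snd z))\<^sup>2 - 2 * (fst z * d (snd z))) / (2 * \<sigma>\<^sup>2))
     (((\<integral>x. (d x)\<^sup>2 \<partial>Xmeas p) - 2 * 0) / (2 * \<sigma>\<^sup>2))"
    using I2 I3 E2 E3
    by (intro has_bochner_integral_divide_zero has_bochner_integral_diff has_bochner_integral_mult_right)
       (auto simp: has_bochner_integral_iff)
  then show ?thesis
    unfolding obs_law_eq_distr[OF f0 \<sigma>] ln_lik1_ratio[OF \<sigma>]
    by (auto simp: has_bochner_integral_iff integrable_distr_eq integral_distr d_def)
qed

text \<open>Half of the Gaussian exponent pays for the factor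
  \<open>exp (2 * \<bar>t\<bar>)\<close>. What remains is, up to the constant, the normal density
  with variance \<open>2 * \<sigma>\<^sup>2\<close>.\<close>

lemma gauss_exp_abs_finite:
  assumes "\<sigma> > 0"
  shows "(\<integral>\<^sup>+t. ennreal ((exp \<bar>t\<bar> - 1)\<^sup>2) \<partial>gauss 0 \<sigma>) \<le> ennreal (sqrt 2 * exp (4 * \<sigma>\<^sup>2))"
proof -
  have le: "normal_density 0 \<sigma> t * (exp \<bar>t\<bar> - 1)\<^sup>2 \<le> sqrt 2 * exp (4 * \<sigma>\<^sup>2) * normal_density 0 (sqrt 2 * \<sigma>) t" for t
  proof -
    have "(exp \<bar>t\<bar> - 1)\<^sup>2 \<le> (exp \<bar>t\<bar>)\<^sup>2"
      by (rule power_mono) auto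
    also have "\<dots> = exp (2 * \<bar>t\<bar>)" by (simp add: exp_double)
    finally have "(exp \<bar>t\<bar> - 1)\<^sup>2 \<le> exp (2 * \<bar>t\<bar>)" .
    then have "exp (- t\<^sup>2 / (2 * \<sigma>\<^sup>2)) * (exp \<bar>t\<bar> - 1)\<^sup>2 \<le> exp (- t\<^sup>2 / (2 * \<sigma>\<^sup>2) + 2 * \<bar>t\<bar>)"
      unfolding exp_add by (intro mult_left_mono) auto
    also have "- t\<^sup>2 / (2 * \<sigma>\<^sup>2) + 2 * \<bar>t\<bar> \<le> 4 * \<sigma>\<^sup>2 - t\<^sup>2 / (4 * \<sigma>\<^sup>2)"
    proof -
      \<comment> \<open>Completing this square is the origin of the constant
        \<open>4 * \<sigma>\<^sup>2\<close>.\<close>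
      have "0 \<le> (\<bar>t\<bar> / (2 * \<sigma>) - 2 * \<sigma>)\<^sup>2" by simp
      also have "\<dots> = t\<^sup>2 / (4 * \<sigma>\<^sup>2) - 2 * \<bar>t\<bar> + 4 * \<sigma>\<^sup>2"
        using assms by (simp add: power2_diff power_divide power_mult_distrib)
      finally show ?thesis using assms by (simp add: divide_simps)
    qed
    finally have "exp (- t\<^sup>2 / (2 * \<sigma>\<^sup>2)) * (exp \<bar>t\<bar> - 1)\<^sup>2 \<le> exp (4 * \<sigma>\<^sup>2 - t\<^sup>2 / (4 * \<sigma>\<^sup>2))"
      by simp
    moreover have "normal_density 0 \<sigma> t = exp (- t\<^sup>2 / (2 * \<sigma>\<^sup>2)) / sqrt (2 * pi * \<sigma>\<^sup>2)"
      by (simp add: normal_density_def)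
    moreover have "sqrt 2 * exp (4 * \<sigma>\<^sup>2) * normal_density 0 (sqrt 2 * \<sigma>) t = exp (4 * \<sigma>\<^sup>2 - t\<^sup>2 / (4 * \<sigma>\<^sup>2)) / sqrt (2 * pi * \<sigma>\<^sup>2)"
    proof -
      have "sqrt 2 * normal_density 0 (sqrt 2 * \<sigma>) t = exp (- (t\<^sup>2 / (4 * \<sigma>\<^sup>2))) / sqrt (2 * pi * \<sigma>\<^sup>2)"
      proof -
        have "sqrt (2 * pi * (sqrt 2 * \<sigma>)\<^sup>2) = sqrt 2 * sqrt (2 * pi * \<sigma>\<^sup>2)"
          unfolding real_sqrt_mult[symmetric] by (simp add: power_mult_distrib)
        then show ?thesis by (simp add: normal_density_def power_mult_distrib)
      qed
      then have "sqrt 2 * exp (4 * \<sigma>\<^sup>2) * normal_density 0 (sqrt 2 * \<sigma>) t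
          = exp (4 * \<sigma>\<^sup>2) * (exp (- (t\<^sup>2 / (4 * \<sigma>\<^sup>2))) / sqrt (2 * pi * \<sigma>\<^sup>2))"
        by (metis mult.assoc mult.left_commute)
      then show ?thesis using exp_add[of "4 * \<sigma>\<^sup>2" "- (t\<^sup>2 / (4 * \<sigma>\<^sup>2))"] by simp
    qed
    ultimately show ?thesis
      by (simp add: divide_right_mono)
  qed
  have "(\<integral>\<^sup>+t. ennreal ((exp \<bar>t\<bar> - 1)\<^sup>2) \<partial>gauss 0 \<sigma>) = (\<integral>\<^sup>+t. ennreal (normal_density 0 \<sigma> t * (exp \<bar>t\<bar> - 1)\<^sup>2) \<partial>lborel)"
    unfolding gauss_def by (subst nn_integral_density) (auto simp: ennreal_mult)
  also have "\<dots> \<le> (\<integral>\<^sup>+t. ennreal (sqrt 2 * exp (4 * \<sigma>\<^sup>2)) * ennreal (normal_density 0 (sqrt 2 * \<sigma>) t) \<partial>lborel)"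
    by (intro nn_integral_mono) (use le in \<open>simp add: ennreal_mult[symmetric] ennreal_leI\<close>)
  also have "\<dots> = ennreal (sqrt 2 * exp (4 * \<sigma>\<^sup>2)) * (\<integral>\<^sup>+t. ennreal (normal_density 0 (sqrt 2 * \<sigma>) t) \<partial>lborel)"
    by (intro nn_integral_cmult) auto
  also have "(\<integral>\<^sup>+t. ennreal (normal_density 0 (sqrt 2 * \<sigma>) t) \<partial>lborel) = 1"
    using assms by (subst nn_integral_eq_integral) auto
  finally show ?thesis by simp
qed

text \<open>Convexity between 0 and \<open>t\<close> pulls \<open>b\<close> out of the exponent: the
  effect of a small tilt becomes linear in \<open>b\<close>, with a random factor that does not
  depend on \<open>b\<close>.\<close>

lemma exp_minus_one_convex:
  fixes b t :: real
  assumes "0 \<le> b" "b \<le> 1"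
  shows "exp (b * t) - 1 \<le> b * (exp t - 1)"
  using convex_onD[OF exp_convex, of b 0 t] assms by (simp add: algebra_simps)

text \<open>\<open>dH\<close> is the squared Hellinger distance without the factor one half, so it
  equals 2 minus twice the affinity; the relation is proved as a sum to avoid subtraction in
  \<open>ennreal\<close>. The second claim reflects that the affinity is nonnegative, and it keeps
  \<open>1 - \<epsilon> / 2\<close> from being cut off when \<open>ennreal\<close> sums are
  merged.\<close>

lemma affinity_le:
  assumes f0 [measurable]: "f0 \<in> borel_measurable (Xmeas p)" and f [measurable]: "f \<in> borel_measurable (Xmeas p)"
    and \<sigma>: "\<sigma> > 0" and far: "\<not> dH p \<sigma> f0 f < ennreal \<epsilon>" and \<epsilon>: "\<epsilon> > 0"
  shows "(\<integral>\<^sup>+z. ennreal (sqrt (lik1 \<sigma> f (fst z) (snd z) * lik1 \<sigma> f0 (fst z) (snd z))) \<partial>(lborel \<Otimes>\<^sub>M Xmeas p))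
     \<le> ennreal (1 - \<epsilon> / 2)" "\<epsilon> \<le> 2"
proof -
  let ?mu = "lborel \<Otimes>\<^sub>M Xmeas p"
  let ?l = "\<lambda>z. lik1 \<sigma> f (fst z) (snd z)" and ?lo = "\<lambda>z. lik1 \<sigma> f0 (fst z) (snd z)"
  define A where "A = (\<integral>\<^sup>+z. ennreal (sqrt (?l z * ?lo z)) \<partial>?mu)"
  have "dH p \<sigma> f0 f + 2 * A = (\<integral>\<^sup>+z. ennreal ((sqrt (?l z) - sqrt (?lo z))\<^sup>2) + 2 * ennreal (sqrt (?l z * ?lo z)) \<partial>?mu)"
    unfolding dH_def A_def by (simp add: nn_integral_add nn_integral_cmult)
  also have "\<dots> = (\<integral>\<^sup>+z. ennreal (?l z) + ennreal (?lo z) \<partial>?mu)"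
  proof (rule nn_integral_cong)
    fix z
    have "(sqrt (?l z) - sqrt (?lo z))\<^sup>2 + 2 * sqrt (?l z * ?lo z) = ?l z + ?lo z"
      by (simp add: power2_diff real_sqrt_mult)
    moreover have "2 * ennreal (sqrt (?l z * ?lo z)) = ennreal (2 * sqrt (?l z * ?lo z))"
      by (simp add: ennreal_mult)
    ultimately show "ennreal ((sqrt (?l z) - sqrt (?lo z))\<^sup>2) + 2 * ennreal (sqrt (?l z * ?lo z)) = ennreal (?l z) + ennreal (?lo z)"
      by (simp add: ennreal_plus[symmetric] del: ennreal_plus)
  qed
  also have "\<dots> = 1 + 1"
    by (subst nn_integral_add) (auto simp: nn_integral_lik1_eq_1[OF f \<sigma>] nn_integral_lik1_eq_1[OF f0 \<sigma>])
  finally have sum: "dH p \<sigma> f0 f + 2 * A = ennreal 2" by simp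
  then have "2 * A \<le> ennreal 2"
    using add_increasing[of "dH p \<sigma> f0 f" "2 * A" "2 * A"] by simp
  then obtain \<alpha> where \<alpha>: "A = ennreal \<alpha>" "\<alpha> \<ge> 0"
    by (cases A) (auto simp: ennreal_mult_top top_unique)
  have "ennreal \<epsilon> + 2 * A \<le> ennreal 2"
    unfolding sum[symmetric] using far by (intro add_right_mono) (simp add: not_less)
  moreover have "2 * A = ennreal (2 * \<alpha>)" using \<alpha> by (simp add: ennreal_mult)
  ultimately have "\<epsilon> + 2 * \<alpha> \<le> 2"
    using \<alpha>(2) \<epsilon> ennreal_le_iff[of 2 "\<epsilon> + 2 * \<alpha>"] by (simp add: ennreal_plus[symmetric] del: ennreal_plus)
  then show "(\<integral>\<^sup>+z. ennreal (sqrt (?l z * ?lo z)) \<partial>?mu) \<le> ennreal (1 - \<epsilon> / 2)" "\<epsilon> \<le> 2"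
    using \<alpha> unfolding A_def[symmetric] by (auto intro!: ennreal_leI)
qed

text \<open>The factor \<^term>\<open>exp (b * \<bar>fst z - f (snd z)\<bar>)\<close> dominates the likelihood ratio between
  \<^term>\<open>f\<close> and any regression function uniformly close to it.\<close>

lemma nn_integral_sqrt_ratio_le:
  assumes f0 [measurable]: "f0 \<in> borel_measurable (Xmeas p)" and f [measurable]: "f \<in> borel_measurable (Xmeas p)"
    and \<sigma>: "\<sigma> > 0" and far: "\<not> dH p \<sigma> f0 f < ennreal \<epsilon>" and \<epsilon>: "\<epsilon> > 0"
    and b: "0 \<le> b" "b \<le> 1" and \<kappa>: "\<kappa> > 0"
  shows "(\<integral>\<^sup>+z. ennreal (sqrt (lik1 \<sigma> f (fst z) (snd z) / lik1 \<sigma> f0 (fst z) (snd z))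
            * exp (b * \<bar>fst z - f (snd z)\<bar>)) \<partial>obs_law p \<sigma> f0)
     \<le> ennreal (1 - \<epsilon> / 2 + \<kappa> / 2 + b\<^sup>2 / (2 * \<kappa>) * (sqrt 2 * exp (4 * \<sigma>\<^sup>2)))"
proof -
  let ?mu = "lborel \<Otimes>\<^sub>M Xmeas p"
  let ?l = "\<lambda>z. lik1 \<sigma> f (fst z) (snd z)" and ?lo = "\<lambda>z. lik1 \<sigma> f0 (fst z) (snd z)"
  let ?e = "\<lambda>z. exp (b * \<bar>fst z - f (snd z)\<bar>)" and ?g = "\<lambda>z. (exp \<bar>fst z - f (snd z)\<bar> - 1)\<^sup>2"
  have [measurable]: "?l \<in> borel_measurable (borel \<Otimes>\<^sub>M Xmeas p)" "?lo \<in> borel_measurable (borel \<Otimes>\<^sub>M Xmeas p)"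
    by (rule measurable_lik1; measurable)+
  have l0: "?lo z > 0" and l: "?l z > 0" for z using \<sigma> by (auto intro: lik1_pos)
  have sq: "?lo z * (sqrt (?l z / ?lo z) * e) = sqrt (?l z * ?lo z) * e" for z e
  proof -
    have "?lo z * sqrt (?l z / ?lo z) = sqrt ((?lo z)\<^sup>2) * sqrt (?l z / ?lo z)"
      using l0[of z] by simp
    also have "\<dots> = sqrt (?l z * ?lo z)"
      unfolding real_sqrt_mult[symmetric] using l0[of z] by (simp add: power2_eq_square)
    finally show ?thesis by simp
  qed
  \<comment> \<open>A weighted arithmetic-geometric mean inequality, arranged so that the squared
    exponential is multiplied by \<open>?l\<close>. Under that density
    \<open>fst z - f (snd z)\<close> is centred noise, whence a bound that does not involve
    \<open>f - f0\<close>.\<close>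
  have pw: "sqrt (?l z * ?lo z) * ?e z \<le> sqrt (?l z * ?lo z) + \<kappa> / 2 * ?lo z + b\<^sup>2 / (2 * \<kappa>) * (?l z * ?g z)" for z
  proof -
    let ?E = "?e z - 1" and ?c = "b * (exp \<bar>fst z - f (snd z)\<bar> - 1)"
    have E: "0 \<le> ?E" "?E \<le> ?c"
      using b exp_minus_one_convex[OF b] by auto
    have "0 \<le> (sqrt (\<kappa> * ?lo z) - sqrt (?l z / \<kappa>) * ?c)\<^sup>2" by simp
    also have "\<dots> = \<kappa> * ?lo z + ?l z / \<kappa> * ?c\<^sup>2 - 2 * (sqrt (\<kappa> * ?lo z) * sqrt (?l z / \<kappa>) * ?c)"
      using l[of z] l0[of z] \<kappa> by (simp add: power2_diff power_mult_distrib)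
    also have "sqrt (\<kappa> * ?lo z) * sqrt (?l z / \<kappa>) = sqrt (?l z * ?lo z)"
      unfolding real_sqrt_mult[symmetric] using \<kappa> by (simp add: mult.commute)
    finally have "sqrt (?l z * ?lo z) * ?c \<le> \<kappa> / 2 * ?lo z + ?l z / \<kappa> * ?c\<^sup>2 / 2" by simp
    moreover have "sqrt (?l z * ?lo z) * ?E \<le> sqrt (?l z * ?lo z) * ?c"
      using E l[of z] l0[of z] by (intro mult_left_mono) auto
    moreover have "?l z / \<kappa> * ?c\<^sup>2 / 2 = b\<^sup>2 / (2 * \<kappa>) * (?l z * ?g z)"
      by (simp add: power_mult_distrib mult_ac)
    ultimately show ?thesis by (simp only: right_diff_distrib mult_1_right)
  qed
  have "(\<integral>\<^sup>+z. ennreal (sqrt (?l z / ?lo z) * ?e z) \<partial>obs_law p \<sigma> f0)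
     = (\<integral>\<^sup>+z. ennreal (sqrt (?l z * ?lo z) * ?e z) \<partial>?mu)"
    by (subst nn_integral_obs_law[OF f0]) (auto intro!: nn_integral_cong simp: ennreal_mult'[symmetric] sq simp del: ennreal_mult)
  also have "\<dots> \<le> (\<integral>\<^sup>+z. ennreal (sqrt (?l z * ?lo z)) + ennreal (\<kappa> / 2) * ennreal (?lo z)
       + ennreal (b\<^sup>2 / (2 * \<kappa>)) * (ennreal (?l z) * ennreal (?g z)) \<partial>?mu)"
  proof (rule nn_integral_mono)
    fix z
    have "ennreal (sqrt (?l z * ?lo z) * ?e z) \<le> ennreal (sqrt (?l z * ?lo z) + \<kappa> / 2 * ?lo z + b\<^sup>2 / (2 * \<kappa>) * (?l z * ?g z))"
      using pw by (rule ennreal_leI)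
    also have "\<dots> = ennreal (sqrt (?l z * ?lo z)) + ennreal (\<kappa> / 2) * ennreal (?lo z)
       + ennreal (b\<^sup>2 / (2 * \<kappa>)) * (ennreal (?l z) * ennreal (?g z))"
      using \<kappa> l[of z] l0[of z] by (simp add: ennreal_mult[symmetric] ennreal_plus[symmetric] del: ennreal_plus)
    finally show "ennreal (sqrt (?l z * ?lo z) * ?e z) \<le> ennreal (sqrt (?l z * ?lo z)) + ennreal (\<kappa> / 2) * ennreal (?lo z)
       + ennreal (b\<^sup>2 / (2 * \<kappa>)) * (ennreal (?l z) * ennreal (?g z))" .
  qed
  also have "\<dots> = (\<integral>\<^sup>+z. ennreal (sqrt (?l z * ?lo z)) \<partial>?mu) + ennreal (\<kappa> / 2) * (\<integral>\<^sup>+z. ennreal (?lo z) \<partial>?mu)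
       + ennreal (b\<^sup>2 / (2 * \<kappa>)) * (\<integral>\<^sup>+z. ennreal (?l z) * ennreal (?g z) \<partial>?mu)"
    by (simp add: nn_integral_add nn_integral_cmult)
  also have "(\<integral>\<^sup>+z. ennreal (?l z) * ennreal (?g z) \<partial>?mu) = (\<integral>\<^sup>+x. (\<integral>\<^sup>+t. ennreal ((exp \<bar>t\<bar> - 1)\<^sup>2) \<partial>gauss 0 \<sigma>) \<partial>Xmeas p)"
    by (subst nn_integral_lik1[OF f]) auto
  also have "\<dots> = (\<integral>\<^sup>+t. ennreal ((exp \<bar>t\<bar> - 1)\<^sup>2) \<partial>gauss 0 \<sigma>)"
    using prob_space.emeasure_space_1[OF prob_space_Xmeas] by simp
  also have "(\<integral>\<^sup>+z. ennreal (sqrt (?l z * ?lo z)) \<partial>?mu) + ennreal (\<kappa> / 2) * (\<integral>\<^sup>+z. ennreal (?lo z) \<partial>?mu)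
       + ennreal (b\<^sup>2 / (2 * \<kappa>)) * (\<integral>\<^sup>+t. ennreal ((exp \<bar>t\<bar> - 1)\<^sup>2) \<partial>gauss 0 \<sigma>)
     \<le> ennreal (1 - \<epsilon> / 2) + ennreal (\<kappa> / 2) * 1 + ennreal (b\<^sup>2 / (2 * \<kappa>)) * ennreal (sqrt 2 * exp (4 * \<sigma>\<^sup>2))"
    unfolding nn_integral_lik1_eq_1[OF f0 \<sigma>]
    by (intro add_mono mult_left_mono affinity_le[OF f0 f \<sigma> far \<epsilon>] gauss_exp_abs_finite \<sigma>) auto
  also have "\<dots> = ennreal (1 - \<epsilon> / 2 + \<kappa> / 2 + b\<^sup>2 / (2 * \<kappa>) * (sqrt 2 * exp (4 * \<sigma>\<^sup>2)))"
    using affinity_le(2)[OF f0 f \<sigma> far \<epsilon>] \<kappa>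
    by (simp add: ennreal_mult'[symmetric] ennreal_plus[symmetric] del: ennreal_plus)
  finally show ?thesis .
qed

subsection \<open>The law of the sample\<close>

text \<open>Points of a finite product space are undefined off the index set, whereas
  \<open>\<theta>\<close> is any function. Its restriction is a point of the space and defines the
  same network, as all indices that are read lie below \<open>nparams p k\<close>.\<close>

lemma nn_restrict [simp]: "nn p k (restrict \<theta> {..<nparams p k}) = nn p k \<theta>"
proof
  fix x
  have "(\<Sum>j\<in>{1..k}. restrict \<theta> {..<nparams p k} j * psi (restrict \<theta> {..<nparams p k} (gam_idx p k j 0)
        + (\<Sum>h\<in>{1..p}. restrict \<theta> {..<nparams p k} (gam_idx p k j h) * x h)))
      = (\<Sum>j\<in>{1..k}. \<theta> j * psi (\<theta> (gam_idx p k j 0) + (\<Sum>h\<in>{1..p}. \<theta> (gam_idx p k j h) * x h)))"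
  proof (rule sum.cong[OF refl])
    fix j assume j: "j \<in> {1..k}"
    then have idx: "j < nparams p k" "gam_idx p k j 0 < nparams p k" by (auto simp: beta_idx_less gam_idx_less)
    have "(\<Sum>h\<in>{1..p}. restrict \<theta> {..<nparams p k} (gam_idx p k j h) * x h) = (\<Sum>h\<in>{1..p}. \<theta> (gam_idx p k j h) * x h)"
      by (rule sum.cong[OF refl]) (simp add: gam_idx_less[OF j])
    then show "restrict \<theta> {..<nparams p k} j * psi (restrict \<theta> {..<nparams p k} (gam_idx p k j 0)
        + (\<Sum>h\<in>{1..p}. restrict \<theta> {..<nparams p k} (gam_idx p k j h) * x h))
      = \<theta> j * psi (\<theta> (gam_idx p k j 0) + (\<Sum>h\<in>{1..p}. \<theta> (gam_idx p k j h) * x h))"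
      using idx by simp
  qed
  then show "nn p k (restrict \<theta> {..<nparams p k}) x = nn p k \<theta> x"
    unfolding nn_def by (simp add: beta_idx_less)
qed

locale regression =
  fixes p :: nat and \<sigma> :: real and f0 :: "(nat \<Rightarrow> real) \<Rightarrow> real"
  assumes sigma_pos: "\<sigma> > 0"
    and f0_meas [measurable]: "f0 \<in> borel_measurable (Xmeas p)"
    and f0_L2: "integrable (Xmeas p) (\<lambda>x. (f0 x)\<^sup>2)"
begin

abbreviation "data n \<equiv> data_law p \<sigma> f0 n"
abbreviation "obs \<equiv> obs_law p \<sigma> f0"

definition true_lik :: "nat \<Rightarrow> (nat \<Rightarrow> real \<times> (nat \<Rightarrow> real)) \<Rightarrow> real" where
  "true_lik n D = (\<Prod>i<n. lik1 \<sigma> f0 (fst (D i)) (snd (D i)))"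

definition lr :: "nat \<Rightarrow> nat \<Rightarrow> (nat \<Rightarrow> real \<times> (nat \<Rightarrow> real)) \<Rightarrow> (nat \<Rightarrow> real) \<Rightarrow> real" where
  "lr k n D \<theta> = likelihood p k \<sigma> n D \<theta> / true_lik n D"

lemma prob_space_obs: "prob_space obs"
  by (rule prob_space_obs_law[OF f0_meas sigma_pos])

lemma prob_space_data: "prob_space (data n)"
  unfolding data_law_def by (intro prob_space_PiM prob_space_obs)

lemma sets_data [simp, measurable_cong]: "sets (data n) = sets (PiM {..<n} (\<lambda>_. borel \<Otimes>\<^sub>M Xmeas p))"
  unfolding data_law_def by (intro sets_PiM_cong) auto

lemma true_lik_pos: "true_lik n D > 0"
  unfolding true_lik_def by (intro prod_pos) (auto intro: lik1_pos sigma_pos)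

lemma likelihood_pos: "likelihood p k \<sigma> n D \<theta> > 0"
  unfolding likelihood_def by (intro prod_pos) (auto intro: lik1_pos sigma_pos)

lemma lr_pos: "lr k n D \<theta> > 0"
  unfolding lr_def using true_lik_pos likelihood_pos by simp

lemma lr_eq_prod: "lr k n D \<theta> = (\<Prod>i<n. lik1 \<sigma> (nn p k \<theta>) (fst (D i)) (snd (D i)) / lik1 \<sigma> f0 (fst (D i)) (snd (D i)))"
  unfolding lr_def likelihood_def true_lik_def by (simp add: prod_dividef)

lemma nn_integral_data_prod:
  fixes g :: "real \<times> (nat \<Rightarrow> real) \<Rightarrow> ennreal"
  assumes [measurable]: "g \<in> borel_measurable (borel \<Otimes>\<^sub>M Xmeas p)"
  shows "(\<integral>\<^sup>+D. (\<Prod>i<n. g (D i)) \<partial>data n) = (\<integral>\<^sup>+z. g z \<partial>obs) ^ n"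
proof -
  interpret O: prob_space obs by (rule prob_space_obs)
  interpret product_sigma_finite "\<lambda>_::nat. obs" by unfold_locales
  show ?thesis unfolding data_law_def
    by (subst product_nn_integral_prod) auto
qed

section \<open>Measurability and moments of the likelihood ratio\<close>

lemma measurable_likelihood:
  assumes D [measurable]: "Dw \<in> measurable M (PiM {..<n} (\<lambda>_. borel \<Otimes>\<^sub>M Xmeas p))"
    and T [measurable]: "Tw \<in> measurable M (PiM {..<nparams p k} (\<lambda>_. borel))"
  shows "(\<lambda>w. likelihood p k \<sigma> n (Dw w) (Tw w)) \<in> borel_measurable M"
proof -
  have Di [measurable]: "(\<lambda>w. Dw w i) \<in> measurable M (borel \<Otimes>\<^sub>M Xmeas p)" if "i < n" for i
    using measurable_compose[OF D measurable_component_singleton] that by simp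
  have Ti: "(\<lambda>w. Tw w i) \<in> borel_measurable M" if "i < nparams p k" for i
    using measurable_compose[OF T measurable_component_singleton] that by simp
  have Xh: "(\<lambda>w. snd (Dw w i) h) \<in> borel_measurable M" if "i < n" "h \<in> {1..p}" for i h
  proof -
    have "(\<lambda>w. snd (Dw w i)) \<in> measurable M (Xmeas p)" using Di[OF that(1)] by measurable
    then have "(\<lambda>w. snd (Dw w i)) \<in> measurable M (PiM {1..p} (\<lambda>_. borel))"
      using measurable_cong_sets[OF refl sets_Xmeas] by blast
    from measurable_compose[OF this measurable_component_singleton[OF that(2)]] show ?thesis by simp
  qed
  show ?thesis unfolding likelihood_def
  proof (intro borel_measurable_prod measurable_lik1)
    fix i assume "i \<in> {..<n}"
    then have i: "i < n" by simp
    show "(\<lambda>w. nn p k (Tw w) (snd (Dw w i))) \<in> borel_measurable M"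
      by (intro measurable_nn Ti Xh i)
    show "(\<lambda>w. fst (Dw w i)) \<in> borel_measurable M" using Di[OF i] by measurable
  qed
qed

lemma measurable_true_lik:
  assumes D [measurable]: "Dw \<in> measurable M (PiM {..<n} (\<lambda>_. borel \<Otimes>\<^sub>M Xmeas p))"
  shows "(\<lambda>w. true_lik n (Dw w)) \<in> borel_measurable M"
  unfolding true_lik_def
proof (intro borel_measurable_prod measurable_lik1)
  fix i assume "i \<in> {..<n}"
  then have [measurable]: "(\<lambda>w. Dw w i) \<in> measurable M (borel \<Otimes>\<^sub>M Xmeas p)"
    using measurable_compose[OF D measurable_component_singleton] by simp
  show "(\<lambda>w. f0 (snd (Dw w i))) \<in> borel_measurable M" "(\<lambda>w. fst (Dw w i)) \<in> borel_measurable M"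
    by measurable
qed

lemma measurable_lr:
  assumes [measurable]: "Dw \<in> measurable M (PiM {..<n} (\<lambda>_. borel \<Otimes>\<^sub>M Xmeas p))"
    "Tw \<in> measurable M (PiM {..<nparams p k} (\<lambda>_. borel))"
  shows "(\<lambda>w. lr k n (Dw w) (Tw w)) \<in> borel_measurable M"
  unfolding lr_def by (intro borel_measurable_divide measurable_likelihood measurable_true_lik assms)

lemma measurable_lr_data: "(\<lambda>D. lr k n D \<theta>) \<in> borel_measurable (data n)"
proof -
  have "(\<lambda>D. lr k n D (restrict \<theta> {..<nparams p k})) \<in> borel_measurable (data n)"
    by (intro measurable_lr measurable_const) (auto simp: space_PiM measurable_cong_sets[OF sets_data refl])
  then show ?thesis by (simp add: lr_def likelihood_def)
qed

lemma measurable_ratio [measurable]: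
  assumes [measurable]: "f \<in> borel_measurable (Xmeas p)"
  shows "(\<lambda>z. lik1 \<sigma> f (fst z) (snd z)) \<in> borel_measurable (borel \<Otimes>\<^sub>M Xmeas p)"
  by (rule measurable_lik1) measurable

lemma nn_integral_lr: "(\<integral>\<^sup>+D. ennreal (lr k n D \<theta>) \<partial>data n) = 1"
proof -
  have "(\<integral>\<^sup>+D. ennreal (lr k n D \<theta>) \<partial>data n)
    = (\<integral>\<^sup>+D. (\<Prod>i<n. ennreal (lik1 \<sigma> (nn p k \<theta>) (fst (D i)) (snd (D i)) / lik1 \<sigma> f0 (fst (D i)) (snd (D i)))) \<partial>data n)"
    by (intro nn_integral_cong) (simp add: lr_eq_prod prod_ennreal)
  also have "\<dots> = (\<integral>\<^sup>+z. ennreal (lik1 \<sigma> (nn p k \<theta>) (fst z) (snd z) / lik1 \<sigma> f0 (fst z) (snd z)) \<partial>obs) ^ n"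
    by (rule nn_integral_data_prod[where g="\<lambda>z. ennreal (lik1 \<sigma> (nn p k \<theta>) (fst z) (snd z) / lik1 \<sigma> f0 (fst z) (snd z))"]) measurable
  also have "\<dots> = 1"
    by (simp add: nn_integral_likelihood_ratio sigma_pos)
  finally show ?thesis .
qed

lemma has_bochner_integral_data_component:
  assumes "has_bochner_integral obs g (c::real)" and [measurable]: "g \<in> borel_measurable (borel \<Otimes>\<^sub>M Xmeas p)" and "i < n"
  shows "has_bochner_integral (data n) (\<lambda>D. g (D i)) c"
proof -
  have distr: "distr (data n) obs (\<lambda>D. D i) = obs"
    unfolding data_law_def using assms(3) by (intro distr_PiM_component prob_space_obs) auto
  have m: "(\<lambda>D. D i) \<in> measurable (data n) obs"
    unfolding data_law_def using assms(3) by (intro measurable_component_singleton) simp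
  have "has_bochner_integral (distr (data n) obs (\<lambda>D. D i)) g c"
    unfolding distr by (rule assms(1))
  then show ?thesis using m
    by (auto simp: has_bochner_integral_iff integrable_distr_eq integral_distr)
qed

lemma data_KL:
  "has_bochner_integral (data n) (\<lambda>D. ln (1 / lr k n D \<theta>))
     (real n * ((L2dist p (nn p k \<theta>) f0)\<^sup>2 / (2 * \<sigma>\<^sup>2)))"
proof -
  let ?g = "\<lambda>z. ln (lik1 \<sigma> f0 (fst z) (snd z) / lik1 \<sigma> (nn p k \<theta>) (fst z) (snd z))"
  have sq: "(L2dist p (nn p k \<theta>) f0)\<^sup>2 = (\<integral>x. (nn p k \<theta> x - f0 x)\<^sup>2 \<partial>Xmeas p)"
    unfolding L2dist_def by simp
  have "has_bochner_integral (data n) (\<lambda>D. \<Sum>i<n. ?g (D i)) (\<Sum>i<n. (L2dist p (nn p k \<theta>) f0)\<^sup>2 / (2 * \<sigma>\<^sup>2))"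
    unfolding sq
    by (intro has_bochner_integral_sum has_bochner_integral_data_component[where g="?g"]
        obs_law_KL f0_meas measurable_nn_Xmeas sigma_pos integrable_nn_diff_square f0_L2) auto
  moreover have "ln (1 / lr k n D \<theta>) = (\<Sum>i<n. ?g (D i))" for D
  proof -
    have inv: "1 / lr k n D \<theta> = (\<Prod>i<n. lik1 \<sigma> f0 (fst (D i)) (snd (D i)) / lik1 \<sigma> (nn p k \<theta>) (fst (D i)) (snd (D i)))"
      unfolding lr_def likelihood_def true_lik_def by (simp add: prod_dividef)
    have "lik1 \<sigma> f0 (fst (D i)) (snd (D i)) / lik1 \<sigma> (nn p k \<theta>) (fst (D i)) (snd (D i)) \<noteq> 0" for i
      using lik1_pos[OF sigma_pos, of f0] lik1_pos[OF sigma_pos, of "nn p k \<theta>"] by (metis divide_pos_pos less_irrefl)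
    then show ?thesis unfolding inv by (intro ln_prod) auto
  qed
  ultimately have "has_bochner_integral (data n) (\<lambda>D. ln (1 / lr k n D \<theta>)) (\<Sum>i<n. (L2dist p (nn p k \<theta>) f0)\<^sup>2 / (2 * \<sigma>\<^sup>2))"
    by (simp only:)
  then show ?thesis by (simp only: sum_constant card_lessThan)
qed

text \<open>The negative part of \<^term>\<open>ln (1 / lr k n D \<theta>)\<close> is at most \<^term>\<open>lr k n D \<theta>\<close>, whose mean is 1.\<close>

lemma nn_integral_pos_part_le:
  "(\<integral>\<^sup>+D. ennreal (ln (1 / lr k n D \<theta>)) \<partial>data n)
     \<le> ennreal (real n * ((L2dist p (nn p k \<theta>) f0)\<^sup>2 / (2 * \<sigma>\<^sup>2)) + 1)"
proof -
  let ?T = "\<lambda>D. ln (1 / lr k n D \<theta>)"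
  have T: "integrable (data n) ?T" "(\<integral>D. ?T D \<partial>data n) = real n * ((L2dist p (nn p k \<theta>) f0)\<^sup>2 / (2 * \<sigma>\<^sup>2))"
    using data_KL[of n k \<theta>] by (auto simp: has_bochner_integral_iff)
  have lr: "integrable (data n) (\<lambda>D. lr k n D \<theta>)" "(\<integral>D. lr k n D \<theta> \<partial>data n) = 1"
  proof -
    show *: "integrable (data n) (\<lambda>D. lr k n D \<theta>)"
      using nn_integral_lr[of n k \<theta>] measurable_lr_data by (intro integrableI_nonneg) (auto simp: less_imp_le[OF lr_pos])
    show "(\<integral>D. lr k n D \<theta> \<partial>data n) = 1"
      using nn_integral_lr[of n k \<theta>] * by (subst (asm) nn_integral_eq_integral) (auto simp: less_imp_le[OF lr_pos])
  qed
  have pw: "0 \<le> ?T D + lr k n D \<theta>" for D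
    using ln_le_minus_one[OF lr_pos[of k n D \<theta>]] lr_pos[of k n D \<theta>] by (simp add: ln_div)
  \<comment> \<open>\<open>ennreal\<close> cuts negative values off at 0, so the left side is the
    mean of the positive part. On the right the integrand is nonnegative and nothing is cut
    off.\<close>
  have "(\<integral>\<^sup>+D. ennreal (?T D) \<partial>data n) \<le> (\<integral>\<^sup>+D. ennreal (?T D + lr k n D \<theta>) \<partial>data n)"
    by (intro nn_integral_mono ennreal_leI) (simp add: less_imp_le[OF lr_pos])
  also have "\<dots> = ennreal (\<integral>D. ?T D + lr k n D \<theta> \<partial>data n)"
    using T lr pw by (intro nn_integral_eq_integral) auto
  also have "(\<integral>D. ?T D + lr k n D \<theta> \<partial>data n) = real n * ((L2dist p (nn p k \<theta>) f0)\<^sup>2 / (2 * \<sigma>\<^sup>2)) + 1"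
    using T lr by simp
  finally show ?thesis .
qed

lemma measurable_lr_pair [measurable]:
  "(\<lambda>z. lr k n (fst z) (snd z)) \<in> borel_measurable (PiM {..<n} (\<lambda>_. borel \<Otimes>\<^sub>M Xmeas p) \<Otimes>\<^sub>M PiM {..<nparams p k} (\<lambda>_. borel))"
  by (intro measurable_lr) measurable

lemma measurable_lr_param:
  assumes D: "D \<in> space (data n)"
  shows "lr k n D \<in> borel_measurable (PiM {..<nparams p k} (\<lambda>_. borel))"
proof (rule measurable_lr)
  have "D \<in> space (PiM {..<n} (\<lambda>_. borel \<Otimes>\<^sub>M Xmeas p))" using D sets_eq_imp_space_eq[OF sets_data] by blast
  then show "(\<lambda>w. D) \<in> measurable (PiM {..<nparams p k} (\<lambda>_. borel)) (PiM {..<n} (\<lambda>_. borel \<Otimes>\<^sub>M Xmeas p))"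
    by (rule measurable_const)
qed simp

lemma measurable_likelihood_param:
  assumes D: "D \<in> space (data n)"
  shows "likelihood p k \<sigma> n D \<in> borel_measurable (PiM {..<nparams p k} (\<lambda>_. borel))"
proof (rule measurable_likelihood)
  have "D \<in> space (PiM {..<n} (\<lambda>_. borel \<Otimes>\<^sub>M Xmeas p))" using D sets_eq_imp_space_eq[OF sets_data] by blast
  then show "(\<lambda>w. D) \<in> measurable (PiM {..<nparams p k} (\<lambda>_. borel)) (PiM {..<n} (\<lambda>_. borel \<Otimes>\<^sub>M Xmeas p))"
    by (rule measurable_const)
qed simp

lemma nn_integral_data_swap:
  fixes g :: "(nat \<Rightarrow> real \<times> (nat \<Rightarrow> real)) \<Rightarrow> (nat \<Rightarrow> real) \<Rightarrow> ennreal"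
  assumes Q: "prob_space Q" and sQ [measurable_cong]: "sets Q = sets (PiM {..<nparams p k} (\<lambda>_. borel))"
    and g [measurable]: "(\<lambda>z. g (fst z) (snd z)) \<in> borel_measurable (PiM {..<n} (\<lambda>_. borel \<Otimes>\<^sub>M Xmeas p) \<Otimes>\<^sub>M PiM {..<nparams p k} (\<lambda>_. borel))"
  shows "(\<integral>\<^sup>+D. (\<integral>\<^sup>+\<theta>. g D \<theta> \<partial>Q) \<partial>data n) = (\<integral>\<^sup>+\<theta>. (\<integral>\<^sup>+D. g D \<theta> \<partial>data n) \<partial>Q)"
    and "(\<lambda>D. \<integral>\<^sup>+\<theta>. g D \<theta> \<partial>Q) \<in> borel_measurable (data n)"
proof -
  interpret Q: prob_space Q by (rule Q)
  interpret D: prob_space "data n" by (rule prob_space_data)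
  interpret pair_sigma_finite "data n" Q by unfold_locales
  have m: "case_prod g \<in> borel_measurable (data n \<Otimes>\<^sub>M Q)"
    unfolding case_prod_beta' by measurable
  show "(\<integral>\<^sup>+D. (\<integral>\<^sup>+\<theta>. g D \<theta> \<partial>Q) \<partial>data n) = (\<integral>\<^sup>+\<theta>. (\<integral>\<^sup>+D. g D \<theta> \<partial>data n) \<partial>Q)"
    using Fubini'[OF m] by simp
  show "(\<lambda>D. \<integral>\<^sup>+\<theta>. g D \<theta> \<partial>Q) \<in> borel_measurable (data n)"
    using Q.borel_measurable_nn_integral[OF m] .
qed

end

subsection \<open>Covering, tails and moments\<close>

text \<open>Cells of side \<open>h\<close> are indexed by floors, and a point of \<open>S\<close>
  itself is picked from every occupied cell. Applied to the part of the cube far from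
  \<open>f0\<close>, this keeps the centres both bounded and far, as the Chernoff bound requires;
  corners of cells might be neither.\<close>

lemma finite_cube_cover:
  fixes S :: "(nat \<Rightarrow> real) set"
  assumes S: "\<And>\<theta> i. \<theta> \<in> S \<Longrightarrow> i < K \<Longrightarrow> \<bar>\<theta> i\<bar> \<le> C" and C: "C \<ge> 0" and h: "h > 0"
  obtains R where "R \<subseteq> S" "finite R" "real (card R) \<le> (2 * C / h + 2) ^ K"
    "\<And>\<theta>. \<theta> \<in> S \<Longrightarrow> \<exists>r\<in>R. \<forall>i<K. \<bar>\<theta> i - r i\<bar> \<le> h"
proof -
  define \<phi> where "\<phi> \<theta> = restrict (\<lambda>i. \<lfloor>\<theta> i / h\<rfloor>) {..<K}" for \<theta> :: "nat \<Rightarrow> real"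
  define J where "J = {\<lfloor>- C / h\<rfloor>..\<lfloor>C / h\<rfloor>}"
  have sub: "\<phi> ` S \<subseteq> PiE {..<K} (\<lambda>_. J)"
  proof (rule image_subsetI)
    fix \<theta> assume "\<theta> \<in> S"
    then have "- C / h \<le> \<theta> i / h \<and> \<theta> i / h \<le> C / h" if "i < K" for i
      using S[of \<theta> i] that h by (auto simp: divide_simps abs_le_iff)
    then show "\<phi> \<theta> \<in> PiE {..<K} (\<lambda>_. J)"
      by (auto simp: \<phi>_def J_def intro!: floor_mono)
  qed
  have fin: "finite (PiE {..<K} (\<lambda>_. J))" by (intro finite_PiE) (auto simp: J_def)
  have finS: "finite (\<phi> ` S)" using sub fin by (rule finite_subset)
  \<comment> \<open>Rounding down the left end costs one, counting both end points costs
    another.\<close>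
  have "real (card J) \<le> 2 * C / h + 2"
  proof -
    have "\<lfloor>- C / h\<rfloor> \<le> \<lfloor>C / h\<rfloor>" using C h by (intro floor_mono divide_right_mono) auto
    then have "real (card J) = of_int \<lfloor>C / h\<rfloor> - of_int \<lfloor>- C / h\<rfloor> + 1" by (simp add: J_def)
    then show ?thesis using floor_correct[of "C / h"] floor_correct[of "- C / h"]
      by (simp add: minus_divide_left[symmetric]; linarith)
  qed
  then have cJ: "real (card J) ^ K \<le> (2 * C / h + 2) ^ K" by (intro power_mono) auto
  define R where "R = inv_into S \<phi> ` \<phi> ` S"
  show ?thesis
  proof
    show "R \<subseteq> S" unfolding R_def by (auto intro: inv_into_into)
    show "finite R" unfolding R_def using finS by (rule finite_imageI)
    have "card R \<le> card (\<phi> ` S)" unfolding R_def using finS by (rule card_image_le)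
    also have "\<dots> \<le> card (PiE {..<K} (\<lambda>_. J))" using fin sub by (rule card_mono)
    also have "\<dots> = card J ^ K" by (simp add: card_PiE)
    finally have "real (card R) \<le> real (card J) ^ K" by (metis of_nat_le_iff of_nat_power)
    with cJ show "real (card R) \<le> (2 * C / h + 2) ^ K" by linarith
    fix \<theta> assume \<theta>: "\<theta> \<in> S"
    let ?r = "inv_into S \<phi> (\<phi> \<theta>)"
    have eq: "\<phi> ?r = \<phi> \<theta>" by (rule f_inv_into_f[OF imageI[OF \<theta>]])
    have "\<bar>\<theta> i - ?r i\<bar> \<le> h" if "i < K" for i
    proof -
      have "\<lfloor>?r i / h\<rfloor> = \<lfloor>\<theta> i / h\<rfloor>"
        using fun_cong[OF eq, of i] that by (simp add: \<phi>_def)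
      then have "\<bar>\<theta> i / h - ?r i / h\<bar> \<le> 1"
        using floor_correct[of "\<theta> i / h"] floor_correct[of "?r i / h"] by linarith
      then have "\<bar>(\<theta> i - ?r i) / h\<bar> \<le> 1" by (simp add: diff_divide_distrib)
      then show ?thesis using h by (simp add: abs_divide divide_simps)
    qed
    moreover have "?r \<in> R" using \<theta> by (auto simp: R_def)
    ultimately show "\<exists>r\<in>R. \<forall>i<K. \<bar>\<theta> i - r i\<bar> \<le> h" by blast
  qed
qed

section \<open>Markov's inequality and Gaussian tails\<close>

lemma emeasure_ge_le:
  fixes u :: "'a \<Rightarrow> ennreal"
  assumes [measurable]: "u \<in> borel_measurable M" and u: "(\<integral>\<^sup>+x. u x \<partial>M) \<le> ennreal a" and c: "c > 0"
  shows "emeasure M {x \<in> space M. ennreal c \<le> u x} \<le> ennreal (a / c)"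
proof -
  have "{x \<in> space M. ennreal c \<le> u x} = {x \<in> space M. 1 \<le> ennreal (1 / c) * u x}"
  proof -
    have "1 \<le> ennreal (1 / c) * y \<longleftrightarrow> ennreal c \<le> y" for y
    proof
      assume "1 \<le> ennreal (1 / c) * y"
      then have "ennreal c * 1 \<le> ennreal c * (ennreal (1 / c) * y)" by (rule mult_left_mono) simp
      also have "\<dots> = y" using c by (simp add: mult.assoc[symmetric] ennreal_mult'[symmetric])
      finally show "ennreal c \<le> y" by simp
    next
      assume "ennreal c \<le> y"
      then have "ennreal (1 / c) * ennreal c \<le> ennreal (1 / c) * y" by (rule mult_left_mono) simp
      then show "1 \<le> ennreal (1 / c) * y" using c by (simp add: ennreal_mult'[symmetric])
    qed
    then show ?thesis by simp
  qed
  also have "emeasure M \<dots> \<le> ennreal (1 / c) * (\<integral>\<^sup>+x. u x * indicator (space M) x \<partial>M)"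
    by (rule nn_integral_Markov_inequality) auto
  also have "(\<integral>\<^sup>+x. u x * indicator (space M) x \<partial>M) = (\<integral>\<^sup>+x. u x \<partial>M)"
    by (intro nn_integral_cong) simp
  also have "ennreal (1 / c) * \<dots> \<le> ennreal (1 / c) * ennreal a"
    using u by (rule mult_left_mono) simp
  also have "\<dots> = ennreal (a / c)" using c by (simp add: ennreal_mult'[symmetric])
  finally show ?thesis .
qed

text \<open>Markov's inequality for \<open>exp (x\<^sup>2 / (4 * s\<^sup>2))\<close>. This factor
  turns the density of variance \<open>s\<^sup>2\<close> into \<open>sqrt 2\<close> times the one of
  variance \<open>2 * s\<^sup>2\<close>, so its mean is \<open>sqrt 2\<close>.\<close>

lemma gauss_tail_le:
  assumes s: "s > 0" and C: "C \<ge> 0"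
  shows "emeasure (gauss 0 s) {x. C < \<bar>x\<bar>} \<le> ennreal (sqrt 2 * exp (- C\<^sup>2 / (4 * s\<^sup>2)))"
proof -
  have "emeasure (gauss 0 s) {x. C < \<bar>x\<bar>} \<le> emeasure (gauss 0 s) {x \<in> space (gauss 0 s). ennreal (exp (C\<^sup>2 / (4 * s\<^sup>2))) \<le> ennreal (exp (x\<^sup>2 / (4 * s\<^sup>2)))}"
  proof (rule emeasure_mono)
    show "{x. C < \<bar>x\<bar>} \<subseteq> {x \<in> space (gauss 0 s). ennreal (exp (C\<^sup>2 / (4 * s\<^sup>2))) \<le> ennreal (exp (x\<^sup>2 / (4 * s\<^sup>2)))}"
    proof
      fix x assume "x \<in> {x. C < \<bar>x\<bar>}"
      then have "C\<^sup>2 \<le> \<bar>x\<bar>\<^sup>2" using C by (intro power_mono) auto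
      then show "x \<in> {x \<in> space (gauss 0 s). ennreal (exp (C\<^sup>2 / (4 * s\<^sup>2))) \<le> ennreal (exp (x\<^sup>2 / (4 * s\<^sup>2)))}"
        by (auto intro!: divide_right_mono)
    qed
  qed measurable
  also have "\<dots> \<le> ennreal (sqrt 2 / exp (C\<^sup>2 / (4 * s\<^sup>2)))"
  proof (rule emeasure_ge_le)
    have d: "normal_density 0 s x * exp (x\<^sup>2 / (4 * s\<^sup>2)) = sqrt 2 * normal_density 0 (sqrt 2 * s) x" for x
    proof -
      have "sqrt (2 * pi * (sqrt 2 * s)\<^sup>2) = sqrt 2 * sqrt (2 * pi * s\<^sup>2)"
        unfolding real_sqrt_mult[symmetric] by (simp add: power_mult_distrib)
      then have "sqrt 2 * normal_density 0 (sqrt 2 * s) x = exp (- x\<^sup>2 / (4 * s\<^sup>2)) / sqrt (2 * pi * s\<^sup>2)"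
        by (simp add: normal_density_def power_mult_distrib)
      also have "- x\<^sup>2 / (4 * s\<^sup>2) = - x\<^sup>2 / (2 * s\<^sup>2) + x\<^sup>2 / (4 * s\<^sup>2)"
        using s by (simp add: field_simps)
      finally show ?thesis unfolding exp_add by (simp add: normal_density_def)
    qed
    have "(\<integral>\<^sup>+x. ennreal (exp (x\<^sup>2 / (4 * s\<^sup>2))) \<partial>gauss 0 s) = (\<integral>\<^sup>+x. ennreal (sqrt 2) * ennreal (normal_density 0 (sqrt 2 * s) x) \<partial>lborel)"
      unfolding gauss_def by (subst nn_integral_density) (auto simp: ennreal_mult[symmetric] d)
    also have "\<dots> = ennreal (sqrt 2) * (\<integral>\<^sup>+x. ennreal (normal_density 0 (sqrt 2 * s) x) \<partial>lborel)"
      by (intro nn_integral_cmult) auto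
    also have "(\<integral>\<^sup>+x. ennreal (normal_density 0 (sqrt 2 * s) x) \<partial>lborel) = 1"
      using s by (subst nn_integral_eq_integral) auto
    finally show "(\<integral>\<^sup>+x. ennreal (exp (x\<^sup>2 / (4 * s\<^sup>2))) \<partial>gauss 0 s) \<le> ennreal (sqrt 2)" by simp
  qed auto
  also have "sqrt 2 / exp (C\<^sup>2 / (4 * s\<^sup>2)) = sqrt 2 * exp (- C\<^sup>2 / (4 * s\<^sup>2))"
    unfolding minus_divide_left[symmetric] exp_minus by (simp only: divide_inverse)
  finally show ?thesis .
qed

lemma gprod_tail_le:
  assumes s: "s > 0" and C: "C \<ge> 0"
  shows "emeasure (gprod K (\<lambda>_. 0) (\<lambda>_. s)) {\<theta> \<in> space (gprod K (\<lambda>_. 0) (\<lambda>_. s)). \<not> (\<forall>i<K. \<bar>\<theta> i\<bar> \<le> C)}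
    \<le> ennreal (real K * (sqrt 2 * exp (- C\<^sup>2 / (4 * s\<^sup>2))))"
proof -
  let ?G = "gprod K (\<lambda>_. 0) (\<lambda>_. s)"
  have s': "\<forall>i<K. (\<lambda>_. s) i > 0" using s by simp
  have m: "{\<theta> \<in> space ?G. C < \<bar>\<theta> i\<bar>} \<in> sets ?G" if "i < K" for i
  proof -
    from that have "i \<in> {..<K}" by simp
    note [measurable] = measurable_component_singleton[OF this, of "\<lambda>_. borel"]
    show ?thesis by measurable
  qed
  have "emeasure ?G {\<theta> \<in> space ?G. \<not> (\<forall>i<K. \<bar>\<theta> i\<bar> \<le> C)} = emeasure ?G (\<Union>i<K. {\<theta> \<in> space ?G. C < \<bar>\<theta> i\<bar>})"
    by (intro arg_cong[where f="emeasure ?G"]) (auto simp: not_le)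
  also have "\<dots> \<le> (\<Sum>i<K. emeasure ?G {\<theta> \<in> space ?G. C < \<bar>\<theta> i\<bar>})"
    using m by (intro emeasure_subadditive_finite) auto
  also have "\<dots> \<le> (\<Sum>i<K. ennreal (sqrt 2 * exp (- C\<^sup>2 / (4 * s\<^sup>2))))"
  proof (rule sum_mono)
    fix i assume "i \<in> {..<K}"
    then have i: "i < K" by simp
    have "emeasure ?G {\<theta> \<in> space ?G. C < \<bar>\<theta> i\<bar>} = (\<integral>\<^sup>+\<theta>. indicator {\<theta> \<in> space ?G. C < \<bar>\<theta> i\<bar>} \<theta> \<partial>?G)"
      using m[OF i] by simp
    also have "\<dots> = (\<integral>\<^sup>+\<theta>. indicator {x. C < \<bar>x\<bar>} (\<theta> i) \<partial>?G)"
      by (intro nn_integral_cong) (auto simp: indicator_def)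
    also have "\<dots> = (\<integral>\<^sup>+x. indicator {x. C < \<bar>x\<bar>} x \<partial>gauss 0 s)"
      by (rule nn_integral_gprod_component[OF s' i]) measurable
    also have "\<dots> = emeasure (gauss 0 s) {x. C < \<bar>x\<bar>}"
      by (intro nn_integral_indicator) measurable
    also have "\<dots> \<le> ennreal (sqrt 2 * exp (- C\<^sup>2 / (4 * s\<^sup>2)))"
      using gauss_tail_le[OF s C] .
    finally show "emeasure ?G {\<theta> \<in> space ?G. C < \<bar>\<theta> i\<bar>} \<le> ennreal (sqrt 2 * exp (- C\<^sup>2 / (4 * s\<^sup>2)))" .
  qed
  also have "\<dots> = ennreal (real K * (sqrt 2 * exp (- C\<^sup>2 / (4 * s\<^sup>2))))"
    by (simp add: ennreal_mult' ennreal_of_nat_eq_real_of_nat)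
  finally show ?thesis .
qed

section \<open>Mean log likelihood ratio under a Gaussian product\<close>

context regression
begin

text \<open>The Lipschitz bound is weakened from the largest coordinate difference to the Euclidean
  distance, because the square of the latter has an explicit mean under a Gaussian product centred
  at \<open>\<theta>'\<close>.\<close>

lemma L2dist_nn_square_le:
  assumes B: "\<forall>i<nparams p k. \<bar>\<theta>' i\<bar> \<le> B"
  shows "(L2dist p (nn p k \<theta>) f0)\<^sup>2 \<le> 2 * (L2dist p (nn p k \<theta>') f0)\<^sup>2
    + 2 * (real (nparams p k) * (1 + B))\<^sup>2 * (\<Sum>i<nparams p k. (\<theta> i - \<theta>' i)\<^sup>2)"
proof -
  interpret prob_space "Xmeas p" by (rule prob_space_Xmeas)
  let ?K = "nparams p k"
  define r where "r = sqrt (\<Sum>i<?K. (\<theta> i - \<theta>' i)\<^sup>2)"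
  have r2: "r\<^sup>2 = (\<Sum>i<?K. (\<theta> i - \<theta>' i)\<^sup>2)" by (simp add: r_def sum_nonneg)
  have r: "\<forall>i<?K. \<bar>\<theta> i - \<theta>' i\<bar> \<le> r"
  proof (intro allI impI)
    fix i assume "i < ?K"
    then have "(\<theta> i - \<theta>' i)\<^sup>2 \<le> (\<Sum>i<?K. (\<theta> i - \<theta>' i)\<^sup>2)" by (intro member_le_sum) auto
    then show "\<bar>\<theta> i - \<theta>' i\<bar> \<le> r" unfolding r_def by (metis real_sqrt_abs real_sqrt_le_iff)
  qed
  have "(L2dist p (nn p k \<theta>) f0)\<^sup>2 = (\<integral>x. (nn p k \<theta> x - f0 x)\<^sup>2 \<partial>Xmeas p)"
    unfolding L2dist_def by simp
  also have "\<dots> \<le> (\<integral>x. 2 * (nn p k \<theta>' x - f0 x)\<^sup>2 + 2 * (real ?K * (1 + B) * r)\<^sup>2 \<partial>Xmeas p)"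
  proof (rule integral_mono_AE)
    show "AE x in Xmeas p. (nn p k \<theta> x - f0 x)\<^sup>2 \<le> 2 * (nn p k \<theta>' x - f0 x)\<^sup>2 + 2 * (real ?K * (1 + B) * r)\<^sup>2"
      using AE_Xmeas_cube
    proof eventually_elim
      fix x assume "\<forall>h\<in>{1..p}. x h \<in> {0..1::real}"
      then have "\<bar>nn p k \<theta> x - nn p k \<theta>' x\<bar> \<le> real ?K * (1 + B) * r"
        using nn_lipschitz[OF r B] by simp
      then have "(nn p k \<theta> x - nn p k \<theta>' x)\<^sup>2 \<le> (real ?K * (1 + B) * r)\<^sup>2"
        by (metis abs_ge_zero power2_abs power_mono)
      moreover have "(nn p k \<theta> x - f0 x)\<^sup>2 \<le> 2 * (nn p k \<theta> x - nn p k \<theta>' x)\<^sup>2 + 2 * (nn p k \<theta>' x - f0 x)\<^sup>2"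
        using sum_squares_bound[of "nn p k \<theta> x - nn p k \<theta>' x" "nn p k \<theta>' x - f0 x"]
        by (simp add: power2_eq_square algebra_simps)
      ultimately show "(nn p k \<theta> x - f0 x)\<^sup>2 \<le> 2 * (nn p k \<theta>' x - f0 x)\<^sup>2 + 2 * (real ?K * (1 + B) * r)\<^sup>2"
        by linarith
    qed
  next
    show "integrable (Xmeas p) (\<lambda>x. 2 * (nn p k \<theta>' x - f0 x)\<^sup>2 + 2 * (real ?K * (1 + B) * r)\<^sup>2)"
      by (intro Bochner_Integration.integrable_add integrable_mult_right integrable_nn_diff_square f0_meas f0_L2 integrable_const)
  qed (rule integrable_nn_diff_square[OF f0_meas f0_L2])
  also have "\<dots> = 2 * (\<integral>x. (nn p k \<theta>' x - f0 x)\<^sup>2 \<partial>Xmeas p) + 2 * (real ?K * (1 + B) * r)\<^sup>2"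
    using prob_space by (simp add: integrable_nn_diff_square f0_L2)
  also have "(\<integral>x. (nn p k \<theta>' x - f0 x)\<^sup>2 \<partial>Xmeas p) = (L2dist p (nn p k \<theta>') f0)\<^sup>2"
    unfolding L2dist_def by simp
  finally show ?thesis by (simp add: power_mult_distrib r2 mult.assoc)
qed

text \<open>Tonelli allows the data to be integrated first, which bounds each inner mean through a
  squared L2 distance; the remaining integral is a second moment. The \<open>+ 1\<close> is the
  price of the cut at 0 in \<open>nn_integral_pos_part_le\<close>.\<close>

lemma expected_log_ratio_le:
  assumes B: "\<forall>i<nparams p k. \<bar>\<theta>' i\<bar> \<le> B" and s: "s > 0"
  shows "(\<integral>\<^sup>+D. (\<integral>\<^sup>+\<theta>. ennreal (ln (1 / lr k n D \<theta>)) \<partial>gprod (nparams p k) \<theta>' (\<lambda>_. s)) \<partial>data n)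
    \<le> ennreal (real n / \<sigma>\<^sup>2 * ((L2dist p (nn p k \<theta>') f0)\<^sup>2 + (real (nparams p k) * (1 + B))\<^sup>2 * (real (nparams p k) * s\<^sup>2)) + 1)"
proof -
  let ?K = "nparams p k"
  let ?q = "gprod ?K \<theta>' (\<lambda>_. s)"
  have s': "\<forall>i<?K. (\<lambda>_. s) i > 0" using s by simp
  interpret q: prob_space ?q using s' by (rule prob_space_gprod)
  let ?L = "(L2dist p (nn p k \<theta>') f0)\<^sup>2" and ?A = "(real ?K * (1 + B))\<^sup>2"
  have sum: "has_bochner_integral ?q (\<lambda>\<theta>. \<Sum>i<?K. (\<theta> i - \<theta>' i)\<^sup>2) (\<Sum>i<?K. s\<^sup>2)"
    using gprod_centered_second_moment[OF s'] by (intro has_bochner_integral_sum) auto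
  have "(\<integral>\<^sup>+D. (\<integral>\<^sup>+\<theta>. ennreal (ln (1 / lr k n D \<theta>)) \<partial>?q) \<partial>data n) = (\<integral>\<^sup>+\<theta>. (\<integral>\<^sup>+D. ennreal (ln (1 / lr k n D \<theta>)) \<partial>data n) \<partial>?q)"
    by (rule nn_integral_data_swap[OF q.prob_space_axioms]) auto
  also have "\<dots> \<le> (\<integral>\<^sup>+\<theta>. ennreal (real n / \<sigma>\<^sup>2 * (?L + ?A * (\<Sum>i<?K. (\<theta> i - \<theta>' i)\<^sup>2)) + 1) \<partial>?q)"
  proof (rule nn_integral_mono)
    fix \<theta>
    have "(\<integral>\<^sup>+D. ennreal (ln (1 / lr k n D \<theta>)) \<partial>data n) \<le> ennreal (real n * ((L2dist p (nn p k \<theta>) f0)\<^sup>2 / (2 * \<sigma>\<^sup>2)) + 1)"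
      by (rule nn_integral_pos_part_le)
    also have "\<dots> \<le> ennreal (real n * ((2 * ?L + 2 * ?A * (\<Sum>i<?K. (\<theta> i - \<theta>' i)\<^sup>2)) / (2 * \<sigma>\<^sup>2)) + 1)"
      using L2dist_nn_square_le[OF B] by (intro ennreal_leI add_right_mono mult_left_mono divide_right_mono) auto
    also have "real n * ((2 * ?L + 2 * ?A * (\<Sum>i<?K. (\<theta> i - \<theta>' i)\<^sup>2)) / (2 * \<sigma>\<^sup>2))
       = real n / \<sigma>\<^sup>2 * (?L + ?A * (\<Sum>i<?K. (\<theta> i - \<theta>' i)\<^sup>2))"
      using sigma_pos by (simp add: field_simps)
    finally show "(\<integral>\<^sup>+D. ennreal (ln (1 / lr k n D \<theta>)) \<partial>data n)
       \<le> ennreal (real n / \<sigma>\<^sup>2 * (?L + ?A * (\<Sum>i<?K. (\<theta> i - \<theta>' i)\<^sup>2)) + 1)" .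
  qed
  also have "\<dots> = ennreal (\<integral>\<theta>. real n / \<sigma>\<^sup>2 * (?L + ?A * (\<Sum>i<?K. (\<theta> i - \<theta>' i)\<^sup>2)) + 1 \<partial>?q)"
    using sum by (intro nn_integral_eq_integral Bochner_Integration.integrable_add integrable_mult_right q.integrable_const)
      (auto simp: has_bochner_integral_iff intro!: AE_I2 add_nonneg_nonneg mult_nonneg_nonneg sum_nonneg divide_nonneg_nonneg)
  also have "(\<integral>\<theta>. real n / \<sigma>\<^sup>2 * (?L + ?A * (\<Sum>i<?K. (\<theta> i - \<theta>' i)\<^sup>2)) + 1 \<partial>?q)
     = real n / \<sigma>\<^sup>2 * (?L + ?A * (\<Sum>i<?K. s\<^sup>2)) + 1"
  proof -
    have "has_bochner_integral ?q (\<lambda>\<theta>. real n / \<sigma>\<^sup>2 * (?L + ?A * (\<Sum>i<?K. (\<theta> i - \<theta>' i)\<^sup>2)) + 1) (real n / \<sigma>\<^sup>2 * (?L + ?A * (\<Sum>i<?K. s\<^sup>2)) + 1)"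
      using q.prob_space by (intro has_bochner_integral_add has_bochner_integral_mult_right sum)
        (auto simp: has_bochner_integral_iff)
    then show ?thesis by (simp add: has_bochner_integral_iff)
  qed
  finally show ?thesis by simp
qed

lemma likelihood_le: "likelihood p k \<sigma> n D \<theta> \<le> (1 / sqrt (2 * pi * \<sigma>\<^sup>2)) ^ n"
proof -
  have "lik1 \<sigma> f y x \<le> 1 / sqrt (2 * pi * \<sigma>\<^sup>2)" for f y x
    unfolding lik1_def normal_density_def by (intro mult_left_le) auto
  then have "likelihood p k \<sigma> n D \<theta> \<le> (\<Prod>i<n. 1 / sqrt (2 * pi * \<sigma>\<^sup>2))"
    unfolding likelihood_def by (intro prod_mono) auto
  then show ?thesis by simp
qed

lemma integrable_ln_likelihood:
  assumes D: "D \<in> space (data n)" and s: "\<forall>i<nparams p k. s i > 0"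
  shows "integrable (gprod (nparams p k) m s) (\<lambda>\<theta>. ln (likelihood p k \<sigma> n D \<theta>))"
proof -
  let ?q = "gprod (nparams p k) m s"
  interpret prob_space ?q using s by (rule prob_space_gprod)
  note [measurable] = measurable_likelihood_param[OF D, of k]
  have eq: "ln (likelihood p k \<sigma> n D \<theta>) = (\<Sum>i<n. - (fst (D i) - nn p k \<theta> (snd (D i)))\<^sup>2 / (2 * \<sigma>\<^sup>2) - ln (sqrt (2 * pi) * \<sigma>))" for \<theta>
  proof -
    have "ln (likelihood p k \<sigma> n D \<theta>) = (\<Sum>i<n. ln (lik1 \<sigma> (nn p k \<theta>) (fst (D i)) (snd (D i))))"
      unfolding likelihood_def by (intro ln_prod) (auto simp: less_imp_neq[OF lik1_pos[OF sigma_pos], symmetric])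
    then show ?thesis by (simp add: lik1_def ln_normal_density sigma_pos)
  qed
  have bnd: "\<bar>ln (likelihood p k \<sigma> n D \<theta>)\<bar>
    \<le> (\<Sum>i<n. (2 * (fst (D i))\<^sup>2 + 2 * (real (k + 1) * (\<Sum>j\<le>k. (\<theta> j)\<^sup>2))) / (2 * \<sigma>\<^sup>2) + \<bar>ln (sqrt (2 * pi) * \<sigma>)\<bar>)" for \<theta>
    unfolding eq
  proof (rule order_trans[OF sum_abs], rule sum_mono)
    fix i
    let ?y = "fst (D i)" and ?f = "nn p k \<theta> (snd (D i))"
    have "(?y - ?f)\<^sup>2 \<le> 2 * ?y\<^sup>2 + 2 * ?f\<^sup>2"
      using sum_squares_bound[of "?y" "- ?f"] by (simp add: power2_diff)
    also have "\<dots> \<le> 2 * ?y\<^sup>2 + 2 * (real (k + 1) * (\<Sum>j\<le>k. (\<theta> j)\<^sup>2))"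
      using nn_square_le by (intro add_left_mono mult_left_mono) auto
    finally have "(?y - ?f)\<^sup>2 / (2 * \<sigma>\<^sup>2) \<le> (2 * ?y\<^sup>2 + 2 * (real (k + 1) * (\<Sum>j\<le>k. (\<theta> j)\<^sup>2))) / (2 * \<sigma>\<^sup>2)"
      by (rule divide_right_mono) simp
    moreover have "0 \<le> (?y - ?f)\<^sup>2 / (2 * \<sigma>\<^sup>2)" by simp
    ultimately show "\<bar>- (?y - ?f)\<^sup>2 / (2 * \<sigma>\<^sup>2) - ln (sqrt (2 * pi) * \<sigma>)\<bar>
      \<le> (2 * ?y\<^sup>2 + 2 * (real (k + 1) * (\<Sum>j\<le>k. (\<theta> j)\<^sup>2))) / (2 * \<sigma>\<^sup>2) + \<bar>ln (sqrt (2 * pi) * \<sigma>)\<bar>"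
      unfolding minus_divide_left[symmetric] by linarith
  qed
  have "integrable ?q (\<lambda>\<theta>. \<Sum>j\<le>k. (\<theta> j)\<^sup>2)"
    by (intro Bochner_Integration.integrable_sum integrable_gprod_second_moment[OF s] beta_idx_less) auto
  then have int: "integrable ?q (\<lambda>\<theta>. \<Sum>i<n. (2 * (fst (D i))\<^sup>2 + 2 * (real (k + 1) * (\<Sum>j\<le>k. (\<theta> j)\<^sup>2))) / (2 * \<sigma>\<^sup>2) + \<bar>ln (sqrt (2 * pi) * \<sigma>)\<bar>)"
    by (intro Bochner_Integration.integrable_sum[where I="{..<n}"] Bochner_Integration.integrable_add integrable_divide_zero integrable_mult_right integrable_const) auto
  show ?thesis
    by (rule Bochner_Integration.integrable_bound[OF int])
       (auto intro!: AE_I2 order_trans[OF bnd] simp del: of_nat_add)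
qed

end

subsection \<open>A finite-sample bound\<close>

text \<open>\<open>ennreal\<close> sees only the positive part, and the negative part can only lower
  the Bochner integral.\<close>

lemma integral_le_of_nn_integral_le:
  fixes f :: "'a \<Rightarrow> real"
  assumes "integrable M f" "(\<integral>\<^sup>+x. ennreal (f x) \<partial>M) \<le> ennreal w" "w \<ge> 0"
  shows "(\<integral>x. f x \<partial>M) \<le> w"
proof -
  have "(\<integral>x. f x \<partial>M) \<le> enn2real (\<integral>\<^sup>+x. ennreal (f x) \<partial>M)"
    using assms(1) by (subst real_lebesgue_integral_def) auto
  also have "\<dots> \<le> w" using assms(2,3) by (intro enn2real_leI) auto
  finally show ?thesis .
qed

section \<open>Chernoff bound over the grid and the exceptional event\<close>

context regression
begin

text \<open>Moving the fitted value by at most \<open>\<eta>\<close> lowers the squared residual by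
  at most \<open>2 * \<eta>\<close> times the absolute residual at \<open>r\<close>. The bound is
  written as a square because the Chernoff argument controls the product of square roots.\<close>

lemma lr_le_of_near:
  assumes cube: "\<forall>i<n. \<forall>h\<in>{1..p}. snd (D i) h \<in> {0..1}"
    and near: "\<forall>i<nparams p k. \<bar>\<theta> i - r i\<bar> \<le> d" and C: "\<forall>i<nparams p k. \<bar>r i\<bar> \<le> C"
    and \<eta>: "real (nparams p k) * (1 + C) * d \<le> \<eta>"
  shows "lr k n D \<theta> \<le> (\<Prod>i<n. sqrt (lik1 \<sigma> (nn p k r) (fst (D i)) (snd (D i)) / lik1 \<sigma> f0 (fst (D i)) (snd (D i)))
       * exp (\<eta> / (2 * \<sigma>\<^sup>2) * \<bar>fst (D i) - nn p k r (snd (D i))\<bar>))\<^sup>2"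
  unfolding lr_eq_prod prod_power_distrib
proof (rule prod_mono, rule conjI)
  fix i assume "i \<in> {..<n}"
  then have i: "i < n" by simp
  let ?y = "fst (D i)" and ?x = "snd (D i)"
  let ?f = "nn p k \<theta> ?x" and ?g = "nn p k r ?x"
  let ?T = "lik1 \<sigma> f0 ?y ?x"
  have T: "?T > 0" using sigma_pos by (rule lik1_pos)
  show "0 \<le> lik1 \<sigma> (nn p k \<theta>) ?y ?x / ?T" using T by simp
  have "\<bar>?f - ?g\<bar> \<le> \<eta>"
    using nn_lipschitz[OF near C, of ?x] cube i \<eta> by auto
  then have "\<bar>?y - ?g\<bar> * \<bar>?f - ?g\<bar> \<le> \<bar>?y - ?g\<bar> * \<eta>"
    by (rule mult_left_mono) simp
  then have "(?y - ?g) * (?f - ?g) \<le> \<bar>?y - ?g\<bar> * \<eta>"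
    using abs_ge_self[of "(?y - ?g) * (?f - ?g)"] unfolding abs_mult by linarith
  moreover have "(?y - ?g)\<^sup>2 - (?y - ?f)\<^sup>2 = 2 * ((?y - ?g) * (?f - ?g)) - (?f - ?g)\<^sup>2"
    by (simp add: power2_eq_square algebra_simps)
  moreover have "0 \<le> (?f - ?g)\<^sup>2" by simp
  ultimately have "(?y - ?g)\<^sup>2 - (?y - ?f)\<^sup>2 \<le> 2 * (\<bar>?y - ?g\<bar> * \<eta>)" by linarith
  then have "((?y - ?g)\<^sup>2 - (?y - ?f)\<^sup>2) / (2 * \<sigma>\<^sup>2) \<le> 2 * (\<bar>?y - ?g\<bar> * \<eta>) / (2 * \<sigma>\<^sup>2)"
    by (rule divide_right_mono) simp
  then have e: "- (?y - ?f)\<^sup>2 / (2 * \<sigma>\<^sup>2) \<le> - (?y - ?g)\<^sup>2 / (2 * \<sigma>\<^sup>2) + 2 * (\<eta> / (2 * \<sigma>\<^sup>2) * \<bar>?y - ?g\<bar>)"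
    by (simp add: diff_divide_distrib mult.commute)
  have "lik1 \<sigma> (nn p k \<theta>) ?y ?x \<le> lik1 \<sigma> (nn p k r) ?y ?x * exp (2 * (\<eta> / (2 * \<sigma>\<^sup>2) * \<bar>?y - ?g\<bar>))"
    unfolding lik1_def normal_density_def mult.assoc exp_add[symmetric] using e
    by (intro mult_left_mono) auto
  then have "lik1 \<sigma> (nn p k \<theta>) ?y ?x / ?T
     \<le> lik1 \<sigma> (nn p k r) ?y ?x / ?T * exp (2 * (\<eta> / (2 * \<sigma>\<^sup>2) * \<bar>?y - ?g\<bar>))"
    using T by (simp add: divide_right_mono)
  also have "\<dots> = (sqrt (lik1 \<sigma> (nn p k r) ?y ?x / ?T) * exp (\<eta> / (2 * \<sigma>\<^sup>2) * \<bar>?y - ?g\<bar>))\<^sup>2"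
    using T by (simp only: power_mult_distrib exp_double) simp
  finally show "lik1 \<sigma> (nn p k \<theta>) ?y ?x / ?T \<le> (sqrt (lik1 \<sigma> (nn p k r) ?y ?x / ?T) * exp (\<eta> / (2 * \<sigma>\<^sup>2) * \<bar>?y - ?g\<bar>))\<^sup>2" .
qed

text \<open>Markov's inequality for a product of independent factors of mean at most
  \<open>\<rho>\<close>. The threshold has \<open>t / 2\<close> because the factors live on the
  scale of square roots of likelihood ratios: squaring gives \<open>exp (- t)\<close>.\<close>

lemma far_event:
  assumes far: "\<not> dH p \<sigma> f0 (nn p k r) < ennreal \<epsilon>" and \<epsilon>: "\<epsilon> > 0"
    and \<eta>: "0 \<le> \<eta>" "\<eta> \<le> 2 * \<sigma>\<^sup>2" and \<kappa>: "\<kappa> > 0"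
    and \<rho>: "1 - \<epsilon> / 2 + \<kappa> / 2 + (\<eta> / (2 * \<sigma>\<^sup>2))\<^sup>2 / (2 * \<kappa>) * (sqrt 2 * exp (4 * \<sigma>\<^sup>2)) \<le> \<rho>" "0 \<le> \<rho>"
  defines "U \<equiv> \<lambda>z. sqrt (lik1 \<sigma> (nn p k r) (fst z) (snd z) / lik1 \<sigma> f0 (fst z) (snd z))
       * exp (\<eta> / (2 * \<sigma>\<^sup>2) * \<bar>fst z - nn p k r (snd z)\<bar>)"
  shows "{D \<in> space (data n). exp (- t / 2) \<le> (\<Prod>i<n. U (D i))} \<in> sets (data n)"
    and "emeasure (data n) {D \<in> space (data n). exp (- t / 2) \<le> (\<Prod>i<n. U (D i))} \<le> ennreal (exp (t / 2) * \<rho> ^ n)"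
proof -
  have U [measurable]: "U \<in> borel_measurable (borel \<Otimes>\<^sub>M Xmeas p)"
    unfolding U_def by measurable
  have U0: "U z \<ge> 0" for z unfolding U_def by simp
  have comp: "(\<lambda>D. U (D i)) \<in> borel_measurable (data n)" if "i \<in> {..<n}" for i
    using measurable_compose[OF measurable_component_singleton[OF that] U] by simp
  then have [measurable]: "(\<lambda>D. \<Prod>i<n. U (D i)) \<in> borel_measurable (data n)"
    by (intro borel_measurable_prod)
  show "{D \<in> space (data n). exp (- t / 2) \<le> (\<Prod>i<n. U (D i))} \<in> sets (data n)"
    by measurable
  have "(\<integral>\<^sup>+D. ennreal (\<Prod>i<n. U (D i)) \<partial>data n) = (\<integral>\<^sup>+D. (\<Prod>i<n. ennreal (U (D i))) \<partial>data n)"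
    by (simp add: prod_ennreal U0)
  also have "\<dots> = (\<integral>\<^sup>+z. ennreal (U z) \<partial>obs) ^ n"
    by (rule nn_integral_data_prod[where g="\<lambda>z. ennreal (U z)"]) measurable
  also have "\<dots> \<le> ennreal \<rho> ^ n"
  proof (rule power_mono)
    have "(\<integral>\<^sup>+z. ennreal (U z) \<partial>obs) \<le> ennreal (1 - \<epsilon> / 2 + \<kappa> / 2 + (\<eta> / (2 * \<sigma>\<^sup>2))\<^sup>2 / (2 * \<kappa>) * (sqrt 2 * exp (4 * \<sigma>\<^sup>2)))"
      unfolding U_def using \<eta> sigma_pos
      by (intro nn_integral_sqrt_ratio_le f0_meas measurable_nn_Xmeas sigma_pos far \<epsilon> \<kappa>) (auto simp: divide_simps)
    also have "\<dots> \<le> ennreal \<rho>" using \<rho>(1) by (rule ennreal_leI)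
    finally show "(\<integral>\<^sup>+z. ennreal (U z) \<partial>obs) \<le> ennreal \<rho>" .
  qed simp
  also have "\<dots> = ennreal (\<rho> ^ n)" using \<rho>(2) by (simp add: ennreal_power)
  finally have le: "(\<integral>\<^sup>+D. ennreal (\<Prod>i<n. U (D i)) \<partial>data n) \<le> ennreal (\<rho> ^ n)" .
  have "emeasure (data n) {D \<in> space (data n). ennreal (exp (- t / 2)) \<le> ennreal (\<Prod>i<n. U (D i))} \<le> ennreal (\<rho> ^ n / exp (- t / 2))"
    by (rule emeasure_ge_le[OF _ le]) auto
  moreover have "\<rho> ^ n / exp (- t / 2) = exp (t / 2) * \<rho> ^ n"
    unfolding minus_divide_left[symmetric] exp_minus
    unfolding divide_inverse[of "\<rho> ^ n"] inverse_inverse_eq by (rule mult.commute)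
  moreover have "ennreal (exp (- t / 2)) \<le> ennreal (\<Prod>i<n. U (D i)) \<longleftrightarrow> exp (- t / 2) \<le> (\<Prod>i<n. U (D i))" for D
    using U0 by (intro ennreal_le_iff prod_nonneg) auto
  ultimately show "emeasure (data n) {D \<in> space (data n). exp (- t / 2) \<le> (\<Prod>i<n. U (D i))} \<le> ennreal (exp (t / 2) * \<rho> ^ n)"
    by simp
qed

lemma AE_data_cube: "AE D in data n. \<forall>i<n. \<forall>h\<in>{1..p}. snd (D i) h \<in> {0..1}"
proof -
  have "AE D in data n. \<forall>h\<in>{1..p}. snd (D i) h \<in> {0..1}" if "i \<in> {..<n}" for i
    unfolding data_law_def
    by (rule AE_PiM_component[where P="\<lambda>z. \<forall>h\<in>{1..p}. snd z h \<in> {0..1}", OF prob_space_obs that])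
       (rule AE_obs_law_cube[OF f0_meas sigma_pos])
  then have "AE D in data n. \<forall>i\<in>{..<n}. \<forall>h\<in>{1..p}. snd (D i) h \<in> {0..1}"
    by (rule AE_finite_allI[OF finite_lessThan])
  then show ?thesis by (simp only: Ball_def lessThan_iff)
qed

text \<open>The prior scale is a free parameter here, so that the finite-sample bound is separate
  from the dependence of the scale on \<open>n\<close>.\<close>

definition gauss_posterior :: "nat \<Rightarrow> real \<Rightarrow> nat \<Rightarrow> (nat \<Rightarrow> real \<times> (nat \<Rightarrow> real)) \<Rightarrow> (nat \<Rightarrow> real) measure" where
  "gauss_posterior k s0 n D = density (gprod (nparams p k) (\<lambda>_. 0) (\<lambda>_. s0))
     (\<lambda>\<theta>. ennreal (likelihood p k \<sigma> n D \<theta> /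
        (\<integral>t. likelihood p k \<sigma> n D t \<partial>gprod (nparams p k) (\<lambda>_. 0) (\<lambda>_. s0))))"

text \<open>The four summands belong to a large mean log ratio under the competitor, a large
  integrated ratio, too much ratio mass outside the cube, and a grid point with a large ratio.
  \<open>Bad\<close> is fixed before \<open>m\<close> and \<open>s'\<close>, so the minimiser may
  depend on the data in any way.\<close>

lemma variational_mass_event:
  fixes \<theta>' :: "nat \<Rightarrow> real"
  defines "w0 \<equiv> \<lambda>n k B s. real n / \<sigma>\<^sup>2 * ((L2dist p (nn p k \<theta>') f0)\<^sup>2
      + (real (nparams p k) * (1 + B))\<^sup>2 * (real (nparams p k) * s\<^sup>2)) + 1"
  assumes n: "n \<ge> 1" and s: "0 < s" "s \<le> s0" and C: "C \<ge> 0" and B: "\<forall>i<nparams p k. \<bar>\<theta>' i\<bar> \<le> B"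
    and \<epsilon>: "\<epsilon> > 0" and d: "d > 0" "real (nparams p k) * (1 + C) * d \<le> \<eta>"
    and \<eta>: "0 \<le> \<eta>" "\<eta> \<le> 2 * \<sigma>\<^sup>2" and \<kappa>: "\<kappa> > 0"
    and \<rho>: "1 - \<epsilon> / 2 + \<kappa> / 2 + (\<eta> / (2 * \<sigma>\<^sup>2))\<^sup>2 / (2 * \<kappa>) * (sqrt 2 * exp (4 * \<sigma>\<^sup>2)) \<le> \<rho>" "0 \<le> \<rho>"
    and t: "t \<ge> 0" and w: "w > 0"
  shows "\<exists>Bad\<in>sets (data n).
      measure (data n) Bad \<le> w0 n k B s / w + 1 / real n
          + exp t * (real (nparams p k) * (sqrt 2 * exp (- C\<^sup>2 / (4 * s0\<^sup>2))))
          + (2 * C / d + 2) ^ nparams p k * (exp (t / 2) * \<rho> ^ n) \<and>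
      (\<forall>D\<in>space (data n) - Bad. \<forall>m s'. (\<forall>i<nparams p k. s' i > 0) \<longrightarrow>
         dKL (gprod (nparams p k) m s') (gauss_posterior k s0 n D)
           \<le> dKL (gprod (nparams p k) \<theta>' (\<lambda>_. s)) (gauss_posterior k s0 n D) \<longrightarrow>
         t * measure (gprod (nparams p k) m s') (Vc p k \<sigma> f0 \<epsilon>)
           \<le> (\<Sum>i<nparams p k. ln (s0 / s) + (s\<^sup>2 + (\<theta>' i)\<^sup>2) / (2 * s0\<^sup>2)) + w + ln (real n + 2))"
proof -
  let ?K = "nparams p k"
  let ?P = "gprod ?K (\<lambda>_. 0) (\<lambda>_. s0)" and ?q = "gprod ?K \<theta>' (\<lambda>_. s)"
  let ?V = "Vc p k \<sigma> f0 \<epsilon>"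
  have s0: "s0 > 0" using s by linarith
  have s0': "\<forall>i<?K. (\<lambda>_. s0) i > 0" and s': "\<forall>i<?K. (\<lambda>_. s) i > 0" using s s0 by auto
  interpret P: prob_space ?P using s0' by (rule prob_space_gprod)
  interpret q: prob_space ?q using s' by (rule prob_space_gprod)
  interpret D: prob_space "data n" by (rule prob_space_data)
  define F where "F = {\<theta> \<in> space ?P. \<forall>i<?K. \<bar>\<theta> i\<bar> \<le> C}"
  define Fc where "Fc = {\<theta> \<in> space ?P. \<not> (\<forall>i<?K. \<bar>\<theta> i\<bar> \<le> C)}"
  have Fc [measurable]: "Fc \<in> sets (PiM {..<?K} (\<lambda>_. borel))"
  proof -
    have "Fc = (\<Union>i<?K. {\<theta> \<in> space ?P. C < \<bar>\<theta> i\<bar>})"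
      unfolding Fc_def by (auto simp: not_le)
    moreover have "{\<theta> \<in> space ?P. C < \<bar>\<theta> i\<bar>} \<in> sets ?P" if "i \<in> {..<?K}" for i
    proof -
      note [measurable] = measurable_component_singleton[OF that, of "\<lambda>_. borel"]
      show ?thesis by measurable
    qed
    ultimately have "Fc \<in> sets ?P" by (metis (no_types, lifting) sets.finite_UN finite_lessThan)
    then show ?thesis by simp
  qed
  obtain R where R: "R \<subseteq> ?V \<inter> F" "finite R" "real (card R) \<le> (2 * C / d + 2) ^ ?K"
    and cover: "\<And>\<theta>. \<theta> \<in> ?V \<inter> F \<Longrightarrow> \<exists>r\<in>R. \<forall>i<?K. \<bar>\<theta> i - r i\<bar> \<le> d"
    by (rule finite_cube_cover[of "?V \<inter> F" ?K C d]) (auto simp: F_def C d(1))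
  define U where "U r z = sqrt (lik1 \<sigma> (nn p k r) (fst z) (snd z) / lik1 \<sigma> f0 (fst z) (snd z))
       * exp (\<eta> / (2 * \<sigma>\<^sup>2) * \<bar>fst z - nn p k r (snd z)\<bar>)" for r and z :: "real \<times> (nat \<Rightarrow> real)"
  obtain N where N: "{D \<in> space (data n). \<not> (\<forall>i<n. \<forall>h\<in>{1..p}. snd (D i) h \<in> {0..1})} \<subseteq> N"
    "emeasure (data n) N = 0" "N \<in> sets (data n)"
    using AE_data_cube by (rule AE_E)
  define W where "W D = (\<integral>\<^sup>+\<theta>. ennreal (ln (1 / lr k n D \<theta>)) \<partial>?q)" for D
  define Z where "Z D = (\<integral>\<^sup>+\<theta>. ennreal (lr k n D \<theta>) \<partial>?P)" for D
  define ZF where "ZF D = (\<integral>\<^sup>+\<theta>. ennreal (lr k n D \<theta>) * indicator Fc \<theta> \<partial>?P)" for D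
  have Wm [measurable]: "W \<in> borel_measurable (data n)"
    unfolding W_def by (rule nn_integral_data_swap(2)[OF q.prob_space_axioms]) auto
  have Zm [measurable]: "Z \<in> borel_measurable (data n)"
    unfolding Z_def by (rule nn_integral_data_swap(2)[OF P.prob_space_axioms]) auto
  have ZFm [measurable]: "ZF \<in> borel_measurable (data n)"
    unfolding ZF_def by (rule nn_integral_data_swap(2)[OF P.prob_space_axioms]) auto
  have EW: "(\<integral>\<^sup>+D. W D \<partial>data n) \<le> ennreal (w0 n k B s)"
    unfolding W_def w0_def by (rule expected_log_ratio_le[OF B s(1)])
  have EZ: "(\<integral>\<^sup>+D. Z D \<partial>data n) \<le> ennreal 1"
  proof -
    have "(\<integral>\<^sup>+D. Z D \<partial>data n) = (\<integral>\<^sup>+\<theta>. (\<integral>\<^sup>+D. ennreal (lr k n D \<theta>) \<partial>data n) \<partial>?P)"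
      unfolding Z_def by (rule nn_integral_data_swap(1)[OF P.prob_space_axioms]) auto
    then show ?thesis by (simp add: nn_integral_lr P.emeasure_space_1)
  qed
  have EZF: "(\<integral>\<^sup>+D. ZF D \<partial>data n) \<le> ennreal (real ?K * (sqrt 2 * exp (- C\<^sup>2 / (4 * s0\<^sup>2))))"
  proof -
    have "(\<integral>\<^sup>+D. ZF D \<partial>data n) = (\<integral>\<^sup>+\<theta>. (\<integral>\<^sup>+D. ennreal (lr k n D \<theta>) * indicator Fc \<theta> \<partial>data n) \<partial>?P)"
      unfolding ZF_def by (rule nn_integral_data_swap(1)[OF P.prob_space_axioms]) auto
    also have "\<dots> = (\<integral>\<^sup>+\<theta>. indicator Fc \<theta> \<partial>?P)"
    proof (rule nn_integral_cong)
      fix \<theta>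
      have [measurable]: "(\<lambda>D. lr k n D \<theta>) \<in> borel_measurable (data n)" by (rule measurable_lr_data)
      have "(\<integral>\<^sup>+D. ennreal (lr k n D \<theta>) * indicator Fc \<theta> \<partial>data n)
        = (\<integral>\<^sup>+D. ennreal (lr k n D \<theta>) \<partial>data n) * indicator Fc \<theta>"
        by (rule nn_integral_multc) measurable
      then show "(\<integral>\<^sup>+D. ennreal (lr k n D \<theta>) * indicator Fc \<theta> \<partial>data n) = indicator Fc \<theta>"
        by (simp add: nn_integral_lr)
    qed
    also have "\<dots> = emeasure ?P Fc" by (rule nn_integral_indicator) simp
    also have "\<dots> \<le> ennreal (real ?K * (sqrt 2 * exp (- C\<^sup>2 / (4 * s0\<^sup>2))))"
      unfolding Fc_def by (rule gprod_tail_le[OF s0 C])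
    finally show ?thesis .
  qed
  \<comment> \<open>Thresholds: \<open>w\<close> is the allowance for the log ratio;
    \<open>n\<close> gives failure probability \<open>1 / n\<close> and later costs only a
    logarithm; \<open>exp (- t)\<close> cancels the weight \<open>exp t\<close> outside the cube;
    \<open>exp (- t / 2)\<close> is its square root.\<close>
  define B1 where "B1 = {D \<in> space (data n). ennreal w \<le> W D}"
  define B2 where "B2 = {D \<in> space (data n). ennreal (real n) \<le> Z D}"
  define B3 where "B3 = {D \<in> space (data n). ennreal (exp (- t)) \<le> ZF D}"
  define B4 where "B4 r = {D \<in> space (data n). exp (- t / 2) \<le> (\<Prod>i<n. U r (D i))}" for r
  have m1: "B1 \<in> sets (data n)" "emeasure (data n) B1 \<le> ennreal (w0 n k B s / w)"
    unfolding B1_def using w by (measurable, intro emeasure_ge_le EW) auto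
  have m2: "B2 \<in> sets (data n)" "emeasure (data n) B2 \<le> ennreal (1 / real n)"
    unfolding B2_def using n by (measurable, intro emeasure_ge_le EZ) auto
  have m3: "B3 \<in> sets (data n)" "emeasure (data n) B3 \<le> ennreal (exp t * (real ?K * (sqrt 2 * exp (- C\<^sup>2 / (4 * s0\<^sup>2)))))"
  proof -
    show "B3 \<in> sets (data n)" unfolding B3_def by measurable
    have "emeasure (data n) B3 \<le> ennreal (real ?K * (sqrt 2 * exp (- C\<^sup>2 / (4 * s0\<^sup>2))) / exp (- t))"
      unfolding B3_def by (intro emeasure_ge_le EZF) auto
    also have "real ?K * (sqrt 2 * exp (- C\<^sup>2 / (4 * s0\<^sup>2))) / exp (- t) = exp t * (real ?K * (sqrt 2 * exp (- C\<^sup>2 / (4 * s0\<^sup>2))))"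
      unfolding exp_minus[of t] divide_inverse[of _ "inverse (exp t)"] inverse_inverse_eq by (rule mult.commute)
    finally show "emeasure (data n) B3 \<le> ennreal (exp t * (real ?K * (sqrt 2 * exp (- C\<^sup>2 / (4 * s0\<^sup>2)))))" .
  qed
  have m4: "B4 r \<in> sets (data n)" "emeasure (data n) (B4 r) \<le> ennreal (exp (t / 2) * \<rho> ^ n)" if "r \<in> R" for r
  proof -
    have "\<not> dH p \<sigma> f0 (nn p k r) < ennreal \<epsilon>" using that R(1) by (auto simp: Vc_def)
    note * = far_event[OF this \<epsilon> \<eta> \<kappa> \<rho>, of n t]
    show "B4 r \<in> sets (data n)" "emeasure (data n) (B4 r) \<le> ennreal (exp (t / 2) * \<rho> ^ n)"
      unfolding B4_def U_def by (rule *)+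
  qed
  define B5 where "B5 = (\<Union>r\<in>R. B4 r)"
  have m5: "B5 \<in> sets (data n)" "emeasure (data n) B5 \<le> ennreal ((2 * C / d + 2) ^ ?K * (exp (t / 2) * \<rho> ^ n))"
  proof -
    show "B5 \<in> sets (data n)" unfolding B5_def using m4(1) R(2) by auto
    have "emeasure (data n) B5 \<le> (\<Sum>r\<in>R. emeasure (data n) (B4 r))"
      unfolding B5_def using m4(1) R(2) by (intro emeasure_subadditive_finite) auto
    also have "\<dots> \<le> (\<Sum>r\<in>R. ennreal (exp (t / 2) * \<rho> ^ n))"
      using m4(2) by (intro sum_mono)
    also have "\<dots> = ennreal (real (card R) * (exp (t / 2) * \<rho> ^ n))"
      by (simp add: ennreal_mult' ennreal_of_nat_eq_real_of_nat)
    also have "\<dots> \<le> ennreal ((2 * C / d + 2) ^ ?K * (exp (t / 2) * \<rho> ^ n))"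
      using R(3) \<rho>(2) by (intro ennreal_leI mult_right_mono) auto
    finally show "emeasure (data n) B5 \<le> ennreal ((2 * C / d + 2) ^ ?K * (exp (t / 2) * \<rho> ^ n))" .
  qed
  define Bad where "Bad = N \<union> B1 \<union> B2 \<union> B3 \<union> B5"
  have Bad: "Bad \<in> sets (data n)" unfolding Bad_def using N(3) m1 m2 m3 m5 by auto
  have w0nn: "0 \<le> w0 n k B s" unfolding w0_def by (auto intro!: add_nonneg_nonneg mult_nonneg_nonneg)
  have real_le: "measure (data n) A \<le> x" if "emeasure (data n) A \<le> ennreal x" "0 \<le> x" for A x
    using that unfolding D.emeasure_eq_measure by (simp add: ennreal_le_iff)
  have r1: "measure (data n) B1 \<le> w0 n k B s / w" using m1(2) w w0nn by (intro real_le) auto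
  have r2: "measure (data n) B2 \<le> 1 / real n" using m2(2) by (intro real_le) auto
  have r3: "measure (data n) B3 \<le> exp t * (real ?K * (sqrt 2 * exp (- C\<^sup>2 / (4 * s0\<^sup>2))))"
    using m3(2) by (intro real_le) auto
  have r5: "measure (data n) B5 \<le> (2 * C / d + 2) ^ ?K * (exp (t / 2) * \<rho> ^ n)"
    using m5(2) C d \<rho>(2) by (intro real_le) auto
  have r0: "measure (data n) N = 0" using N(2) by (simp add: measure_def)
  have sub: "measure (data n) (X \<union> Y) \<le> measure (data n) X + measure (data n) Y"
    if "X \<in> sets (data n)" "Y \<in> sets (data n)" for X Y
    using that by (rule measure_Un_le)
  have "measure (data n) Bad \<le> measure (data n) N + measure (data n) B1 + measure (data n) B2
      + measure (data n) B3 + measure (data n) B5"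
    unfolding Bad_def using N(3) m1(1) m2(1) m3(1) m5(1)
    by (intro order_trans[OF sub] add_mono order_refl sets.Un) auto
  then have prob: "measure (data n) Bad \<le> w0 n k B s / w + 1 / real n
          + exp t * (real ?K * (sqrt 2 * exp (- C\<^sup>2 / (4 * s0\<^sup>2))))
          + (2 * C / d + 2) ^ ?K * (exp (t / 2) * \<rho> ^ n)"
    using r0 r1 r2 r3 r5 by linarith
  let ?A = "\<Sum>i<?K. ln (s0 / s) + (s\<^sup>2 + (\<theta>' i)\<^sup>2) / (2 * s0\<^sup>2)"
  have A0: "0 \<le> ?A"
  proof (rule sum_nonneg)
    fix i
    have "0 \<le> ln (s0 / s)" using s by (intro ln_ge_zero) (simp add: divide_simps)
    then show "0 \<le> ln (s0 / s) + (s\<^sup>2 + (\<theta>' i)\<^sup>2) / (2 * s0\<^sup>2)" by simp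
  qed
  have good: "t * measure (gprod ?K m sv) ?V \<le> ?A + w + ln (real n + 2)"
    if Dg: "D \<in> space (data n) - Bad" and sv: "\<forall>i<?K. sv i > 0"
      and min: "dKL (gprod ?K m sv) (gauss_posterior k s0 n D) \<le> dKL ?q (gauss_posterior k s0 n D)"
    for D m sv
  proof (cases "?V \<in> sets (PiM {..<?K} (\<lambda>_. borel))")
    \<comment> \<open>\<open>measure\<close> is 0 by convention on a set outside the sigma-algebra,
      and the right side is nonnegative.\<close>
    case False
    then have "measure (gprod ?K m sv) ?V = 0" by (intro measure_notin_sets) simp
    moreover have "0 \<le> ln (real n + 2)" by (intro ln_ge_zero) simp
    ultimately show ?thesis using A0 w by simp
  next
    case V [measurable]: True
    have DS: "D \<in> space (data n)" using Dg by simp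
    have cube: "\<forall>i<n. \<forall>h\<in>{1..p}. snd (D i) h \<in> {0..1}" using Dg N(1) by (auto simp: Bad_def)
    have g1: "W D < ennreal w" and g2: "Z D < ennreal (real n)" and g3: "ZF D < ennreal (exp (- t))"
      and g5: "\<And>r. r \<in> R \<Longrightarrow> (\<Prod>i<n. U r (D i)) < exp (- t / 2)"
      using Dg by (auto simp: Bad_def B1_def B2_def B3_def B5_def B4_def not_le)
    note [measurable] = measurable_lr_param[OF DS, of k] measurable_likelihood_param[OF DS, of k]
    have small: "lr k n D \<theta> \<le> exp (- t)" if th: "\<theta> \<in> ?V \<inter> F" for \<theta>
    proof -
      obtain r where r: "r \<in> R" "\<forall>i<?K. \<bar>\<theta> i - r i\<bar> \<le> d" using cover[OF th] by blast
      have "\<forall>i<?K. \<bar>r i\<bar> \<le> C" using r(1) R(1) by (auto simp: F_def)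
      from lr_le_of_near[OF cube r(2) this d(2)]
      have "lr k n D \<theta> \<le> (\<Prod>i<n. U r (D i))\<^sup>2" unfolding U_def .
      also have "\<dots> \<le> (exp (- t / 2))\<^sup>2"
        using g5[OF r(1)] by (intro power_mono prod_nonneg) (auto simp: U_def)
      also have "\<dots> = exp (- t)" by (simp add: exp_double[symmetric])
      finally show ?thesis .
    qed
    have mass: "(\<integral>\<^sup>+\<theta>. ennreal (exp (t * indicator ?V \<theta>) * lr k n D \<theta>) \<partial>?P) \<le> ennreal (real n + 2)"
    proof -
      have "(\<integral>\<^sup>+\<theta>. ennreal (exp (t * indicator ?V \<theta>) * lr k n D \<theta>) \<partial>?P)
        \<le> (\<integral>\<^sup>+\<theta>. ennreal (lr k n D \<theta>) + ennreal (exp t) * (ennreal (lr k n D \<theta>) * indicator Fc \<theta>) + 1 \<partial>?P)"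
      proof (rule nn_integral_mono)
        fix \<theta> assume sp: "\<theta> \<in> space ?P"
        have lr0: "0 \<le> lr k n D \<theta>" by (rule less_imp_le[OF lr_pos])
        \<comment> \<open>Off \<open>?V\<close> the weight is 1 and the ratio is charged to
          \<open>Z\<close>. On the far part of the cube \<open>exp t\<close> meets
          \<open>lr \<le> exp (- t)\<close>, which accounts for the summand 1. The rest is charged
          to \<open>ZF\<close>.\<close>
        consider "\<theta> \<notin> ?V" | "\<theta> \<in> ?V \<inter> F" | "\<theta> \<in> Fc" "\<theta> \<in> ?V" using sp by (auto simp: F_def Fc_def)
        then show "ennreal (exp (t * indicator ?V \<theta>) * lr k n D \<theta>)
          \<le> ennreal (lr k n D \<theta>) + ennreal (exp t) * (ennreal (lr k n D \<theta>) * indicator Fc \<theta>) + 1"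
        proof cases
          case 1
          then show ?thesis by (simp add: add.assoc)
        next
          case 2
          then have "exp t * lr k n D \<theta> \<le> exp t * exp (- t)" by (intro mult_left_mono small) auto
          also have "\<dots> = 1" by (simp add: exp_minus)
          finally have "ennreal (exp (t * indicator ?V \<theta>) * lr k n D \<theta>) \<le> ennreal 1"
            using 2 by (intro ennreal_leI) simp
          then show ?thesis by (simp add: add_increasing)
        next
          case 3
          then show ?thesis using lr0 by (simp add: ennreal_mult add.commute[of "ennreal (lr k n D \<theta>)"] add.assoc)
        qed
      qed
      also have "\<dots> = Z D + ennreal (exp t) * ZF D + 1"
        unfolding Z_def ZF_def by (simp add: nn_integral_add nn_integral_cmult P.emeasure_space_1)
      also have "\<dots> \<le> ennreal (real n) + ennreal (exp t) * ennreal (exp (- t)) + 1"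
        using g2 g3 by (intro add_mono mult_left_mono) auto
      also have "\<dots> = ennreal (real n + 2)"
        by (simp add: ennreal_mult'[symmetric] exp_minus ennreal_plus[symmetric] del: ennreal_plus)
           (simp add: ennreal_plus[symmetric] ennreal_1[symmetric] del: ennreal_plus ennreal_1)
      finally show ?thesis .
    qed
    have Zpos: "0 < (\<integral>t. likelihood p k \<sigma> n D t \<partial>?P)"
      by (rule evidence_pos[OF s0' measurable_likelihood_param[OF DS] likelihood_pos likelihood_le])
    have int: "integrable (gprod ?K m s) (\<lambda>\<theta>. ln (likelihood p k \<sigma> n D \<theta>))" if "\<forall>i<?K. s i > 0" for m s
      by (rule integrable_ln_likelihood[OF DS that])
    have "t * measure (gprod ?K m sv) ?V
      \<le> (\<integral>\<theta>. ln (gdens ?K \<theta>' (\<lambda>_. s) \<theta>) - ln (gdens ?K (\<lambda>_. 0) (\<lambda>_. s0) \<theta>) \<partial>?q)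
        + (\<integral>\<theta>. ln (true_lik n D / likelihood p k \<sigma> n D \<theta>) \<partial>?q) + ln (real n + 2)"
      by (rule variational_mass_le[OF sv s0' s' measurable_likelihood_param[OF DS] likelihood_pos Zpos true_lik_pos int V _
            mass[unfolded lr_def] min[unfolded gauss_posterior_def]]) auto
    also have "(\<integral>\<theta>. ln (gdens ?K \<theta>' (\<lambda>_. s) \<theta>) - ln (gdens ?K (\<lambda>_. 0) (\<lambda>_. s0) \<theta>) \<partial>?q) \<le> ?A"
      by (rule gprod_relative_entropy_le[OF s' s0])
    also have "(\<integral>\<theta>. ln (true_lik n D / likelihood p k \<sigma> n D \<theta>) \<partial>?q) \<le> w"
    proof (rule integral_le_of_nn_integral_le)
      have "ln (true_lik n D / likelihood p k \<sigma> n D \<theta>) = ln (true_lik n D) - ln (likelihood p k \<sigma> n D \<theta>)" for \<theta>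
        using true_lik_pos[of n D] likelihood_pos[of k n D \<theta>] by (simp add: ln_div)
      then show "integrable ?q (\<lambda>\<theta>. ln (true_lik n D / likelihood p k \<sigma> n D \<theta>))"
        by (simp add: int[OF s'] Bochner_Integration.integrable_diff)
      show "(\<integral>\<^sup>+\<theta>. ennreal (ln (true_lik n D / likelihood p k \<sigma> n D \<theta>)) \<partial>?q) \<le> ennreal w"
        using less_imp_le[OF g1] by (simp add: W_def lr_def)
    qed (use w in simp)
    finally show ?thesis by simp
  qed
  show ?thesis
    using Bad prob good by (intro bexI[of _ Bad]) auto
qed

end

subsection \<open>Asymptotics\<close>

text \<open>A measurable cover bounds the outer probability from above; it also makes the set of
  covers nonempty, without which the infimum would have no reason to be nonnegative.\<close>

lemma outer_prob_bounds:
  assumes "A \<in> sets M" "S \<subseteq> A"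
  shows "0 \<le> outer_prob M S" "outer_prob M S \<le> measure M A"
proof -
  have "bdd_below (measure M ` {A \<in> sets M. S \<subseteq> A})" by (rule bdd_belowI[of _ 0]) auto
  then show "outer_prob M S \<le> measure M A"
    unfolding outer_prob_def using assms by (intro cInf_lower) auto
  show "0 \<le> outer_prob M S"
    unfolding outer_prob_def using assms by (intro cInf_greatest) auto
qed

text \<open>The first term is the relative entropy of order \<open>n powr a * ln n\<close>, measured
  against the scale \<open>n powr e\<close> with \<open>e = 1 - \<delta>\<close>.\<close>

lemma entropy_rate:
  fixes a e m A \<kappa> :: real
  assumes "0 < a" "a < e"
  shows "(\<lambda>n. \<kappa> * (real n powr a * (A + m * ln (real n)) / real n powr e)
      + c / real n powr e + ln (real n + 2) / real n powr e) \<longlonglongrightarrow> 0"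
  using assms by real_asymp

text \<open>The cube exceeds the prior scale by a factor of order \<open>n\<close>, so the Gaussian
  tail is quadratic in the exponent and beats the weight \<open>exp (c * n)\<close>.\<close>

lemma tail_rate:
  fixes b c \<kappa> :: real
  assumes "0 < c" "0 < b"
  shows "(\<lambda>n. exp (c * real n) * (\<kappa> * real n * (sqrt 2 * exp (- (real n)\<^sup>2 / b)))) \<longlonglongrightarrow> 0"
  using assms by real_asymp

text \<open>The logarithm of the number of grid points is sublinear because \<open>a < 1\<close>,
  and the linear Chernoff exponent absorbs it.\<close>

lemma covering_rate:
  fixes a e m A \<kappa> :: real
  assumes "0 < a" "a < 1" "e > 0"
  shows "(\<lambda>n. exp (\<kappa> * real n powr a * (A + m * ln (real n)) - e * real n)) \<longlonglongrightarrow> 0"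
  using assms by real_asymp

text \<open>Eventually \<open>k n \<le> 2 * n powr a\<close> and \<open>1 \<le> n powr a\<close>, so
  \<open>1 + k n * (p + 2)\<close> is at most \<open>1 + 2 * (p + 2) = 2 * p + 5\<close> times
  \<open>n powr a\<close>.\<close>

lemma nparams_rate:
  assumes "0 < a" "(\<lambda>n. real (k n)) \<sim>[at_top] (\<lambda>n. real n powr a)"
  shows "eventually (\<lambda>n. real (nparams p (k n)) \<le> real (2 * p + 5) * real n powr a) at_top"
proof -
  have "((\<lambda>n. real (k n) / real n powr a) \<longlongrightarrow> 1) at_top"
  proof (rule asymp_equivD_strong[OF assms(2)])
    show "eventually (\<lambda>n. real (k n) \<noteq> 0 \<or> real n powr a \<noteq> 0) at_top"
      using eventually_gt_at_top[of 0] by eventually_elim simp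
  qed
  then have "eventually (\<lambda>n. real (k n) / real n powr a < 2) at_top"
    by (rule order_tendstoD) simp
  then show ?thesis using eventually_ge_at_top[of 1]
  proof eventually_elim
    case (elim n)
    then have k: "real (k n) \<le> 2 * real n powr a" by (simp add: divide_simps split: if_splits)
    have "1 \<le> real n powr a" using elim assms(1) by (simp add: ge_one_powr_ge_zero)
    moreover have "real (nparams p (k n)) = 1 + real (k n) * real (p + 2)"
      by (simp add: nparams_def algebra_simps)
    moreover have "real (k n) * real (p + 2) \<le> 2 * real n powr a * real (p + 2)"
      using k by (rule mult_right_mono) simp
    ultimately show ?case by (simp add: algebra_simps)
  qed
qed

text \<open>The quotient is \<open>(L n)\<^sup>2 * n powr \<delta>\<close>, which for
  \<open>\<delta> \<ge> 0\<close> is at most the square of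
  \<open>L n * n powr \<delta>\<close>.\<close>

lemma L2_rate:
  fixes L :: "nat \<Rightarrow> real"
  assumes d: "0 \<le> \<delta>" and L: "L \<in> o(\<lambda>n. real n powr (- \<delta>))"
  shows "(\<lambda>n. real n * (L n)\<^sup>2 / real n powr (1 - \<delta>)) \<longlonglongrightarrow> 0"
proof -
  have lim: "(\<lambda>n. L n / real n powr (- \<delta>)) \<longlonglongrightarrow> 0"
    using L by (rule smalloD_tendsto)
  then have lim2: "(\<lambda>n. (L n / real n powr (- \<delta>))\<^sup>2) \<longlonglongrightarrow> 0"
    using tendsto_power[OF lim, of 2] by simp
  show ?thesis
  proof (rule tendsto_sandwich[OF _ _ tendsto_const lim2])
    show "eventually (\<lambda>n. 0 \<le> real n * (L n)\<^sup>2 / real n powr (1 - \<delta>)) at_top" by simp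
    show "eventually (\<lambda>n. real n * (L n)\<^sup>2 / real n powr (1 - \<delta>) \<le> (L n / real n powr (- \<delta>))\<^sup>2) at_top"
      using eventually_ge_at_top[of 1]
    proof eventually_elim
      case (elim n)
      have p1: "real n powr \<delta> \<ge> 1" using elim d by (simp add: ge_one_powr_ge_zero)
      have "real n * (L n)\<^sup>2 / real n powr (1 - \<delta>) = (L n)\<^sup>2 * real n powr \<delta>"
        using elim by (simp add: powr_diff)
      also have "\<dots> \<le> (L n)\<^sup>2 * (real n powr \<delta> * real n powr \<delta>)"
        using mult_right_mono[OF p1, of "real n powr \<delta>"] by (intro mult_left_mono) auto
      also have "\<dots> = (L n / real n powr (- \<delta>))\<^sup>2"
        using elim by (simp add: powr_minus power_divide power2_eq_square divide_inverse)
      finally show ?case .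
    qed
  qed
qed

theorem theorem2:
  fixes p :: nat and k :: "nat \<Rightarrow> nat" and f0 :: "(nat \<Rightarrow> real) \<Rightarrow> real"
    and \<sigma>0 a \<delta> v \<zeta> u :: real
    and \<theta>0 :: "nat \<Rightarrow> nat \<Rightarrow> real"
    and qstar :: "nat \<Rightarrow> (nat \<Rightarrow> real \<times> (nat \<Rightarrow> real)) \<Rightarrow> (nat \<Rightarrow> real) measure"
  assumes p_pos: "p \<ge> 1"
    and sigma_pos: "\<sigma>0 > 0"
    and f0_meas: "f0 \<in> borel_measurable (Xmeas p)"
    and f0_L2: "integrable (Xmeas p) (\<lambda>x. (f0 x)\<^sup>2)"
    and a: "0 < a" "a < 1"
    and kn: "(\<lambda>n. real (k n)) \<sim>[at_top] (\<lambda>n. real n powr a)"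
    and delta: "0 \<le> \<delta>" "\<delta> < 1 - a"
    and v: "v > 1"
    and A1: "(\<lambda>n. L2dist p (nn p (k n) (\<theta>0 n)) f0) \<in> o(\<lambda>n. real n powr (- \<delta>))"
    and A3: "(\<lambda>n. \<Sum>i<nparams p (k n). (\<theta>0 n i)\<^sup>2) \<in> O(\<lambda>n. real n powr v)"
    and zeta: "\<zeta> > 0"
    and u: "u > v"
    and qstar_in: "\<And>n D. D \<in> space (data_law p \<sigma>0 f0 n) \<Longrightarrow>
                      qstar n D \<in> mf_family (nparams p (k n))"
    and qstar_min: "\<And>n D q. D \<in> space (data_law p \<sigma>0 f0 n) \<Longrightarrow> q \<in> mf_family (nparams p (k n)) \<Longrightarrow>
                      dKL (qstar n D) (posterior p (k n) \<sigma>0 \<zeta> u n D)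
                        \<le> dKL q (posterior p (k n) \<sigma>0 \<zeta> u n D)"
  shows "\<forall>\<epsilon>>0. small_o_prob (data_law p \<sigma>0 f0)
            (\<lambda>n D. measure (qstar n D) (Vc p (k n) \<sigma>0 f0 \<epsilon>))
            (\<lambda>n. real n powr (- \<delta>))"
  unfolding small_o_prob_def
proof (intro allI impI)
  fix \<epsilon> \<tau> :: real assume \<epsilon>: "\<epsilon> > 0" and \<tau>: "\<tau> > 0"
  interpret regression p \<sigma>0 f0
    using sigma_pos f0_meas f0_L2 by unfold_locales
  let ?K = "\<lambda>n. nparams p (k n)"
  let ?S = "\<lambda>n. \<Sum>i<?K n. (\<theta>0 n i)\<^sup>2"
  let ?L = "\<lambda>n. L2dist p (nn p (k n) (\<theta>0 n)) f0"

  \<comment> \<open>\<open>E\<close> is the constant of \<open>gauss_exp_abs_finite\<close>. With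
    \<open>\<kappa> = \<epsilon> / 4\<close>, the tilt \<open>b\<close> is so small that the two
    error terms in the mean of the tilted square root cost at most \<open>\<epsilon> / 8\<close>
    each, leaving \<open>1 - \<epsilon> / 4 \<le> \<rho>\<close>. The cap \<open>b \<le> 1\<close>
    is the range of \<open>exp_minus_one_convex\<close>.\<close>
  define E where "E = sqrt 2 * exp (4 * \<sigma>0\<^sup>2)"
  have E: "E > 0" by (simp add: E_def)
  define b where "b = min 1 (\<epsilon> / (4 * sqrt E))"
  have b: "0 < b" "b \<le> 1" "b \<le> \<epsilon> / (4 * sqrt E)" using \<epsilon> E by (auto simp: b_def)
  \<comment> \<open>The uniform tolerance within a cell, set so that the resulting tilt is exactly
    \<open>b\<close>.\<close>
  define \<eta> where "\<eta> = 2 * \<sigma>0\<^sup>2 * b"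
  have \<eta>: "0 < \<eta>" "\<eta> \<le> 2 * \<sigma>0\<^sup>2" "\<eta> / (2 * \<sigma>0\<^sup>2) = b"
    using b sigma_pos by (auto simp: \<eta>_def)
  define \<rho> where "\<rho> = exp (- \<epsilon> / 4)"
  have \<rho>: "1 - \<epsilon> / 2 + (\<epsilon> / 4) / 2 + (\<eta> / (2 * \<sigma>0\<^sup>2))\<^sup>2 / (2 * (\<epsilon> / 4)) * (sqrt 2 * exp (4 * \<sigma>0\<^sup>2)) \<le> \<rho>"
  proof -
    have "b\<^sup>2 \<le> (\<epsilon> / (4 * sqrt E))\<^sup>2" using b by (intro power_mono) auto
    also have "\<dots> = \<epsilon>\<^sup>2 / (16 * E)" using E by (simp add: power_divide power_mult_distrib)
    finally have "b\<^sup>2 * E \<le> \<epsilon>\<^sup>2 / 16" using E by (simp add: field_simps)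
    then have "b\<^sup>2 * E / (2 * (\<epsilon> / 4)) \<le> \<epsilon>\<^sup>2 / 16 / (2 * (\<epsilon> / 4))"
      using \<epsilon> by (intro divide_right_mono) auto
    also have "\<dots> = \<epsilon> / 8" using \<epsilon> by (simp add: power2_eq_square)
    finally have "b\<^sup>2 / (2 * (\<epsilon> / 4)) * E \<le> \<epsilon> / 8" by simp
    moreover have "1 + - \<epsilon> / 4 \<le> \<rho>" unfolding \<rho>_def by (rule exp_ge_add_one_self)
    ultimately show ?thesis unfolding \<eta>(3) E_def[symmetric] by simp
  qed

  define \<kappa>0 where "\<kappa>0 = real (2 * p + 5)"
  have \<kappa>0: "\<kappa>0 \<ge> 1" by (simp add: \<kappa>0_def)
  obtain c0 where c0: "c0 > 0" "eventually (\<lambda>n. norm (?S n) \<le> c0 * norm (real n powr v)) at_top"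
    using A3 by (auto elim: landau_o.bigE)
  \<comment> \<open>With \<open>t = c * n\<close>, the product
    \<open>exp (t / 2) * \<rho> ^ n\<close> is \<open>exp (- (\<epsilon> / 8 * n))\<close>: half of
    the Chernoff exponent pays for the weight, half is left for the grid.\<close>
  define c where "c = \<epsilon> / 4"
  have c: "c > 0" using \<epsilon> by (simp add: c_def)
  define e where "e = 1 - \<delta>"
  have e: "a < e" "e > 0" using delta a by (auto simp: e_def)
  \<comment> \<open>The total allowance is \<open>c * n * (\<tau> * n powr (- \<delta>)) = \<tau> *
    c * n powr e\<close>. Half goes to the log ratio, half to the entropy and
    \<open>ln (n + 2)\<close>.\<close>
  define w where "w n = \<tau> * c / 2 * real n powr e" for n
  \<comment> \<open>Small enough to keep the contribution of the parameter noise to the mean log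
    ratio bounded, although \<open>B\<close> may grow like \<open>n powr v\<close>; in the entropy
    it costs only a multiple of \<open>ln n\<close> per coordinate.\<close>
  define s where "s n = real n powr (- (v + 2))" for n
  define s0 where "s0 n = sqrt (\<zeta>\<^sup>2 * real n powr u)" for n
  \<comment> \<open>The extra power of \<open>n\<close> over the prior scale makes
    \<open>C\<^sup>2 / s0\<^sup>2\<close> equal to
    \<open>n\<^sup>2 / \<zeta>\<^sup>2\<close>.\<close>
  define C where "C n = real n powr (u / 2 + 1)" for n
  \<comment> \<open>\<open>\<bar>x\<bar> \<le> 1 + x\<^sup>2\<close> bounds every coordinate without
    a square root.\<close>
  define B where "B n = 1 + ?S n" for n
  \<comment> \<open>The mesh at which the Lipschitz constant over the cube yields the tolerance
    \<open>\<eta>\<close>.\<close>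
  define d where "d n = \<eta> / (real (?K n) * (1 + C n))" for n
  \<comment> \<open>Radius over mesh is \<open>C * ?K * (1 + C) / \<eta>\<close>, of order at most
    \<open>n powr (u + 3)\<close>; \<open>A\<close> collects the constants.\<close>
  define A where "A = 4 * \<kappa>0 / \<eta> + 2"
  have A: "A \<ge> 2" using \<kappa>0 \<eta> by (simp add: A_def)
  define c1 where "c1 = \<kappa>0 * (\<kappa>0 * (2 + c0))\<^sup>2 / \<sigma>0\<^sup>2 + 1"
  define c2 where "c2 = (\<kappa>0 + c0) / (2 * \<zeta>\<^sup>2)"

  define bd where "bd n = (real n / \<sigma>0\<^sup>2 * (?L n)\<^sup>2 + c1) / w n + 1 / real n
      + exp (c * real n) * (\<kappa>0 * real n * (sqrt 2 * exp (- (real n)\<^sup>2 / (4 * \<zeta>\<^sup>2))))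
      + exp (\<kappa>0 * real n powr a * (ln A + (u + 3) * ln (real n)) - \<epsilon> / 8 * real n)" for n
  have bd: "bd \<longlonglongrightarrow> 0"
  proof -
    have "(\<lambda>n. 2 / (\<tau> * c * \<sigma>0\<^sup>2) * (real n * (?L n)\<^sup>2 / real n powr (1 - \<delta>)) + 2 * c1 / (\<tau> * c) * (1 / real n powr e)) \<longlonglongrightarrow> 2 / (\<tau> * c * \<sigma>0\<^sup>2) * 0 + 2 * c1 / (\<tau> * c) * 0"
      using e(2) by (intro tendsto_add tendsto_mult tendsto_const L2_rate[OF delta(1) A1]) real_asymp
    moreover have "2 / (\<tau> * c * \<sigma>0\<^sup>2) * (real n * (?L n)\<^sup>2 / real n powr (1 - \<delta>)) + 2 * c1 / (\<tau> * c) * (1 / real n powr e)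
       = (real n / \<sigma>0\<^sup>2 * (?L n)\<^sup>2 + c1) / w n" for n
      unfolding w_def e_def[symmetric] using \<tau> c sigma_pos by (cases "n = 0") (auto simp: field_simps)
    ultimately have 1: "(\<lambda>n. (real n / \<sigma>0\<^sup>2 * (?L n)\<^sup>2 + c1) / w n) \<longlonglongrightarrow> 0" by simp
    have 2: "(\<lambda>n. 1 / real n) \<longlonglongrightarrow> 0" by real_asymp
    have "(\<lambda>n. bd n) \<longlonglongrightarrow> 0 + 0 + 0 + 0"
      unfolding bd_def using c zeta a \<epsilon>
      by (intro tendsto_add 1 2 tail_rate covering_rate) auto
    then show ?thesis by simp
  qed

  have ev_entropy: "eventually (\<lambda>n. \<kappa>0 * (real n powr a * (ln \<zeta> + (u / 2 + v + 2) * ln (real n)) / real n powr e)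
      + c2 / real n powr e + ln (real n + 2) / real n powr e < \<tau> * c / 2) at_top"
    using \<tau> c by (intro order_tendstoD[OF entropy_rate[OF a(1) e(1)]]) simp
  have ev_s: "eventually (\<lambda>n. real n powr (- (v + 2)) \<le> \<zeta> * real n powr (u / 2)) at_top"
    using zeta v u by real_asymp

  have "eventually (\<lambda>n. outer_prob (data n) {D \<in> space (data n). \<tau> * real n powr (- \<delta>) < \<bar>measure (qstar n D) (Vc p (k n) \<sigma>0 f0 \<epsilon>)\<bar>} \<in> {0..bd n}) at_top"
    using eventually_ge_at_top[of 1] nparams_rate[OF a(1) kn, of p] c0(2) ev_entropy ev_s
  proof eventually_elim
    case (elim n)
    have n: "n \<ge> 1" and n1: "real n \<ge> 1" using elim(1) by auto
    have pw: "real n powr x \<le> real n powr y" if "x \<le> y" for x y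
      using n1 that by (rule powr_mono[rotated])
    have pw0: "real n powr x > 0" for x using n1 by simp
    have Ka: "real (?K n) \<le> \<kappa>0 * real n powr a" using elim(2) by (simp add: \<kappa>0_def)
    have K1: "real (?K n) \<ge> 1" by (simp add: nparams_def)
    have Kn: "real (?K n) \<le> \<kappa>0 * real n"
    proof -
      have "\<kappa>0 * real n powr a \<le> \<kappa>0 * real n powr 1"
        using a \<kappa>0 by (intro mult_left_mono pw) auto
      then show ?thesis using Ka n1 by simp
    qed
    have S: "0 \<le> ?S n" "?S n \<le> c0 * real n powr v" using elim(3) by (auto simp: sum_nonneg)
    have s0eq: "s0 n = \<zeta> * real n powr (u / 2)"
      using zeta n1 by (simp add: s0_def real_sqrt_mult powr_half_sqrt[symmetric] powr_powr)
    have s0sq: "(s0 n)\<^sup>2 = \<zeta>\<^sup>2 * real n powr u" by (simp add: s0_def)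
    have sn: "0 < s n" "s n \<le> s0 n" using elim(5) pw0 by (auto simp: s_def s0eq)
    have s0n: "s0 n > 0" using sn by linarith
    have Cn: "C n \<ge> 1" using n1 u v by (simp add: C_def ge_one_powr_ge_zero)
    have Bn: "\<forall>i<?K n. \<bar>\<theta>0 n i\<bar> \<le> B n"
    proof (intro allI impI)
      fix i assume "i < ?K n"
      then have "(\<theta>0 n i)\<^sup>2 \<le> ?S n" by (intro member_le_sum) auto
      moreover have "2 * \<bar>\<theta>0 n i\<bar> \<le> 1 + (\<theta>0 n i)\<^sup>2"
        using sum_squares_bound[of 1 "\<bar>\<theta>0 n i\<bar>"] by simp
      moreover have "0 \<le> \<bar>\<theta>0 n i\<bar>" by simp
      ultimately show "\<bar>\<theta>0 n i\<bar> \<le> B n" unfolding B_def by linarith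
    qed
    have dn: "d n > 0" "real (?K n) * (1 + C n) * d n \<le> \<eta>"
      using \<eta> K1 Cn by (auto simp: d_def)
    have wn: "w n > 0" using \<tau> c pw0 by (simp add: w_def)
    obtain Bad where Bad: "Bad \<in> sets (data n)"
      and prob: "measure (data n) Bad \<le> (real n / \<sigma>0\<^sup>2 * ((?L n)\<^sup>2
            + (real (?K n) * (1 + B n))\<^sup>2 * (real (?K n) * (s n)\<^sup>2)) + 1) / w n + 1 / real n
          + exp (c * real n) * (real (?K n) * (sqrt 2 * exp (- (C n)\<^sup>2 / (4 * (s0 n)\<^sup>2))))
          + (2 * C n / d n + 2) ^ ?K n * (exp (c * real n / 2) * \<rho> ^ n)"
      and good: "\<And>D m s'. D \<in> space (data n) - Bad \<Longrightarrow> \<forall>i<?K n. s' i > 0 \<Longrightarrow>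
         dKL (gprod (?K n) m s') (gauss_posterior (k n) (s0 n) n D)
           \<le> dKL (gprod (?K n) (\<theta>0 n) (\<lambda>_. s n)) (gauss_posterior (k n) (s0 n) n D) \<Longrightarrow>
         c * real n * measure (gprod (?K n) m s') (Vc p (k n) \<sigma>0 f0 \<epsilon>)
           \<le> (\<Sum>i<?K n. ln (s0 n / s n) + ((s n)\<^sup>2 + (\<theta>0 n i)\<^sup>2) / (2 * (s0 n)\<^sup>2)) + w n + ln (real n + 2)"
      using variational_mass_event[OF n sn _ Bn \<epsilon> dn less_imp_le[OF \<eta>(1)] \<eta>(2) _ \<rho> _ _ wn, of "c * real n"] Cn \<epsilon> c
      by (auto simp: \<rho>_def)

    have le_bd: "measure (data n) Bad \<le> bd n"
    proof -
      have "(real n / \<sigma>0\<^sup>2 * ((?L n)\<^sup>2 + (real (?K n) * (1 + B n))\<^sup>2 * (real (?K n) * (s n)\<^sup>2)) + 1) / w n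
        \<le> (real n / \<sigma>0\<^sup>2 * (?L n)\<^sup>2 + c1) / w n"
      proof -
        have "1 + B n \<le> (2 + c0) * real n powr v"
          using S(2) ge_one_powr_ge_zero[OF n1, of v] v by (simp add: B_def distrib_right)
        then have "(real (?K n) * (1 + B n))\<^sup>2 \<le> (\<kappa>0 * real n * ((2 + c0) * real n powr v))\<^sup>2"
          using Kn S \<kappa>0 by (intro power_mono mult_mono) (auto simp: B_def)
        moreover have "real (?K n) * (s n)\<^sup>2 \<le> \<kappa>0 * real n * (s n)\<^sup>2"
          using Kn by (intro mult_right_mono) auto
        ultimately have "(real (?K n) * (1 + B n))\<^sup>2 * (real (?K n) * (s n)\<^sup>2)
          \<le> (\<kappa>0 * real n * ((2 + c0) * real n powr v))\<^sup>2 * (\<kappa>0 * real n * (s n)\<^sup>2)"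
          by (rule mult_mono) auto
        also have "\<dots> = \<kappa>0 * (\<kappa>0 * (2 + c0))\<^sup>2 * (real n * real n * real n * (real n powr v * s n)\<^sup>2)"
          by (simp add: power2_eq_square mult_ac)
        \<comment> \<open>The \<open>v\<close> in the exponent of \<open>s\<close> cancels the
          growth of \<open>B\<close>. The square of the remaining \<open>1 / n\<^sup>2\<close>
          outweighs the three factors \<open>n\<close> from \<open>?K\<close> by the one power of
          \<open>n\<close> that stands in front.\<close>
        also have "real n powr v * s n = inverse (real n * real n)"
          using n1 by (simp add: s_def powr_add[symmetric]) (simp add: powr_minus powr_numeral power2_eq_square)
        finally have "(real (?K n) * (1 + B n))\<^sup>2 * (real (?K n) * (s n)\<^sup>2) \<le> \<kappa>0 * (\<kappa>0 * (2 + c0))\<^sup>2 / real n"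
          using n1 by (simp add: power2_eq_square field_simps)
        then have "real n / \<sigma>0\<^sup>2 * ((real (?K n) * (1 + B n))\<^sup>2 * (real (?K n) * (s n)\<^sup>2))
            \<le> real n / \<sigma>0\<^sup>2 * (\<kappa>0 * (\<kappa>0 * (2 + c0))\<^sup>2 / real n)"
          by (intro mult_left_mono) auto
        also have "\<dots> = \<kappa>0 * (\<kappa>0 * (2 + c0))\<^sup>2 / \<sigma>0\<^sup>2" using n1 by simp
        finally show ?thesis
          using wn by (intro divide_right_mono) (auto simp: c1_def distrib_left)
      qed
      moreover have "exp (c * real n) * (real (?K n) * (sqrt 2 * exp (- (C n)\<^sup>2 / (4 * (s0 n)\<^sup>2))))
        \<le> exp (c * real n) * (\<kappa>0 * real n * (sqrt 2 * exp (- (real n)\<^sup>2 / (4 * \<zeta>\<^sup>2))))"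
      proof -
        have "(C n)\<^sup>2 = real n powr u * (real n)\<^sup>2"
          using n1 by (simp add: C_def power2_eq_square powr_add[symmetric] powr_add)
        then have "(C n)\<^sup>2 / (4 * (s0 n)\<^sup>2) = (real n)\<^sup>2 / (4 * \<zeta>\<^sup>2)"
          unfolding s0sq using pw0[of u] by simp
        then show ?thesis using Kn by (simp add: mult_right_mono)
      qed
      moreover have "(2 * C n / d n + 2) ^ ?K n * (exp (c * real n / 2) * \<rho> ^ n)
        \<le> exp (\<kappa>0 * real n powr a * (ln A + (u + 3) * ln (real n)) - \<epsilon> / 8 * real n)"
      proof -
        let ?X = "2 * C n / d n + 2"
        have X1: "?X \<ge> 1" using Cn dn by simp
        have "2 * C n / d n = 2 * (C n * (real (?K n) * (1 + C n))) / \<eta>"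
          using \<eta> by (simp add: d_def)
        also have "\<dots> \<le> 2 * (C n * ((\<kappa>0 * real n) * (2 * C n))) / \<eta>"
          using \<eta> Cn Kn \<kappa>0 by (intro divide_right_mono mult_left_mono mult_mono) auto
        also have "C n * ((\<kappa>0 * real n) * (2 * C n)) = 2 * \<kappa>0 * real n powr (u + 3)"
        proof -
          have "C n * C n = real n powr (u + 2)" by (simp add: C_def powr_add[symmetric])
          then have "real n * (C n * C n) = real n powr (u + 3)"
            using n1 powr_add[of "real n" 1 "u + 2"] by (simp add: add.commute)
          moreover have "C n * ((\<kappa>0 * real n) * (2 * C n)) = 2 * \<kappa>0 * (real n * (C n * C n))" by simp
          ultimately show ?thesis by (simp only:)
        qed
        finally have "?X \<le> 4 * \<kappa>0 / \<eta> * real n powr (u + 3) + 2" by simp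
        also have "2 \<le> 2 * real n powr (u + 3)" using n1 u v by (simp add: ge_one_powr_ge_zero)
        finally have "?X \<le> A * real n powr (u + 3)" by (simp add: A_def algebra_simps)
        then have "ln ?X \<le> ln (A * real n powr (u + 3))" using X1 by simp
        also have "\<dots> = ln A + (u + 3) * ln (real n)"
          using A n1 by (simp add: ln_mult ln_powr)
        finally have lnX: "ln ?X \<le> ln A + (u + 3) * ln (real n)" .
        have "real (?K n) * ln ?X \<le> (\<kappa>0 * real n powr a) * (ln A + (u + 3) * ln (real n))"
          using Ka lnX X1 \<kappa>0 by (intro mult_mono) auto
        moreover have "?X ^ ?K n = exp (real (?K n) * ln ?X)"
          using X1 by (simp add: exp_of_nat_mult)
        ultimately have "?X ^ ?K n \<le> exp ((\<kappa>0 * real n powr a) * (ln A + (u + 3) * ln (real n)))"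
          by simp
        moreover have "exp (c * real n / 2) * \<rho> ^ n = exp (- (\<epsilon> / 8 * real n))"
          by (simp add: \<rho>_def c_def exp_of_nat_mult[symmetric] exp_add[symmetric] algebra_simps)
        ultimately have "?X ^ ?K n * (exp (c * real n / 2) * \<rho> ^ n)
          \<le> exp ((\<kappa>0 * real n powr a) * (ln A + (u + 3) * ln (real n))) * exp (- (\<epsilon> / 8 * real n))"
          by simp
        then show ?thesis by (simp only: exp_add[symmetric] add_uminus_conv_diff)
      qed
      ultimately show ?thesis using prob unfolding bd_def by linarith
    qed
    have sub_Bad: "{D \<in> space (data n). \<tau> * real n powr (- \<delta>) < \<bar>measure (qstar n D) (Vc p (k n) \<sigma>0 f0 \<epsilon>)\<bar>} \<subseteq> Bad"
    proof (rule subsetI, rule ccontr)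
      fix D assume D: "D \<in> {D \<in> space (data n). \<tau> * real n powr (- \<delta>) < \<bar>measure (qstar n D) (Vc p (k n) \<sigma>0 f0 \<epsilon>)\<bar>}"
        and "D \<notin> Bad"
      then have DS: "D \<in> space (data n)" and DG: "D \<in> space (data n) - Bad" by auto
      obtain m s' where ms: "qstar n D = gprod (?K n) m s'" "\<forall>i<?K n. s' i > 0"
        using qstar_in[OF DS] by (auto simp: mf_family_def gprod_def)
      have post: "posterior p (k n) \<sigma>0 \<zeta> u n D = gauss_posterior (k n) (s0 n) n D"
        by (simp add: posterior_def gauss_posterior_def prior_def gprod_def s0_def)
      have "gprod (?K n) (\<theta>0 n) (\<lambda>_. s n) \<in> mf_family (?K n)"
        unfolding mf_family_def gprod_def mem_Collect_eq using sn(1) by (intro exI[of _ "\<theta>0 n"] exI[of _ "\<lambda>_. s n"]) simp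
      from qstar_min[OF DS this, unfolded post ms(1)]
      have mass: "c * real n * measure (qstar n D) (Vc p (k n) \<sigma>0 f0 \<epsilon>)
           \<le> (\<Sum>i<?K n. ln (s0 n / s n) + ((s n)\<^sup>2 + (\<theta>0 n i)\<^sup>2) / (2 * (s0 n)\<^sup>2)) + w n + ln (real n + 2)"
        unfolding ms(1) by (rule good[OF DG ms(2)])
      have "(\<Sum>i<?K n. ln (s0 n / s n) + ((s n)\<^sup>2 + (\<theta>0 n i)\<^sup>2) / (2 * (s0 n)\<^sup>2))
        = real (?K n) * ln (s0 n / s n) + (real (?K n) * (s n)\<^sup>2 + ?S n) / (2 * (s0 n)\<^sup>2)"
        unfolding sum.distrib sum_divide_distrib[symmetric] by simp
      also have "\<dots> \<le> \<kappa>0 * real n powr a * (ln \<zeta> + (u / 2 + v + 2) * ln (real n)) + c2"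
      proof (rule add_mono)
        have "s0 n / s n = \<zeta> * real n powr (u / 2 + v + 2)"
        proof -
          have "u / 2 - - (v + 2) = u / 2 + v + 2" by simp
          then have "real n powr (u / 2) / real n powr (- (v + 2)) = real n powr (u / 2 + v + 2)"
            using powr_diff[of "real n" "u / 2" "- (v + 2)"] n1 by metis
          then show ?thesis unfolding s0eq s_def times_divide_eq_right[symmetric] by (rule arg_cong)
        qed
        then have "ln (s0 n / s n) = ln \<zeta> + (u / 2 + v + 2) * ln (real n)"
          using zeta n1 by (simp add: ln_mult ln_powr)
        moreover have "0 \<le> ln (s0 n / s n)" using sn by (intro ln_ge_zero) (simp add: divide_simps)
        ultimately show "real (?K n) * ln (s0 n / s n) \<le> \<kappa>0 * real n powr a * (ln \<zeta> + (u / 2 + v + 2) * ln (real n))"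
          using Ka by (metis mult_right_mono)
        have "(s n)\<^sup>2 \<le> inverse (real n)"
        proof -
          have "(s n)\<^sup>2 = real n powr (- (2 * v + 4))" by (simp add: s_def power2_eq_square powr_add[symmetric])
          also have "\<dots> \<le> real n powr (- 1)" using v by (intro pw) simp
          finally show ?thesis using n1 by (simp add: powr_minus)
        qed
        then have "real (?K n) * (s n)\<^sup>2 \<le> (\<kappa>0 * real n) * inverse (real n)"
          using Kn \<kappa>0 by (intro mult_mono) auto
        then have "real (?K n) * (s n)\<^sup>2 \<le> \<kappa>0 * 1" using n1 by (simp add: mult.assoc)
        also have "\<dots> \<le> \<kappa>0 * real n powr u"
          using \<kappa>0 n1 u v by (intro mult_left_mono ge_one_powr_ge_zero) auto
        \<comment> \<open>Here \<open>u > v\<close> enters: the squared norm of the centre is at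
          most of the order of the prior variance.\<close>
        finally have "real (?K n) * (s n)\<^sup>2 + ?S n \<le> \<kappa>0 * real n powr u + c0 * real n powr u"
          using S(2) mult_left_mono[OF pw[of v u], of c0] u c0(1) by linarith
        then have "(real (?K n) * (s n)\<^sup>2 + ?S n) / (2 * (s0 n)\<^sup>2) \<le> ((\<kappa>0 + c0) * real n powr u) / (2 * (s0 n)\<^sup>2)"
          by (intro divide_right_mono) (auto simp: distrib_right)
        also have "\<dots> = c2" unfolding s0sq c2_def using pw0[of u] by simp
        finally show "(real (?K n) * (s n)\<^sup>2 + ?S n) / (2 * (s0 n)\<^sup>2) \<le> c2" .
      qed
      finally have entropy: "(\<Sum>i<?K n. ln (s0 n / s n) + ((s n)\<^sup>2 + (\<theta>0 n i)\<^sup>2) / (2 * (s0 n)\<^sup>2))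
        \<le> \<kappa>0 * real n powr a * (ln \<zeta> + (u / 2 + v + 2) * ln (real n)) + c2" .
      have rate: "\<kappa>0 * real n powr a * (ln \<zeta> + (u / 2 + v + 2) * ln (real n)) + c2 + w n + ln (real n + 2)
        \<le> \<tau> * c * real n powr e"
      proof -
        let ?Y = "\<kappa>0 * real n powr a * (ln \<zeta> + (u / 2 + v + 2) * ln (real n)) + c2 + ln (real n + 2)"
        have "?Y / real n powr e < \<tau> * c / 2"
          using elim(4) by (simp add: add_divide_distrib mult.assoc)
        then have "?Y < \<tau> * c / 2 * real n powr e" using pw0[of e] by (simp add: divide_less_eq)
        then show ?thesis by (simp add: w_def)
      qed
      have "\<tau> * c * real n powr e = c * real n * (\<tau> * real n powr (- \<delta>))"
        using n1 by (simp add: e_def powr_diff powr_minus divide_inverse)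
      with mass entropy rate have "c * real n * measure (qstar n D) (Vc p (k n) \<sigma>0 f0 \<epsilon>)
          \<le> c * real n * (\<tau> * real n powr (- \<delta>))"
        by linarith
      then have "measure (qstar n D) (Vc p (k n) \<sigma>0 f0 \<epsilon>) \<le> \<tau> * real n powr (- \<delta>)"
        using c n1 by simp
      then show False using D by simp
    qed
    show ?case
      unfolding atLeastAtMost_iff
      using outer_prob_bounds(1)[OF Bad sub_Bad] order_trans[OF outer_prob_bounds(2)[OF Bad sub_Bad] le_bd] by (rule conjI)
  qed
  then have "eventually (\<lambda>n. 0 \<le> outer_prob (data n) {D \<in> space (data n). \<tau> * real n powr (- \<delta>) < \<bar>measure (qstar n D) (Vc p (k n) \<sigma>0 f0 \<epsilon>)\<bar>}) at_top"
    "eventually (\<lambda>n. outer_prob (data n) {D \<in> space (data n). \<tau> * real n powr (- \<delta>) < \<bar>measure (qstar n D) (Vc p (k n) \<sigma>0 f0 \<epsilon>)\<bar>} \<le> bd n) at_top"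
    by (auto elim: eventually_mono)
  then show "(\<lambda>n. outer_prob (data n) {D \<in> space (data n). \<tau> * real n powr (- \<delta>) < \<bar>measure (qstar n D) (Vc p (k n) \<sigma>0 f0 \<epsilon>)\<bar>}) \<longlonglongrightarrow> 0"
    by (rule tendsto_sandwich[OF _ _ tendsto_const bd])
qed

end
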